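(* Let $\mathbb{K}$ be a field, $S=\mathbb{K}[x_1,\ldots,x_n]$, let $\mathfrak{I}$ be a monomial ideal in $S$ with LCM-lattice $\mathrm{lcm}(\mathfrak{I})$, and let $i_1,i_2,k$ be integers such that $i_1,i_2 \geq 1$ and $0 \leq k \leq \min\{i_1,i_2\}$. Let $m \in \mathrm{lcm}(\mathfrak{I})$ be such that $\beta_{i_1+i_2-k,m}(S/\mathfrak{I}) \neq 0$. Then there exist $n_1, n_2 \in \mathrm{lcm}(\mathfrak{I})$, both dividing $m$, such that $m = \mathrm{lcm}(n_1,n_2)$, $\beta_{i_1,n_1}(S/\mathfrak{I}) \neq 0$ and $\beta_{i_2,n_2}(S/\mathfrak{I}) \neq 0$. In particular: (i) for all integers $i_1,i_2 \geq 0$ and $0 \leq k \leq \min\{i_1,i_2\}$, $$t_{i_1+i_2-k}(S/\mathfrak{I}) \leq t_{i_1}(S/\mathfrak{I}) + t_{i_2}(S/\mathfrak{I});$$ (ii) for all integers $i_1,i_2 \geq 0$, $$a_{i_1+i_2}(S/\mathfrak{I}) \leq a_{i_1}(S/\mathfrak{I}) \cdot a_{i_2}(S/\mathfrak{I}).$$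
   Context: The LCM-lattice $\mathrm{lcm}(\mathfrak{I})$ is the set of all least common multiples of subsets of the minimal monomial generating set of $\mathfrak{I}$ (the lcm of the empty set being $1$), ordered by divisibility. With $S$ multigraded by monomials, the multigraded Betti numbers are $\beta_{i,m}(S/\mathfrak{I}) = \dim_{\mathbb{K}} \mathrm{Tor}_i^S(S/\mathfrak{I},\mathbb{K})_m$ for a monomial $m$. It is known (Gasharov–Peeva–Welker) that for $i \ge 1$ and $1 \neq m \in \mathrm{lcm}(\mathfrak{I})$ one has $\beta_{i,m}(S/\mathfrak{I}) = \dim_{\mathbb{K}} \widetilde{H}_{i-2}((1,m))$, where $(1,m)$ is the open interval in $\mathrm{lcm}(\mathfrak{I})$ and $\widetilde{H}_*$ is reduced homology over $\mathbb{K}$ of its order complex. The graded Betti numbers are $\beta_{ij}(S/\mathfrak{I})=\dim_{\mathbb{K}}\mathrm{Tor}^S_i(S/\mathfrak{I},\mathbb{K})_j$ for the standard grading; $t_i(S/\mathfrak{I})$ is the maximal $j$ with $\beta_{ij}(S/\mathfrak{I})\neq 0$, and $t_i(S/\mathfrak{I})=0$ if there is no such $j$. Finally $a_i(S/\mathfrak{I})$ is the number of monomials $m$ (including possibly $m=1$) with $\beta_{i,m}(S/\mathfrak{I}) \neq 0$. *)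

theory Defs
  imports Complex_Main "HOL-Library.Poly_Mapping" "HOL-Library.Function_Algebras"
begin

section \<open>Monomial ideals and the LCM-lattice\<close>

text \<open>
  The variables are indexed by a finite type \<open>'n\<close>.  A monomial is given by its exponent vector,
  so multiplication of monomials is \<open>+\<close>, divisibility is the pointwise order \<open>\<le>\<close>, and the
  least common multiple of two monomials is \<open>sup\<close>.
\<close>

type_synonym 'n monomial = "'n \<Rightarrow> nat"

type_synonym ('n, 'k) mpoly = "'n monomial \<Rightarrow>\<^sub>0 'k"

definition monom_poly :: "'n monomial \<Rightarrow> ('n, 'k::field) mpoly" where
  "monom_poly m = Poly_Mapping.single m 1"

definition total_degree :: "'n::finite monomial \<Rightarrow> nat" where
  "total_degree m = (\<Sum>x\<in>UNIV. m x)"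

text \<open>The ideals of \<open>S\<close> are the submodules of \<open>S\<close> as a module over itself.\<close>

definition ideal_generated :: "('n, 'k::field) mpoly set \<Rightarrow> ('n, 'k) mpoly set" where
  "ideal_generated A = module.span (*) A"

definition monomial_ideal :: "('n, 'k::field) mpoly set \<Rightarrow> bool" where
  "monomial_ideal I \<longleftrightarrow> (\<exists>M. I = ideal_generated (monom_poly ` M))"

definition min_generators :: "('n, 'k::field) mpoly set \<Rightarrow> 'n monomial set" where
  "min_generators I = (THE G. ideal_generated (monom_poly ` G) = I \<and>
      (\<forall>H. H \<subset> G \<longrightarrow> ideal_generated (monom_poly ` H) \<noteq> I))"

text \<open>
  The supremum of the empty set of natural numbers is \<open>0\<close>, so \<open>lcm_monomials {}\<close> is the
  monomial \<open>1\<close>.  Sets of minimal generators are finite, hence the suprema below are maxima.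
\<close>

definition lcm_monomials :: "'n monomial set \<Rightarrow> 'n monomial" where
  "lcm_monomials A = (\<lambda>x. Sup ((\<lambda>m. m x) ` A))"

definition lcm_lattice :: "('n, 'k::field) mpoly set \<Rightarrow> 'n monomial set" where
  "lcm_lattice I = {lcm_monomials A | A. A \<subseteq> min_generators I}"


section \<open>Multigraded free resolutions\<close>

text \<open>
  Vectors over a ring are functions on \<open>nat\<close>; the free module of rank \<open>r\<close> consists of those
  vanishing outside \<open>{..<r}\<close>.
\<close>

definition free_mod :: "nat \<Rightarrow> (nat \<Rightarrow> 'a::zero) set" where
  "free_mod r = {v. \<forall>b\<ge>r. v b = 0}"

definition mat_app ::
    "nat \<Rightarrow> nat \<Rightarrow> (nat \<Rightarrow> nat \<Rightarrow> 'a::comm_ring_1) \<Rightarrow> (nat \<Rightarrow> 'a) \<Rightarrow> nat \<Rightarrow> 'a" where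
  "mat_app r s A v = (\<lambda>a. if a < r then (\<Sum>b<s. A a b * v b) else 0)"

text \<open>
  The data of a complex \<open>\<dots> \<rightarrow> F\<^sub>1 \<rightarrow> F\<^sub>0 \<rightarrow> S/I\<close> of finitely generated multigraded free modules:
  the \<open>i\<close>-th module is \<open>F\<^sub>i = \<Oplus>\<^bsub>b < rk i\<^esub> S(-mdeg i b)\<close>, \<open>dmat i\<close> is the matrix of the
  differential \<open>F\<^bsub>i+1\<^esub> \<rightarrow> F\<^sub>i\<close>, and \<open>aug b\<close> is a representative in \<open>S\<close> of the image of the
  \<open>b\<close>-th basis element of \<open>F\<^sub>0\<close> in \<open>S/I\<close>.
\<close>

record (overloaded) ('n, 'k) free_complex =
  rk :: "nat \<Rightarrow> nat"
  mdeg :: "nat \<Rightarrow> nat \<Rightarrow> 'n monomial"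
  dmat :: "nat \<Rightarrow> nat \<Rightarrow> nat \<Rightarrow> ('n, 'k) mpoly"
  aug :: "nat \<Rightarrow> ('n, 'k) mpoly"

definition diff_map ::
    "('n, 'k::field) free_complex \<Rightarrow> nat \<Rightarrow> (nat \<Rightarrow> ('n, 'k) mpoly) \<Rightarrow> nat \<Rightarrow> ('n, 'k) mpoly" where
  "diff_map F i = mat_app (rk F i) (rk F (Suc i)) (dmat F i)"

definition aug_map ::
    "('n, 'k::field) free_complex \<Rightarrow> (nat \<Rightarrow> ('n, 'k) mpoly) \<Rightarrow> ('n, 'k) mpoly" where
  "aug_map F v = (\<Sum>b<rk F 0. aug F b * v b)"

definition multihomogeneous :: "('n, 'k::field) free_complex \<Rightarrow> bool" where
  "multihomogeneous F \<longleftrightarrow>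
     (\<forall>b<rk F 0. \<forall>e\<in>Poly_Mapping.keys (aug F b). e = mdeg F 0 b) \<and>
     (\<forall>i. \<forall>a<rk F i. \<forall>b<rk F (Suc i). \<forall>e\<in>Poly_Mapping.keys (dmat F i a b).
        e + mdeg F i a = mdeg F (Suc i) b)"

text \<open>
  The last three conditions are exactness of \<open>\<dots> \<rightarrow> F\<^sub>1 \<rightarrow> F\<^sub>0 \<rightarrow> S/I \<rightarrow> 0\<close> at \<open>S/I\<close>, at \<open>F\<^sub>0\<close> and
  at \<open>F\<^bsub>i+1\<^esub>\<close>.
\<close>

definition free_resolution :: "('n, 'k::field) mpoly set \<Rightarrow> ('n, 'k) free_complex \<Rightarrow> bool" where
  "free_resolution I F \<longleftrightarrow>
     multihomogeneous F \<and>
     (\<forall>p. \<exists>v\<in>free_mod (rk F 0). p - aug_map F v \<in> I) \<and>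
     {v \<in> free_mod (rk F 0). aug_map F v \<in> I} = diff_map F 0 ` free_mod (rk F 1) \<and>
     (\<forall>i. {v \<in> free_mod (rk F (Suc i)). diff_map F i v = 0}
            = diff_map F (Suc i) ` free_mod (rk F (Suc (Suc i))))"


section \<open>Tor and Betti numbers\<close>

text \<open>
  Tensoring with \<open>K = S/(x\<^sub>1, \<dots>, x\<^sub>n)\<close> replaces every matrix entry by its constant term.  For a
  set \<open>D\<close> of multidegrees, \<open>tensor_part F i D\<close> is the part of \<open>F\<^sub>i \<otimes>\<^sub>S K\<close> in degrees \<open>D\<close>; taking
  \<open>D\<close> to be a singleton gives a multigraded component, and taking \<open>D\<close> to be all monomials of
  total degree \<open>j\<close> gives a component for the standard grading.
\<close>

definition tensor_diff ::
    "('n, 'k::field) free_complex \<Rightarrow> nat \<Rightarrow> (nat \<Rightarrow> 'k) \<Rightarrow> nat \<Rightarrow> 'k" where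
  "tensor_diff F i =
     mat_app (rk F i) (rk F (Suc i)) (\<lambda>a b. Poly_Mapping.lookup (dmat F i a b) 0)"

definition tensor_part ::
    "('n, 'k::field) free_complex \<Rightarrow> nat \<Rightarrow> 'n monomial set \<Rightarrow> (nat \<Rightarrow> 'k) set" where
  "tensor_part F i D = {v \<in> free_mod (rk F i). \<forall>b<rk F i. v b \<noteq> 0 \<longrightarrow> mdeg F i b \<in> D}"

definition tensor_cycles ::
    "('n, 'k::field) free_complex \<Rightarrow> nat \<Rightarrow> 'n monomial set \<Rightarrow> (nat \<Rightarrow> 'k) set" where
  "tensor_cycles F i D =
     (case i of 0 \<Rightarrow> tensor_part F 0 D
      | Suc j \<Rightarrow> {v \<in> tensor_part F (Suc j) D. tensor_diff F j v = 0})"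

definition tensor_boundaries ::
    "('n, 'k::field) free_complex \<Rightarrow> nat \<Rightarrow> 'n monomial set \<Rightarrow> (nat \<Rightarrow> 'k) set" where
  "tensor_boundaries F i D = tensor_diff F i ` tensor_part F (Suc i) D"

definition kdim :: "(nat \<Rightarrow> 'k::field) set \<Rightarrow> nat" where
  "kdim V = vector_space.dim (\<lambda>(c::'k) (v::nat \<Rightarrow> 'k) b. c * v b) V"

text \<open>
  \<open>tor_dim I i D\<close> is the dimension over \<open>K\<close> of the part of \<open>Tor\<^sub>i\<^sup>S(S/I, K)\<close> in degrees \<open>D\<close>, that
  is, of cycles modulo boundaries in \<open>F \<otimes>\<^sub>S K\<close> for a multigraded free resolution \<open>F\<close> of \<open>S/I\<close>.
  The choice of \<open>F\<close> is immaterial.  All spaces are finite-dimensional, and for a resolution the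
  boundaries are contained in the cycles, so the subtraction does not truncate.
\<close>

definition tor_dim ::
    "('n, 'k::field) mpoly set \<Rightarrow> nat \<Rightarrow> 'n monomial set \<Rightarrow> nat" where
  "tor_dim I i D =
     (let F = (SOME F. free_resolution I F)
      in kdim (tensor_cycles F i D) - kdim (tensor_boundaries F i D))"

definition multi_betti :: "('n, 'k::field) mpoly set \<Rightarrow> nat \<Rightarrow> 'n monomial \<Rightarrow> nat" where
  "multi_betti I i m = tor_dim I i {m}"

definition graded_betti :: "('n::finite, 'k::field) mpoly set \<Rightarrow> nat \<Rightarrow> nat \<Rightarrow> nat" where
  "graded_betti I i j = tor_dim I i {m. total_degree m = j}"

definition t_max :: "('n::finite, 'k::field) mpoly set \<Rightarrow> nat \<Rightarrow> nat" where
  "t_max I i = (if \<exists>j. graded_betti I i j \<noteq> 0 then Max {j. graded_betti I i j \<noteq> 0} else 0)"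

definition a_num :: "('n, 'k::field) mpoly set \<Rightarrow> nat \<Rightarrow> nat" where
  "a_num I i = card {m. multi_betti I i m \<noteq> 0}"

end

theory Submission
  imports Defs "HOL-Library.FuncSet"
begin

text \<open>
  Setting all variables to \<open>1\<close> turns a minimal multigraded free resolution \<open>P\<close> of \<open>S/I\<close> into a
  complex of vector spaces with a basis graded by monomials.  Its part in degrees \<open>\<le> x\<close> is exact
  whenever the monomial \<open>x\<close> lies in \<open>I\<close>, and its basis elements of degree \<open>m\<close> count the Betti
  numbers in degree \<open>m\<close>.  Give \<open>a \<otimes> b\<close> the lcm of the degrees of \<open>a\<close> and \<open>b\<close>; then \<open>P \<otimes> P\<close> has
  the same exactness properties, so \<open>z \<mapsto> z \<otimes> 1\<close> and \<open>z \<mapsto> 1 \<otimes> z\<close> are homotopic maps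
  \<open>P \<rightarrow> P \<otimes> P\<close>, and there is a multiplication \<open>P \<otimes> P \<rightarrow> P\<close>.  For a basis element \<open>z\<close> of
  homological degree \<open>n\<close> cut the element \<open>w\<close> realising \<open>z \<otimes> 1 \<sim> 1 \<otimes> z\<close> at a bidegree \<open>(p, q)\<close>
  with \<open>p + q = n\<close> and \<open>p \<ge> 1\<close>.  If no pair of basis elements in bidegree \<open>(p, q)\<close> had the degree
  of \<open>z\<close> as its lcm, the part of \<open>w\<close> up to the cut would have boundary \<open>- 1 \<otimes> z\<close> modulo lower
  degrees, and multiplying would make \<open>z\<close> a boundary modulo lower degrees, contradicting
  minimality.  The first factors occurring in \<open>w\<close> are iterated boundary components of \<open>z\<close>; replacing
  such a factor by one between it and \<open>z\<close> raises \<open>p\<close> to any value up to \<open>n\<close> without changing the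
  lcm, and this accounts for the parameter \<open>k\<close>.
\<close>

section \<open>Finite-rank free vector spaces\<close>

text \<open>After the variables are set to \<open>1\<close>, the degree-\<open>m\<close> part of
  \<open>P \<otimes> K\<close> survives as the chains of degree \<open>\<le> m\<close> modulo the
  chains of degree \<open>< m\<close>. This is why Betti numbers are handled through congruences
  modulo \<open>lower_space\<close>; minimality says that every boundary is congruent to
  \<open>0\<close>.

  An element of \<open>P \<otimes> P\<close> is stored as a family of vectors of the second factor,
  indexed by the basis of the first. Since \<open>a \<otimes> b\<close> has degree at most that of
  \<open>z\<close> iff \<open>a\<close> and \<open>b\<close> both do, the homotopy can be built
  column by column from exactness of the second factor, always in the degree of \<open>z\<close>.
  The recursion can start because for \<open>n \<ge> 1\<close> that degree lies in \<open>J\<close>,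
  where \<open>S/I\<close> vanishes and \<open>1\<close> is a boundary.

  The multiplication has \<open>1\<close> as a strict left unit. So the term
  \<open>1 \<otimes> z\<close> contributes \<open>z\<close> itself, while the other terms of the
  multiplied homotopy identity are boundaries or come from the boundary of \<open>z\<close>, and
  hence are of lower degree.\<close>

definition smul :: "'k::field \<Rightarrow> (nat \<Rightarrow> 'k) \<Rightarrow> nat \<Rightarrow> 'k" where
  "smul c v = (\<lambda>a. c * v a)"

definition unit_vec :: "nat \<Rightarrow> nat \<Rightarrow> 'k::field" where
  "unit_vec b = (\<lambda>a. if a = b then 1 else 0)"

text \<open>A linear map given by the images \<open>\<phi> b\<close> of the basis vectors, so that
  \<open>lcomb_lcomb\<close> is composition. Coordinates of \<open>v\<close> from \<open>s\<close>
  on are ignored.\<close>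

definition lcomb :: "nat \<Rightarrow> (nat \<Rightarrow> nat \<Rightarrow> 'k::field) \<Rightarrow> (nat \<Rightarrow> 'k) \<Rightarrow> nat \<Rightarrow> 'k" where
  "lcomb s \<phi> v = (\<lambda>a. \<Sum>b<s. v b * \<phi> b a)"

lemma sum_fun_apply: "(\<Sum>x\<in>A. f x) a = (\<Sum>x\<in>A. f x a)"
  for f :: "'a \<Rightarrow> 'b \<Rightarrow> 'c::comm_monoid_add"
  by (induction A rule: infinite_finite_induct) auto

lemma smul_apply [simp]: "smul c v a = c * v a"
  by (simp add: smul_def)

lemma unit_vec_apply: "unit_vec b a = (if a = b then 1 else 0)"
  by (simp add: unit_vec_def)

lemma lcomb_apply: "lcomb s \<phi> v a = (\<Sum>b<s. v b * \<phi> b a)"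
  by (simp add: lcomb_def)

lemma lcomb_lcomb: "lcomb s \<phi> (lcomb t \<psi> v) = lcomb t (\<lambda>b. lcomb s \<phi> (\<psi> b)) v"
proof
  fix a
  have "lcomb s \<phi> (lcomb t \<psi> v) a = (\<Sum>b<s. \<Sum>c<t. v c * \<psi> c b * \<phi> b a)"
    by (simp add: lcomb_apply sum_distrib_right)
  also have "\<dots> = (\<Sum>c<t. \<Sum>b<s. v c * \<psi> c b * \<phi> b a)"
    by (rule sum.swap)
  also have "\<dots> = lcomb t (\<lambda>b. lcomb s \<phi> (\<psi> b)) v a"
    by (simp add: lcomb_apply sum_distrib_left mult.assoc)
  finally show "lcomb s \<phi> (lcomb t \<psi> v) a = lcomb t (\<lambda>b. lcomb s \<phi> (\<psi> b)) v a" .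
qed

lemma lcomb_zero [simp]: "lcomb s \<phi> 0 = 0"
  by (simp add: lcomb_def fun_eq_iff)

lemma lcomb_zero_left [simp]: "lcomb s (\<lambda>b. 0) v = 0"
  by (simp add: lcomb_def fun_eq_iff)

lemma lcomb_add: "lcomb s \<phi> (u + v) = lcomb s \<phi> u + lcomb s \<phi> v"
  by (simp add: lcomb_def fun_eq_iff algebra_simps sum.distrib)

lemma lcomb_diff: "lcomb s \<phi> (u - v) = lcomb s \<phi> u - lcomb s \<phi> v"
  by (simp add: lcomb_def fun_eq_iff algebra_simps sum_subtractf)

lemma lcomb_uminus: "lcomb s \<phi> (- v) = - lcomb s \<phi> v"
  by (simp add: lcomb_def fun_eq_iff sum_negf)

lemma lcomb_smul: "lcomb s \<phi> (smul c v) = smul c (lcomb s \<phi> v)"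
  by (simp add: lcomb_def fun_eq_iff sum_distrib_left mult.assoc)

lemma lcomb_add_left: "lcomb s (\<lambda>b. \<phi> b + \<psi> b) v = lcomb s \<phi> v + lcomb s \<psi> v"
  by (simp add: lcomb_def fun_eq_iff algebra_simps sum.distrib)

lemma lcomb_diff_left: "lcomb s (\<lambda>b. \<phi> b - \<psi> b) v = lcomb s \<phi> v - lcomb s \<psi> v"
  by (simp add: lcomb_def fun_eq_iff algebra_simps sum_subtractf)

lemma lcomb_uminus_left: "lcomb s (\<lambda>b. - \<phi> b) v = - lcomb s \<phi> v"
  by (simp add: lcomb_def fun_eq_iff sum_negf)

lemma lcomb_smul_left: "lcomb s (\<lambda>b. smul c (\<phi> b)) v = smul c (lcomb s \<phi> v)"
  by (simp add: lcomb_def fun_eq_iff sum_distrib_left algebra_simps)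

lemma lcomb_cong: "(\<And>b. b < s \<Longrightarrow> v b \<noteq> 0 \<Longrightarrow> \<phi> b = \<psi> b) \<Longrightarrow> lcomb s \<phi> v = lcomb s \<psi> v"
  unfolding lcomb_def by (intro ext sum.cong) (metis mult_zero_left lessThan_iff)+

lemma lcomb_unit_left: "v \<in> free_mod s \<Longrightarrow> lcomb s unit_vec v = v"
  by (auto simp: lcomb_def fun_eq_iff unit_vec_apply free_mod_def if_distrib cong: if_cong)

lemma lcomb_unit [simp]: "b < s \<Longrightarrow> lcomb s \<phi> (unit_vec b) = \<phi> b"
  by (simp add: lcomb_def fun_eq_iff unit_vec_apply if_distrib if_distribR cong: if_cong)

lemma lcomb_sum: "lcomb s \<phi> (\<Sum>x\<in>A. f x) = (\<Sum>x\<in>A. lcomb s \<phi> (f x))"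
  by (intro ext, simp add: lcomb_apply sum_fun_apply sum_distrib_right) (rule sum.swap)

lemma smul_zero [simp]: "smul c 0 = 0" "smul 0 v = 0"
  by (auto simp: fun_eq_iff)

lemma smul_one [simp]: "smul 1 v = v"
  by (auto simp: fun_eq_iff)

lemma smul_smul [simp]: "smul c (smul e v) = smul (c * e) v"
  by (auto simp: fun_eq_iff)

section \<open>Vectors bounded by a degree, weakly or strictly\<close>

definition chain_space :: "(nat \<Rightarrow> nat) \<Rightarrow> (nat \<Rightarrow> nat \<Rightarrow> 'a::order) \<Rightarrow> nat \<Rightarrow> 'a \<Rightarrow> (nat \<Rightarrow> 'k::field) set" where
  "chain_space r g i x = {v \<in> free_mod (r i). \<forall>b. v b \<noteq> 0 \<longrightarrow> g i b \<le> x}"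

text \<open>The bound is imposed on each basis element separately: degrees below \<open>x\<close>
  may be incomparable, so such a vector need not lie in a single \<open>chain_space r g i y\<close>
  with \<open>y < x\<close>.\<close>

definition lower_space :: "(nat \<Rightarrow> nat) \<Rightarrow> (nat \<Rightarrow> nat \<Rightarrow> 'a::order) \<Rightarrow> nat \<Rightarrow> 'a \<Rightarrow> (nat \<Rightarrow> 'k::field) set" where
  "lower_space r g i x = {v \<in> free_mod (r i). \<forall>b. v b \<noteq> 0 \<longrightarrow> g i b < x}"

lemma chains_iff: "v \<in> chain_space r g i x \<longleftrightarrow> (\<forall>b. v b \<noteq> 0 \<longrightarrow> b < r i \<and> g i b \<le> x)"
  by (auto simp: chain_space_def free_mod_def not_less[symmetric])

lemma lower_space_iff: "v \<in> lower_space r g i x \<longleftrightarrow> (\<forall>b. v b \<noteq> 0 \<longrightarrow> b < r i \<and> g i b < x)"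
  by (auto simp: lower_space_def free_mod_def not_less[symmetric])

lemma chains_support_le: "v \<in> chain_space r g i x \<Longrightarrow> v b \<noteq> 0 \<Longrightarrow> g i b \<le> x"
  by (simp add: chains_iff)

lemma chains_free_mod: "v \<in> chain_space r g i x \<Longrightarrow> v \<in> free_mod (r i)"
  by (simp add: chain_space_def)

lemma chains_mono: "v \<in> chain_space r g i x \<Longrightarrow> x \<le> y \<Longrightarrow> v \<in> chain_space r g i y"
  by (fastforce simp: chains_iff)

lemma chains_lower: "v \<in> chain_space r g i x \<Longrightarrow> x < y \<Longrightarrow> v \<in> lower_space r g i y"
  by (force simp: chains_iff lower_space_iff)

lemma chains_zero [simp]: "0 \<in> chain_space r g i x" "0 \<in> lower_space r g i x"
  by (auto simp: chains_iff lower_space_iff)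

lemma chains_add: "u \<in> chain_space r g i x \<Longrightarrow> v \<in> chain_space r g i x \<Longrightarrow> u + v \<in> chain_space r g i x"
  unfolding chains_iff by (metis plus_fun_apply add_0)

lemma chains_diff: "u \<in> chain_space r g i x \<Longrightarrow> v \<in> chain_space r g i x \<Longrightarrow> u - v \<in> chain_space r g i x"
  unfolding chains_iff by (metis minus_apply diff_0_right)

lemma chains_uminus: "v \<in> chain_space r g i x \<Longrightarrow> - v \<in> chain_space r g i x"
  by (fastforce simp: chains_iff)

lemma chains_smul: "v \<in> chain_space r g i x \<Longrightarrow> smul c v \<in> chain_space r g i x"
  by (fastforce simp: chains_iff)

lemma lower_space_add:
  "u \<in> lower_space r g i x \<Longrightarrow> v \<in> lower_space r g i x \<Longrightarrow> u + v \<in> lower_space r g i x"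
  unfolding lower_space_iff by (metis plus_fun_apply add_0)

lemma lower_space_diff:
  "u \<in> lower_space r g i x \<Longrightarrow> v \<in> lower_space r g i x \<Longrightarrow> u - v \<in> lower_space r g i x"
  unfolding lower_space_iff by (metis minus_apply diff_0_right)

lemma unit_chains: "b < r i \<Longrightarrow> g i b \<le> x \<Longrightarrow> unit_vec b \<in> chain_space r g i x"
  by (auto simp: chains_iff unit_vec_apply)

lemma chains_sum: "(\<And>b. b \<in> A \<Longrightarrow> f b \<in> chain_space r g i x) \<Longrightarrow> (\<Sum>b\<in>A. f b) \<in> chain_space r g i x"
  by (induction A rule: infinite_finite_induct) (auto intro: chains_add)

lemma lower_space_sum:
  "(\<And>b. b \<in> A \<Longrightarrow> f b \<in> lower_space r g i x) \<Longrightarrow> (\<Sum>b\<in>A. f b) \<in> lower_space r g i x"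
  by (induction A rule: infinite_finite_induct) (auto intro: lower_space_add)

lemma lcomb_eq_sum: "lcomb s \<phi> v = (\<Sum>b<s. smul (v b) (\<phi> b))"
  by (simp add: fun_eq_iff lcomb_apply sum_fun_apply)

lemma lcomb_chains_gen:
  assumes "\<And>b. b < s \<Longrightarrow> v b \<noteq> 0 \<Longrightarrow> \<phi> b \<in> chain_space r g i x"
  shows "lcomb s \<phi> v \<in> chain_space r g i x"
  unfolding lcomb_eq_sum
proof (rule chains_sum)
  fix b assume "b \<in> {..<s}"
  then show "smul (v b) (\<phi> b) \<in> chain_space r g i x"
    using assms[of b] by (cases "v b = 0") (auto intro: chains_smul)
qed

lemma lcomb_lower_gen:
  assumes "\<And>b. b < s \<Longrightarrow> v b \<noteq> 0 \<Longrightarrow> \<phi> b \<in> lower_space r g i x"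
  shows "lcomb s \<phi> v \<in> lower_space r g i x"
  unfolding lcomb_eq_sum
proof (rule lower_space_sum)
  fix b assume "b \<in> {..<s}"
  then show "smul (v b) (\<phi> b) \<in> lower_space r g i x"
    using assms[of b] by (cases "v b = 0") (auto simp: lower_space_iff)
qed

text \<open>Strictly lower chains are preserved because a basis element of degree \<open>y < x\<close> is sent into
  degrees \<open>\<le> y\<close>.\<close>

lemma lcomb_chains:
  assumes "\<And>b. b < r i \<Longrightarrow> \<phi> b \<in> chain_space r' g' i' (g i b)"
  shows "v \<in> chain_space r g i x \<Longrightarrow> lcomb (r i) \<phi> v \<in> chain_space r' g' i' x"
    and "v \<in> lower_space r g i x \<Longrightarrow> lcomb (r i) \<phi> v \<in> lower_space r' g' i' x"
proof -
  show "lcomb (r i) \<phi> v \<in> chain_space r' g' i' x" if "v \<in> chain_space r g i x"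
    using that assms by (intro lcomb_chains_gen) (auto simp: chains_iff[of v] intro: chains_mono)
  show "lcomb (r i) \<phi> v \<in> lower_space r' g' i' x" if "v \<in> lower_space r g i x"
    using that assms by (intro lcomb_lower_gen) (auto simp: lower_space_iff[of v] intro: chains_lower)
qed

section \<open>Resolutions in each multidegree\<close>

text \<open>
  Setting all variables to \<open>1\<close> in a multigraded free resolution of \<open>S/I\<close> loses no information as
  long as the degrees of the basis elements are remembered: the part of degree \<open>x\<close> becomes the
  complex of vector spaces on the basis elements of degree \<open>\<le> x\<close>.  The vector \<open>D i b\<close> is the
  boundary of the \<open>b\<close>-th basis element of the \<open>i + 1\<close>-st module, \<open>c b\<close> the augmentation of the
  \<open>b\<close>-th basis element of the \<open>0\<close>-th one, and \<open>J\<close> is the set of monomials in \<open>I\<close>.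
\<close>

definition cyc ::
    "'a set \<Rightarrow> (nat \<Rightarrow> nat) \<Rightarrow> (nat \<Rightarrow> nat \<Rightarrow> nat \<Rightarrow> 'k::field) \<Rightarrow> (nat \<Rightarrow> 'k) \<Rightarrow> nat \<Rightarrow> 'a \<Rightarrow> (nat \<Rightarrow> 'k) \<Rightarrow> bool"
  where
  "cyc J r D c i x v = (case i of 0 \<Rightarrow> x \<in> J \<or> (\<Sum>b<r 0. v b * c b) = 0
     | Suc j \<Rightarrow> lcomb (r (Suc j)) (D j) v = 0)"

locale strand_resolution =
  fixes J :: "'a::order set" and r :: "nat \<Rightarrow> nat" and g :: "nat \<Rightarrow> nat \<Rightarrow> 'a"
    and D :: "nat \<Rightarrow> nat \<Rightarrow> nat \<Rightarrow> 'k::field" and c :: "nat \<Rightarrow> 'k"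
  assumes upset: "x \<in> J \<Longrightarrow> x \<le> y \<Longrightarrow> y \<in> J"
    and boundary_chains: "b < r (Suc i) \<Longrightarrow> D i b \<in> chain_space r g i (g (Suc i) b)"
    and aug_surj: "x \<notin> J \<Longrightarrow> \<exists>v\<in>chain_space r g 0 x. (\<Sum>b<r 0. v b * c b) = 1"
    and boundary_cyc: "v \<in> chain_space r g (Suc i) x \<Longrightarrow> cyc J r D c i x (lcomb (r (Suc i)) (D i) v)"
    and exact: "v \<in> chain_space r g i x \<Longrightarrow> cyc J r D c i x v \<Longrightarrow>
       \<exists>u\<in>chain_space r g (Suc i) x. lcomb (r (Suc i)) (D i) u = v"
begin

abbreviation d :: "nat \<Rightarrow> (nat \<Rightarrow> 'k) \<Rightarrow> nat \<Rightarrow> 'k" where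
  "d i \<equiv> lcomb (r (Suc i)) (D i)"

lemma d_chains: "v \<in> chain_space r g (Suc i) x \<Longrightarrow> d i v \<in> chain_space r g i x"
  by (rule lcomb_chains(1)) (use boundary_chains in auto)

lemma boundary_is_cyc: "b < r (Suc i) \<Longrightarrow> cyc J r D c i (g (Suc i) b) (D i b)"
  using boundary_cyc[OF unit_chains, of b i "g (Suc i) b"] by simp

lemma d_boundary [simp]: "b < r (Suc (Suc i)) \<Longrightarrow> d i (D (Suc i) b) = 0"
  using boundary_is_cyc[of b "Suc i"] by (simp add: cyc_def)

lemma dd [simp]: "d i (d (Suc i) v) = 0"
proof -
  have "d i (d (Suc i) v) = lcomb (r (Suc (Suc i))) (\<lambda>b. 0) v"
    unfolding lcomb_lcomb by (rule lcomb_cong) simp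
  then show ?thesis by simp
qed

text \<open>Acyclicity of the tensor product with \<open>K\<close> in degree \<open>m\<close>, phrased modulo lower degrees.\<close>

definition hom_zero :: "nat \<Rightarrow> 'a \<Rightarrow> bool" where
  "hom_zero i m \<longleftrightarrow> (\<forall>v\<in>chain_space r g i m.
     (case i of 0 \<Rightarrow> True | Suc j \<Rightarrow> d j v \<in> lower_space r g j m) \<longrightarrow>
     (\<exists>u\<in>chain_space r g (Suc i) m. v - d i u \<in> lower_space r g i m))"

end

subsection \<open>Comparison of resolutions\<close>

text \<open>The usual lifting of the identity of \<open>S/I\<close>. Augmentations are compared only
  outside \<open>J\<close>: in a degree of \<open>J\<close> the quotient vanishes and
  \<open>cyc\<close> accepts every chain in homological degree \<open>0\<close>.\<close>

lemma comparison_map: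
  fixes c c' :: "nat \<Rightarrow> 'k::field"
  assumes "strand_resolution J r g D c" and "strand_resolution J r' g' D' c'"
  shows "\<exists>\<phi>. (\<forall>i. \<forall>b<r i. \<phi> i b \<in> chain_space r' g' i (g i b)) \<and>
    (\<forall>b<r 0. g 0 b \<notin> J \<longrightarrow> (\<Sum>a<r' 0. \<phi> 0 b a * c' a) = c b) \<and>
    (\<forall>i. \<forall>b<r (Suc i). lcomb (r' (Suc i)) (D' i) (\<phi> (Suc i) b) = lcomb (r i) (\<phi> i) (D i b))"
proof -
  interpret A: strand_resolution J r g D c by fact
  interpret B: strand_resolution J r' g' D' c' by fact
  \<comment> \<open>The last clause, cycles go to cycles, is the invariant: it makes the image of
    \<open>D i b\<close> a cycle, so exactness of the target supplies the next image.\<close>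
  define P where "P i \<phi> \<longleftrightarrow> (\<forall>b<r i. \<phi> b \<in> chain_space r' g' i (g i b)) \<and>
      (i = 0 \<longrightarrow> (\<forall>b<r 0. g 0 b \<notin> J \<longrightarrow> (\<Sum>a<r' 0. \<phi> b a * c' a) = c b)) \<and>
      (\<forall>x. \<forall>v\<in>chain_space r g i x. cyc J r D c i x v \<longrightarrow> cyc J r' D' c' i x (lcomb (r i) \<phi> v))"
    for i and \<phi> :: "nat \<Rightarrow> nat \<Rightarrow> 'k"
  define Q where "Q i \<phi> \<psi> \<longleftrightarrow>
      (\<forall>b<r (Suc i). lcomb (r' (Suc i)) (D' i) (\<psi> b) = lcomb (r i) \<phi> (D i b))"
    for i and \<phi> \<psi> :: "nat \<Rightarrow> nat \<Rightarrow> 'k"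
  have "\<exists>\<phi>. \<forall>i. P i (\<phi> i) \<and> Q i (\<phi> i) (\<phi> (Suc i))"
  proof (rule dependent_nat_choice)
    have "\<exists>w\<in>chain_space r' g' 0 (g 0 b). g 0 b \<notin> J \<longrightarrow> (\<Sum>a<r' 0. w a * c' a) = c b" for b
    proof (cases "g 0 b \<in> J")
      case True
      then show ?thesis by (intro bexI[of _ 0]) auto
    next
      case False
      then obtain v where v: "v \<in> chain_space r' g' 0 (g 0 b)" "(\<Sum>a<r' 0. v a * c' a) = 1"
        using B.aug_surj by blast
      then have "(\<Sum>a<r' 0. smul (c b) v a * c' a) = c b"
        by (simp add: mult.assoc flip: sum_distrib_left)
      then show ?thesis using chains_smul[OF v(1)] by blast
    qed
    then obtain \<phi> where \<phi>: "\<And>b. \<phi> b \<in> chain_space r' g' 0 (g 0 b)"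
      "\<And>b. g 0 b \<notin> J \<Longrightarrow> (\<Sum>a<r' 0. \<phi> b a * c' a) = c b" by metis
    have "cyc J r' D' c' 0 x (lcomb (r 0) \<phi> v)"
      if v: "v \<in> chain_space r g 0 x" and "cyc J r D c 0 x v" for x v
    proof (cases "x \<in> J")
      case False
      have "(\<Sum>a<r' 0. lcomb (r 0) \<phi> v a * c' a) = (\<Sum>a<r' 0. \<Sum>b<r 0. v b * \<phi> b a * c' a)"
        by (simp add: lcomb_apply sum_distrib_right)
      also have "\<dots> = (\<Sum>b<r 0. v b * (\<Sum>a<r' 0. \<phi> b a * c' a))"
        by (subst sum.swap) (simp add: sum_distrib_left mult.assoc)
      also have "\<dots> = (\<Sum>b<r 0. v b * c b)"
      proof (rule sum.cong)
        fix b
        show "v b * (\<Sum>a<r' 0. \<phi> b a * c' a) = v b * c b"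
        proof (cases "v b = 0")
          case False
          then have "g 0 b \<le> x" using v by (simp add: chains_iff)
          with \<open>x \<notin> J\<close> have "g 0 b \<notin> J" using A.upset by blast
          with \<phi>(2) show ?thesis by simp
        qed simp
      qed simp
      also have "\<dots> = 0" using that False by (simp add: cyc_def)
      finally show ?thesis by (simp add: cyc_def)
    qed (simp add: cyc_def)
    with \<phi> show "\<exists>\<phi>. P 0 \<phi>" unfolding P_def by blast
  next
    fix \<phi> i assume P: "P i \<phi>"
    have "\<exists>w\<in>chain_space r' g' (Suc i) (g (Suc i) b).
        lcomb (r' (Suc i)) (D' i) w = lcomb (r i) \<phi> (D i b)" if b: "b < r (Suc i)" for b
    proof (rule B.exact)
      show "lcomb (r i) \<phi> (D i b) \<in> chain_space r' g' i (g (Suc i) b)"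
        using P A.boundary_chains[OF b] by (intro lcomb_chains(1)) (auto simp: P_def)
      show "cyc J r' D' c' i (g (Suc i) b) (lcomb (r i) \<phi> (D i b))"
        using P A.boundary_is_cyc[OF b] A.boundary_chains[OF b] by (auto simp: P_def)
    qed
    then obtain \<psi> where \<psi>: "\<And>b. b < r (Suc i) \<Longrightarrow> \<psi> b \<in> chain_space r' g' (Suc i) (g (Suc i) b)"
      "\<And>b. b < r (Suc i) \<Longrightarrow> lcomb (r' (Suc i)) (D' i) (\<psi> b) = lcomb (r i) \<phi> (D i b)" by metis
    have "lcomb (r' (Suc i)) (D' i) (lcomb (r (Suc i)) \<psi> v) = lcomb (r i) \<phi> (A.d i v)" for v
      unfolding lcomb_lcomb by (rule lcomb_cong) (simp add: \<psi>(2))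
    then have "P (Suc i) \<psi>" using \<psi>(1) by (auto simp: P_def cyc_def)
    with \<psi>(2) show "\<exists>\<psi>. P (Suc i) \<psi> \<and> Q i \<phi> \<psi>" unfolding Q_def by blast
  qed
  then obtain \<phi> where "\<And>i. P i (\<phi> i)" "\<And>i. Q i (\<phi> i) (\<phi> (Suc i))" by blast
  then show ?thesis unfolding P_def Q_def by blast
qed

text \<open>Uniqueness of liftings up to homotopy, in the form that a lift of zero is
  null-homotopic.\<close>

lemma null_homotopy:
  fixes c c' :: "nat \<Rightarrow> 'k::field"
  assumes "strand_resolution J r g D c" and "strand_resolution J r' g' D' c'"
    and \<phi>: "\<And>i b. b < r i \<Longrightarrow> \<phi> i b \<in> chain_space r' g' i (g i b)"
    and \<phi>_aug: "\<And>b. b < r 0 \<Longrightarrow> g 0 b \<notin> J \<Longrightarrow> (\<Sum>a<r' 0. \<phi> 0 b a * c' a) = 0"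
    and \<phi>_d: "\<And>i b. b < r (Suc i) \<Longrightarrow>
      lcomb (r' (Suc i)) (D' i) (\<phi> (Suc i) b) = lcomb (r i) (\<phi> i) (D i b)"
  shows "\<exists>h. (\<forall>i. \<forall>b<r i. h i b \<in> chain_space r' g' (Suc i) (g i b)) \<and>
    (\<forall>b<r 0. \<phi> 0 b = lcomb (r' (Suc 0)) (D' 0) (h 0 b)) \<and>
    (\<forall>i. \<forall>b<r (Suc i). \<phi> (Suc i) b =
       lcomb (r' (Suc (Suc i))) (D' (Suc i)) (h (Suc i) b) + lcomb (r i) (h i) (D i b))"
proof -
  interpret A: strand_resolution J r g D c by fact
  interpret B: strand_resolution J r' g' D' c' by fact
  \<comment> \<open>On cycles the summand \<open>h\<close> after \<open>d\<close> disappears,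
    leaving \<open>d h = \<phi>\<close>. Applied to \<open>D i b\<close>, this makes
    \<open>\<phi> (Suc i) b - h (D i b)\<close> a cycle.\<close>
  define P where "P i h \<longleftrightarrow> (\<forall>b<r i. h b \<in> chain_space r' g' (Suc i) (g i b)) \<and>
      (i = 0 \<longrightarrow> (\<forall>b<r 0. \<phi> 0 b = B.d 0 (h b))) \<and>
      (\<forall>x. \<forall>v\<in>chain_space r g i x. cyc J r D c i x v \<longrightarrow>
         B.d i (lcomb (r i) h v) = lcomb (r i) (\<phi> i) v)"
    for i and h :: "nat \<Rightarrow> nat \<Rightarrow> 'k"
  define Q where "Q i h h' \<longleftrightarrow>
      (\<forall>b<r (Suc i). \<phi> (Suc i) b = B.d (Suc i) (h' b) + lcomb (r i) h (D i b))"
    for i and h h' :: "nat \<Rightarrow> nat \<Rightarrow> 'k"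
  have "\<exists>h. \<forall>i. P i (h i) \<and> Q i (h i) (h (Suc i))"
  proof (rule dependent_nat_choice)
    have "\<exists>w\<in>chain_space r' g' (Suc 0) (g 0 b). B.d 0 w = \<phi> 0 b" if "b < r 0" for b
      by (rule B.exact) (use that \<phi> \<phi>_aug in \<open>auto simp: cyc_def\<close>)
    then obtain h where h: "\<And>b. b < r 0 \<Longrightarrow> h b \<in> chain_space r' g' (Suc 0) (g 0 b)"
      "\<And>b. b < r 0 \<Longrightarrow> B.d 0 (h b) = \<phi> 0 b" by metis
    have "B.d 0 (lcomb (r 0) h v) = lcomb (r 0) (\<phi> 0) v" for v
      unfolding lcomb_lcomb by (rule lcomb_cong) (simp add: h(2))
    with h show "\<exists>h. P 0 h" unfolding P_def by (metis)
  next
    fix h i assume P: "P i h"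
    have "\<exists>w\<in>chain_space r' g' (Suc (Suc i)) (g (Suc i) b).
        B.d (Suc i) w = \<phi> (Suc i) b - lcomb (r i) h (D i b)" if b: "b < r (Suc i)" for b
    proof (rule B.exact)
      have "lcomb (r i) h (D i b) \<in> chain_space r' g' (Suc i) (g (Suc i) b)"
        using P A.boundary_chains[OF b] by (intro lcomb_chains(1)) (auto simp: P_def)
      then show "\<phi> (Suc i) b - lcomb (r i) h (D i b) \<in> chain_space r' g' (Suc i) (g (Suc i) b)"
        using \<phi>[OF b] chains_diff by blast
      have "B.d i (lcomb (r i) h (D i b)) = lcomb (r i) (\<phi> i) (D i b)"
        using P A.boundary_is_cyc[OF b] A.boundary_chains[OF b] by (auto simp: P_def)
      then show "cyc J r' D' c' (Suc i) (g (Suc i) b) (\<phi> (Suc i) b - lcomb (r i) h (D i b))"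
        by (simp add: cyc_def lcomb_diff \<phi>_d[OF b])
    qed
    then obtain h' where
      h': "\<And>b. b < r (Suc i) \<Longrightarrow> h' b \<in> chain_space r' g' (Suc (Suc i)) (g (Suc i) b)"
      "\<And>b. b < r (Suc i) \<Longrightarrow> B.d (Suc i) (h' b) = \<phi> (Suc i) b - lcomb (r i) h (D i b)" by metis
    have "B.d (Suc i) (lcomb (r (Suc i)) h' v) =
        lcomb (r (Suc i)) (\<phi> (Suc i)) v - lcomb (r i) h (A.d i v)" for v
      unfolding lcomb_lcomb lcomb_diff_left[symmetric] by (rule lcomb_cong) (simp add: h'(2))
    then have "P (Suc i) h'" using h'(1) by (auto simp: P_def cyc_def)
    with h'(2) show "\<exists>h'. P (Suc i) h' \<and> Q i h h'" unfolding Q_def by (metis diff_add_cancel)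
  qed
  then obtain h where "\<And>i. P i (h i)" "\<And>i. Q i (h i) (h (Suc i))" by blast
  then show ?thesis unfolding P_def Q_def by blast
qed

text \<open>The composite of the comparison maps is homotopic to the identity, and all maps involved
  respect degree bounds, strict ones included. So vanishing modulo lower degrees passes from one
  resolution to the other.\<close>

lemma hom_zero_transfer:
  fixes c c' :: "nat \<Rightarrow> 'k::field"
  assumes resA: "strand_resolution J r g D c" and resB: "strand_resolution J r' g' D' c'"
    and zero: "strand_resolution.hom_zero r g D i m"
  shows "strand_resolution.hom_zero r' g' D' i m"
proof -
  interpret A: strand_resolution J r g D c by fact
  interpret B: strand_resolution J r' g' D' c' by fact
  obtain \<phi> where \<phi>: "\<And>i b. b < r i \<Longrightarrow> \<phi> i b \<in> chain_space r' g' i (g i b)"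
    "\<And>b. b < r 0 \<Longrightarrow> g 0 b \<notin> J \<Longrightarrow> (\<Sum>a<r' 0. \<phi> 0 b a * c' a) = c b"
    "\<And>i b. b < r (Suc i) \<Longrightarrow> B.d i (\<phi> (Suc i) b) = lcomb (r i) (\<phi> i) (D i b)"
    using comparison_map[OF resA resB] by (elim exE conjE, rule_tac that) blast+
  obtain \<psi> where \<psi>: "\<And>i b. b < r' i \<Longrightarrow> \<psi> i b \<in> chain_space r g i (g' i b)"
    "\<And>b. b < r' 0 \<Longrightarrow> g' 0 b \<notin> J \<Longrightarrow> (\<Sum>a<r 0. \<psi> 0 b a * c a) = c' b"
    "\<And>i b. b < r' (Suc i) \<Longrightarrow> A.d i (\<psi> (Suc i) b) = lcomb (r' i) (\<psi> i) (D' i b)"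
    using comparison_map[OF resB resA] by (elim exE conjE, rule_tac that) blast+
  have \<phi>_d: "B.d i (lcomb (r (Suc i)) (\<phi> (Suc i)) v) = lcomb (r i) (\<phi> i) (A.d i v)" for i v
    unfolding lcomb_lcomb by (rule lcomb_cong) (simp add: \<phi>(3))
  have \<psi>_d: "A.d i (lcomb (r' (Suc i)) (\<psi> (Suc i)) v) = lcomb (r' i) (\<psi> i) (B.d i v)" for i v
    unfolding lcomb_lcomb by (rule lcomb_cong) (simp add: \<psi>(3))
  \<comment> \<open>Identity minus \<open>\<phi> \<psi>\<close>: a lift of zero.\<close>
  define \<theta> where "\<theta> i b = unit_vec b - lcomb (r i) (\<phi> i) (\<psi> i b)" for i b
  have \<theta>_lcomb: "lcomb (r' i) (\<theta> i) v = v - lcomb (r i) (\<phi> i) (lcomb (r' i) (\<psi> i) v)"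
    if "v \<in> free_mod (r' i)" for i v
  proof -
    have "lcomb (r' i) (\<theta> i) v = lcomb (r' i) (\<lambda>b. unit_vec b - lcomb (r i) (\<phi> i) (\<psi> i b)) v"
      by (rule lcomb_cong) (rule \<theta>_def)
    also have "\<dots> = lcomb (r' i) unit_vec v - lcomb (r i) (\<phi> i) (lcomb (r' i) (\<psi> i) v)"
      by (simp only: lcomb_diff_left lcomb_lcomb)
    finally show ?thesis by (simp only: lcomb_unit_left[OF that])
  qed
  have "\<exists>h. (\<forall>i. \<forall>b<r' i. h i b \<in> chain_space r' g' (Suc i) (g' i b)) \<and>
    (\<forall>b<r' 0. \<theta> 0 b = B.d 0 (h 0 b)) \<and>
    (\<forall>i. \<forall>b<r' (Suc i). \<theta> (Suc i) b = B.d (Suc i) (h (Suc i) b) + lcomb (r' i) (h i) (D' i b))"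
  proof (rule null_homotopy[OF resB resB])
    show "\<theta> i b \<in> chain_space r' g' i (g' i b)" if "b < r' i" for i b
      unfolding \<theta>_def using that \<phi>(1) \<psi>(1)
      by (intro chains_diff unit_chains lcomb_chains(1)) auto
  next
    fix b assume b: "b < r' 0" "g' 0 b \<notin> J"
    have "(\<Sum>a<r' 0. lcomb (r 0) (\<phi> 0) (\<psi> 0 b) a * c' a)
        = (\<Sum>a<r' 0. \<Sum>e<r 0. \<psi> 0 b e * \<phi> 0 e a * c' a)"
      by (simp add: lcomb_apply sum_distrib_right)
    also have "\<dots> = (\<Sum>e<r 0. \<psi> 0 b e * (\<Sum>a<r' 0. \<phi> 0 e a * c' a))"
      by (subst sum.swap) (simp add: sum_distrib_left mult.assoc)
    also have "\<dots> = (\<Sum>e<r 0. \<psi> 0 b e * c e)"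
    proof (rule sum.cong)
      fix e assume e: "e \<in> {..<r 0}"
      show "\<psi> 0 b e * (\<Sum>a<r' 0. \<phi> 0 e a * c' a) = \<psi> 0 b e * c e"
      proof (cases "\<psi> 0 b e = 0")
        case False
        then have "g 0 e \<le> g' 0 b" using \<psi>(1)[OF b(1)] by (simp add: chains_iff)
        with b(2) have "g 0 e \<notin> J" using A.upset by blast
        with \<phi>(2) e show ?thesis by simp
      qed simp
    qed simp
    also have "\<dots> = c' b" using \<psi>(2) b by simp
    finally show "(\<Sum>a<r' 0. \<theta> 0 b a * c' a) = 0"
      using b(1) by (simp add: \<theta>_def left_diff_distrib sum_subtractf unit_vec_apply
          if_distrib[of "\<lambda>x. x * _"] cong: if_cong)
  next
    fix i b assume b: "b < r' (Suc i)"
    then show "B.d i (\<theta> (Suc i) b) = lcomb (r' i) (\<theta> i) (D' i b)"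
      using chains_free_mod[OF B.boundary_chains[OF b]]
      by (simp add: \<theta>_lcomb \<theta>_def lcomb_diff \<phi>_d \<psi>(3))
  qed
  then obtain h where h: "\<And>i b. b < r' i \<Longrightarrow> h i b \<in> chain_space r' g' (Suc i) (g' i b)"
    "\<And>b. b < r' 0 \<Longrightarrow> \<theta> 0 b = B.d 0 (h 0 b)"
    "\<And>i b. b < r' (Suc i) \<Longrightarrow> \<theta> (Suc i) b = B.d (Suc i) (h (Suc i) b) + lcomb (r' i) (h i) (D' i b)"
    by blast
  show ?thesis
    unfolding B.hom_zero_def
  proof (intro ballI impI)
    fix v assume v: "v \<in> chain_space r' g' i m"
      and dv: "case i of 0 \<Rightarrow> True | Suc j \<Rightarrow> B.d j v \<in> lower_space r' g' j m"
    let ?w = "lcomb (r' i) (\<psi> i) v"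
    have "?w \<in> chain_space r g i m"
      using v \<psi>(1) by (intro lcomb_chains(1)) auto
    moreover have "case i of 0 \<Rightarrow> True | Suc j \<Rightarrow> A.d j ?w \<in> lower_space r g j m"
    proof (cases i)
      case (Suc j)
      have "lcomb (r' j) (\<psi> j) (B.d j v) \<in> lower_space r g j m"
        by (rule lcomb_chains(2)) (use dv Suc \<psi>(1) in auto)
      then show ?thesis by (simp add: Suc \<psi>_d)
    qed simp
    ultimately obtain u where u: "u \<in> chain_space r g (Suc i) m" "?w - A.d i u \<in> lower_space r g i m"
      using zero unfolding A.hom_zero_def by blast
    \<comment> \<open>By the homotopy identity \<open>e\<close> is \<open>h (d v)\<close>, of lower
      degree because \<open>d v\<close> is; in homological degree \<open>0\<close> it is
      zero.\<close>
    define e where "e = lcomb (r' i) (\<theta> i) v - B.d i (lcomb (r' i) (h i) v)"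
    have e: "e \<in> lower_space r' g' i m"
    proof (cases i)
      case 0
      have "lcomb (r' 0) (\<theta> 0) v = B.d 0 (lcomb (r' 0) (h 0) v)"
        unfolding lcomb_lcomb by (rule lcomb_cong) (simp add: h(2))
      then show ?thesis by (simp add: e_def 0)
    next
      case (Suc j)
      have "lcomb (r' (Suc j)) (\<theta> (Suc j)) v =
          B.d (Suc j) (lcomb (r' (Suc j)) (h (Suc j)) v) + lcomb (r' j) (h j) (B.d j v)"
        unfolding lcomb_lcomb lcomb_add_left[symmetric] by (rule lcomb_cong) (simp add: h(3))
      then have "e = lcomb (r' j) (h j) (B.d j v)" by (simp add: e_def Suc)
      moreover have "lcomb (r' j) (h j) (B.d j v) \<in> lower_space r' g' (Suc j) m"
        by (rule lcomb_chains(2)) (use dv Suc h(1) in auto)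
      ultimately show ?thesis by (simp add: Suc)
    qed
    have v_eq: "v = lcomb (r' i) (\<theta> i) v + lcomb (r i) (\<phi> i) ?w"
      by (simp add: \<theta>_lcomb[OF chains_free_mod[OF v]])
    let ?u = "lcomb (r' i) (h i) v + lcomb (r (Suc i)) (\<phi> (Suc i)) u"
    have "v - B.d i ?u = e + lcomb (r i) (\<phi> i) (?w - A.d i u)"
      by (subst v_eq) (simp add: e_def lcomb_add lcomb_diff \<phi>_d)
    moreover have "lcomb (r i) (\<phi> i) (?w - A.d i u) \<in> lower_space r' g' i m"
      by (rule lcomb_chains(2)[OF _ u(2)]) (use \<phi>(1) in auto)
    ultimately have "v - B.d i ?u \<in> lower_space r' g' i m" using e lower_space_add by metis
    moreover have "?u \<in> chain_space r' g' (Suc i) m"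
      using v u(1) \<phi>(1) h(1) by (intro chains_add lcomb_chains(1)) auto
    ultimately show "\<exists>u\<in>chain_space r' g' (Suc i) m. v - B.d i u \<in> lower_space r' g' i m" by blast
  qed
qed

section \<open>Splitting the degrees of a minimal resolution\<close>

lemma lcomb_swap:
  "lcomb s (\<lambda>a. lcomb t (\<lambda>f. \<Phi> f a) v) u = lcomb t (\<lambda>f. lcomb s (\<Phi> f) u) v"
proof
  fix x
  have "lcomb s (\<lambda>a. lcomb t (\<lambda>f. \<Phi> f a) v) u x = (\<Sum>a<s. \<Sum>f<t. u a * (v f * \<Phi> f a x))"
    by (simp add: lcomb_apply sum_distrib_left)
  also have "\<dots> = (\<Sum>f<t. \<Sum>a<s. v f * (u a * \<Phi> f a x))"
    by (subst sum.swap) (simp add: mult.left_commute)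
  finally show "lcomb s (\<lambda>a. lcomb t (\<lambda>f. \<Phi> f a) v) u x = lcomb t (\<lambda>f. lcomb s (\<Phi> f) u) v x"
    by (simp add: lcomb_apply sum_distrib_left)
qed

text \<open>Composition for the transposed action, in which a family indexed by \<open>e\<close>
  becomes one indexed by \<open>a\<close>. This is how boundaries act on the first factor of a
  tensor.\<close>

lemma lcomb_lcomb_coeff:
  "lcomb s (\<lambda>a. lcomb t \<Phi> (\<lambda>e. E e a)) u = lcomb t \<Phi> (\<lambda>e. \<Sum>a<s. u a * E e a)"
proof
  fix x
  have "lcomb s (\<lambda>a. lcomb t \<Phi> (\<lambda>e. E e a)) u x = (\<Sum>a<s. \<Sum>e<t. u a * E e a * \<Phi> e x)"
    by (simp add: lcomb_apply sum_distrib_left mult.assoc)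
  also have "\<dots> = (\<Sum>e<t. \<Sum>a<s. u a * E e a * \<Phi> e x)"
    by (rule sum.swap)
  finally show "lcomb s (\<lambda>a. lcomb t \<Phi> (\<lambda>e. E e a)) u x = lcomb t \<Phi> (\<lambda>e. \<Sum>a<s. u a * E e a) x"
    by (simp add: lcomb_apply sum_distrib_right)
qed

lemma smul_diff: "smul e (u - v) = smul e u - smul e v"
  by (simp add: fun_eq_iff right_diff_distrib)

lemma lcomb_coeff_zero: "(\<And>b. b < s \<Longrightarrow> v b = 0) \<Longrightarrow> lcomb s \<phi> v = 0"
  by (simp add: lcomb_def fun_eq_iff)

text \<open>The module in homological degree \<open>0\<close> is generated by \<open>1\<close>. By
  \<open>degree_in\<close> the quotient vanishes in the degree of every later basis element, so
  \<open>unit_vec 0\<close> is a cycle there.\<close>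

locale minimal_strand_resolution = strand_resolution J r g D c
  for J :: "'a::semilattice_sup set" and r g and D :: "nat \<Rightarrow> nat \<Rightarrow> nat \<Rightarrow> 'k::field" and c +
  assumes r0: "r 0 = 1" and g0_least: "g 0 0 \<le> x"
    and minimal: "b < r (Suc i) \<Longrightarrow> D i b \<in> lower_space r g i (g (Suc i) b)"
    and degree_in: "b < r (Suc i) \<Longrightarrow> g (Suc i) b \<in> J"
begin

lemma lower_space_mono: "v \<in> lower_space r g i x \<Longrightarrow> x \<le> y \<Longrightarrow> v \<in> lower_space r g i y"
  unfolding lower_space_iff by (meson order_less_le_trans)

lemma d_minimal: "v \<in> chain_space r g (Suc i) x \<Longrightarrow> d i v \<in> lower_space r g i x"
  by (rule lcomb_lower_gen) (auto simp: chains_iff[of v] intro: lower_space_mono[OF minimal])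

section \<open>The homotopy between the two inclusions into the tensor square\<close>

definition preimage :: "nat \<Rightarrow> 'a \<Rightarrow> (nat \<Rightarrow> 'k) \<Rightarrow> nat \<Rightarrow> 'k" where
  "preimage i x v = (if v = 0 then 0 else SOME w. w \<in> chain_space r g (Suc i) x \<and> d i w = v)"

lemma preimage_zero [simp]: "preimage i x 0 = 0"
  by (simp add: preimage_def)

lemma preimage:
  assumes "v \<in> chain_space r g i x" and "cyc J r D c i x v"
  shows "preimage i x v \<in> chain_space r g (Suc i) x" and "d i (preimage i x v) = v"
proof -
  have "\<exists>w. w \<in> chain_space r g (Suc i) x \<and> d i w = v" using exact[OF assms] by blast
  from someI_ex[OF this] show "preimage i x v \<in> chain_space r g (Suc i) x" "d i (preimage i x v) = v"
    by (auto simp: preimage_def)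
qed

lemma cyc_smul: "cyc J r D c i x v \<Longrightarrow> cyc J r D c i x (smul e v)"
proof (cases i)
  case 0
  have "(\<Sum>b<r 0. smul e v b * c b) = e * (\<Sum>b<r 0. v b * c b)"
    by (simp add: sum_distrib_left mult.assoc)
  then show "cyc J r D c i x v \<Longrightarrow> ?thesis" using 0 by (auto simp: cyc_def)
qed (simp add: cyc_def lcomb_smul)

text \<open>
  Writing \<open>P\<close> for the resolution, the pointwise (lcm-graded) tensor product \<open>P \<otimes> P\<close> again resolves
  \<open>S/I\<close>, so \<open>z \<mapsto> z \<otimes> 1\<close> and \<open>z \<mapsto> 1 \<otimes> z\<close> are homotopic.  A homotopy sends the basis element \<open>z\<close> of
  degree \<open>p + q\<close> to an element with components \<open>\<Sum>\<^sub>a a \<otimes> homotopy q p z a\<close> in \<open>P\<^sub>p \<otimes> P\<^bsub>q+1\<^esub>\<close>, and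
  \<open>\<Sum>\<^sub>a a \<otimes> homotopy_d q p z a\<close> is the boundary of that component in the second factor.
\<close>

primrec homotopy :: "nat \<Rightarrow> nat \<Rightarrow> nat \<Rightarrow> nat \<Rightarrow> nat \<Rightarrow> 'k" where
  "homotopy 0 p z a = preimage 0 (g p z) (smul ((- 1) ^ p) (if p \<noteq> 0 \<and> a = z then unit_vec 0 else 0))"
| "homotopy (Suc q) p z a = preimage (Suc q) (g (p + Suc q) z) (smul ((- 1) ^ p)
     (- lcomb (r (Suc p)) (homotopy q (Suc p) z) (\<lambda>e. D p e a) - (if p = 0 then unit_vec z else 0)
      - lcomb (r (p + q)) (\<lambda>f. homotopy q p f a) (D (p + q) z)))"

definition homotopy_d :: "nat \<Rightarrow> nat \<Rightarrow> nat \<Rightarrow> nat \<Rightarrow> nat \<Rightarrow> 'k" where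
  "homotopy_d q p z a = (case q of 0 \<Rightarrow> (if p \<noteq> 0 \<and> a = z then unit_vec 0 else 0)
   | Suc q' \<Rightarrow> - lcomb (r (Suc p)) (homotopy q' (Suc p) z) (\<lambda>e. D p e a) - (if p = 0 then unit_vec z else 0)
      - lcomb (r (p + q')) (\<lambda>f. homotopy q' p f a) (D (p + q') z))"

lemma homotopy_d_0: "homotopy_d 0 p z a = (if p \<noteq> 0 \<and> a = z then unit_vec 0 else 0)"
  by (simp add: homotopy_d_def)

lemma homotopy_d_Suc: "homotopy_d (Suc q) p z a =
    - lcomb (r (Suc p)) (homotopy q (Suc p) z) (\<lambda>e. D p e a) - (if p = 0 then unit_vec z else 0)
    - lcomb (r (p + q)) (\<lambda>f. homotopy q p f a) (D (p + q) z)"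
  by (simp add: homotopy_d_def)

lemma homotopy_eq: "homotopy q p z a = preimage q (g (p + q) z) (smul ((- 1) ^ p) (homotopy_d q p z a))"
  by (cases q) (simp_all add: homotopy_d_0 homotopy_d_Suc)

lemma dd_coeff: "e < r (Suc (Suc p)) \<Longrightarrow> (\<Sum>a<r (Suc p). D p a b * D (Suc p) e a) = 0"
  using d_boundary[of e p] by (simp add: lcomb_def fun_eq_iff mult.commute)

text \<open>This makes the next row solvable: applying \<open>d q\<close> to
  \<open>homotopy_d (Suc q) p z a\<close> leaves the left-hand side, up to sign, minus the boundary
  of \<open>1 \<otimes> z\<close>.\<close>

lemma homotopy_d_commute:
  assumes z: "z < r (Suc (p + q))" and a: "a < r p"
  shows "lcomb (r (Suc p)) (homotopy_d q (Suc p) z) (\<lambda>e. D p e a) - lcomb (r (p + q)) (\<lambda>f. homotopy_d q p f a) (D (p + q) z)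
    = (if p = 0 then D q z else 0)"
proof (cases q)
  case 0
  have "lcomb (r (Suc p)) (homotopy_d 0 (Suc p) z) (\<lambda>e. D p e a) = smul (D p z a) (unit_vec 0)"
  proof
    fix x
    have "lcomb (r (Suc p)) (homotopy_d 0 (Suc p) z) (\<lambda>e. D p e a) x
        = (\<Sum>e<r (Suc p). if e = z then D p e a * unit_vec 0 x else 0)"
      unfolding lcomb_apply homotopy_d_0 by (rule sum.cong) auto
    then show "lcomb (r (Suc p)) (homotopy_d 0 (Suc p) z) (\<lambda>e. D p e a) x = smul (D p z a) (unit_vec 0) x"
      using z 0 by simp
  qed
  moreover have "lcomb (r p) (\<lambda>f. homotopy_d 0 p f a) (D p z) = smul (D p z a) (unit_vec 0)" if "p \<noteq> 0"
  proof
    fix x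
    have "lcomb (r p) (\<lambda>f. homotopy_d 0 p f a) (D p z) x
        = (\<Sum>f<r p. if f = a then D p z f * unit_vec 0 x else 0)"
      unfolding lcomb_apply homotopy_d_0 by (rule sum.cong) (use that in auto)
    then show "lcomb (r p) (\<lambda>f. homotopy_d 0 p f a) (D p z) x = smul (D p z a) (unit_vec 0) x"
      using a by simp
  qed
  moreover have "lcomb (r p) (\<lambda>f. homotopy_d 0 p f a) (D p z) = 0" if "p = 0"
    using that by (simp add: homotopy_d_0)
  moreover have "smul (D 0 z a) (unit_vec 0) = D 0 z" if "p = 0"
  proof
    fix x
    have "D 0 z x = 0" if "x \<noteq> 0"
      using boundary_chains[of z 0] z \<open>p = 0\<close> 0 that by (auto simp: chains_iff r0)
    then show "smul (D 0 z a) (unit_vec 0) x = D 0 z x"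
      using a that by (auto simp: unit_vec_apply r0)
  qed
  ultimately show ?thesis by (auto simp: 0)
next
  case (Suc q')
  \<comment> \<open>The mixed term, with one boundary taken of \<open>z\<close> and one in the first
    factor. It occurs on both sides and cancels; the two double boundaries vanish.\<close>
  define X where "X = lcomb (r (Suc p)) (\<lambda>e. lcomb (r (Suc p + q')) (\<lambda>f. homotopy q' (Suc p) f e)
      (D (Suc p + q') z)) (\<lambda>e. D p e a)"
  have "lcomb (r (Suc p)) (\<lambda>e. lcomb (r (Suc (Suc p))) (homotopy q' (Suc (Suc p)) z) (\<lambda>k. D (Suc p) k e))
      (\<lambda>e. D p e a) = 0"
    unfolding lcomb_lcomb_coeff by (rule lcomb_coeff_zero) (rule dd_coeff)
  then have 1: "lcomb (r (Suc p)) (homotopy_d q (Suc p) z) (\<lambda>e. D p e a) = - X"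
    by (simp add: homotopy_d_Suc[abs_def] Suc X_def lcomb_diff_left lcomb_uminus_left)
  have "lcomb (r (Suc (p + q'))) (\<lambda>f. lcomb (r (p + q')) (\<lambda>k. homotopy q' p k a) (D (p + q') f))
      (D (Suc (p + q')) z) = lcomb (r (p + q')) (\<lambda>k. homotopy q' p k a) (d (p + q') (D (Suc (p + q')) z))"
    by (simp add: lcomb_lcomb)
  also have "\<dots> = 0" using z Suc by simp
  finally have 2: "lcomb (r (Suc (p + q'))) (\<lambda>f. lcomb (r (p + q')) (\<lambda>k. homotopy q' p k a) (D (p + q') f))
      (D (Suc (p + q')) z) = 0" .
  have 3: "lcomb (r (Suc (p + q'))) (\<lambda>f. lcomb (r (Suc p)) (homotopy q' (Suc p) f) (\<lambda>e. D p e a))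
      (D (Suc (p + q')) z) = X"
    using lcomb_swap[of "r (Suc p)" "r (Suc p + q')" "homotopy q' (Suc p)" "D (Suc p + q') z" "\<lambda>e. D p e a"]
    by (simp only: X_def add_Suc)
  have 4: "lcomb (r (Suc (p + q'))) (\<lambda>f. if p = 0 then unit_vec f else 0) (D (Suc (p + q')) z)
      = (if p = 0 then D (Suc q') z else 0)"
    using lcomb_unit_left[OF chains_free_mod[OF boundary_chains[of z "p + q"]]] z Suc by auto
  have "lcomb (r (p + q)) (\<lambda>f. homotopy_d q p f a) (D (p + q) z) = - X - (if p = 0 then D (Suc q') z else 0)"
    by (simp add: homotopy_d_Suc[abs_def] Suc lcomb_diff_left lcomb_uminus_left 2 3 4 del: if_split)
  with 1 show ?thesis by (simp add: Suc)
qed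

text \<open>Row \<open>q + 1\<close> of column \<open>p\<close> uses row \<open>q\<close> of columns
  \<open>p\<close> and \<open>p + 1\<close>, and those preimages are controlled only once their
  right-hand sides are known to be cycles. Hence the induction on \<open>q\<close> for all
  \<open>p\<close> at once.\<close>

lemma homotopy_d_cycle:
  "z < r (p + q) \<Longrightarrow> a < r p \<Longrightarrow>
    homotopy_d q p z a \<in> chain_space r g q (g (p + q) z) \<and> cyc J r D c q (g (p + q) z) (homotopy_d q p z a)"
proof (induction q arbitrary: p z a)
  case 0
  \<comment> \<open>In a degree of \<open>J\<close>, \<open>unit_vec 0\<close> counts as a
    cycle.\<close>
  have "g p z \<in> J" if "p \<noteq> 0" using degree_in[of z "p - 1"] 0 that by simp
  moreover have "unit_vec 0 \<in> chain_space r g 0 (g p z)"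
    by (intro unit_chains) (simp_all add: r0 g0_least)
  ultimately show ?case by (auto simp: homotopy_d_0 cyc_def)
next
  case (Suc q)
  have homotopy_chains: "homotopy q p z a \<in> chain_space r g (Suc q) (g (p + q) z)"
    and d_homotopy: "d q (homotopy q p z a) = smul ((- 1) ^ p) (homotopy_d q p z a)"
    if "z < r (p + q)" "a < r p" for p z a
    unfolding homotopy_eq using preimage[of "smul ((- 1) ^ p) (homotopy_d q p z a)" q "g (p + q) z"] Suc.IH[OF that]
    by (auto intro: chains_smul cyc_smul)
  have z: "z < r (Suc (p + q))" using Suc.prems by simp
  have Dz: "D (p + q) z \<in> chain_space r g (p + q) (g (Suc (p + q)) z)"
    using z by (rule boundary_chains)
  have "lcomb (r (Suc p)) (homotopy q (Suc p) z) (\<lambda>e. D p e a) \<in> chain_space r g (Suc q) (g (Suc (p + q)) z)"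
    using homotopy_chains[of z "Suc p"] z by (intro lcomb_chains_gen) auto
  moreover have "lcomb (r (p + q)) (\<lambda>f. homotopy q p f a) (D (p + q) z) \<in> chain_space r g (Suc q) (g (Suc (p + q)) z)"
  proof (rule lcomb_chains_gen)
    fix f assume "f < r (p + q)" "D (p + q) z f \<noteq> 0"
    with homotopy_chains[OF _ Suc.prems(2)] Dz show "homotopy q p f a \<in> chain_space r g (Suc q) (g (Suc (p + q)) z)"
      by (metis chains_iff chains_mono)
  qed
  moreover have "(if p = 0 then unit_vec z else 0) \<in> chain_space r g (Suc q) (g (Suc (p + q)) z)"
    using z by (auto intro: unit_chains)
  ultimately have chain: "homotopy_d (Suc q) p z a \<in> chain_space r g (Suc q) (g (p + Suc q) z)"
    unfolding homotopy_d_Suc add_Suc_right by (intro chains_diff chains_uminus)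
  have "d q (lcomb (r (Suc p)) (homotopy q (Suc p) z) (\<lambda>e. D p e a))
      = lcomb (r (Suc p)) (\<lambda>e. smul ((- 1) ^ Suc p) (homotopy_d q (Suc p) z e)) (\<lambda>e. D p e a)"
    unfolding lcomb_lcomb by (rule lcomb_cong) (use z d_homotopy[of z "Suc p"] in simp)
  then have 1: "d q (lcomb (r (Suc p)) (homotopy q (Suc p) z) (\<lambda>e. D p e a))
      = - smul ((- 1) ^ p) (lcomb (r (Suc p)) (homotopy_d q (Suc p) z) (\<lambda>e. D p e a))"
    by (simp only: lcomb_smul_left) (simp add: fun_eq_iff)
  have "d q (lcomb (r (p + q)) (\<lambda>f. homotopy q p f a) (D (p + q) z))
      = lcomb (r (p + q)) (\<lambda>f. smul ((- 1) ^ p) (homotopy_d q p f a)) (D (p + q) z)"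
    unfolding lcomb_lcomb by (rule lcomb_cong) (use d_homotopy Suc.prems(2) in simp)
  then have 2: "d q (lcomb (r (p + q)) (\<lambda>f. homotopy q p f a) (D (p + q) z))
      = smul ((- 1) ^ p) (lcomb (r (p + q)) (\<lambda>f. homotopy_d q p f a) (D (p + q) z))"
    by (simp only: lcomb_smul_left)
  have 3: "d q (if p = 0 then unit_vec z else 0) = (if p = 0 then D q z else 0)"
    using z by (cases "p = 0") simp_all
  have "d q (homotopy_d (Suc q) p z a) = smul ((- 1) ^ p) (lcomb (r (Suc p)) (homotopy_d q (Suc p) z) (\<lambda>e. D p e a)
      - lcomb (r (p + q)) (\<lambda>f. homotopy_d q p f a) (D (p + q) z)) - (if p = 0 then D q z else 0)"
    unfolding homotopy_d_Suc lcomb_diff lcomb_uminus 1 2 3 smul_diff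
    by (simp add: diff_right_commute del: if_split)
  also have "\<dots> = 0"
    unfolding homotopy_d_commute[OF z Suc.prems(2)] by simp
  finally show ?case using chain by (simp add: cyc_def)
qed

lemma homotopy_chains: "z < r (p + q) \<Longrightarrow> a < r p \<Longrightarrow> homotopy q p z a \<in> chain_space r g (Suc q) (g (p + q) z)"
  and d_homotopy: "z < r (p + q) \<Longrightarrow> a < r p \<Longrightarrow> d q (homotopy q p z a) = smul ((- 1) ^ p) (homotopy_d q p z a)"
  unfolding homotopy_eq
  by (rule preimage; use homotopy_d_cycle[of z p q a] in \<open>simp add: chains_smul cyc_smul\<close>)+

text \<open>The first factors in the homotopy are iterated boundary components of \<open>z\<close>, hence can be
  raised to any homological degree up to that of \<open>z\<close>.\<close>

definition below :: "nat \<Rightarrow> nat \<Rightarrow> nat \<Rightarrow> nat \<Rightarrow> bool" where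
  "below p a n z \<longleftrightarrow> (\<forall>l. p \<le> l \<and> l \<le> n \<longrightarrow> (\<exists>b<r l. g p a \<le> g l b \<and> g l b \<le> g n z))"

text \<open>This is why \<open>preimage\<close> is made to send \<open>0\<close> to
  \<open>0\<close>: the support of the homotopy can be traced back through the recursion.\<close>

lemma homotopy_nonzero_imp_homotopy_d: "homotopy q p z a \<noteq> 0 \<Longrightarrow> homotopy_d q p z a \<noteq> 0"
  unfolding homotopy_eq by (metis preimage_zero smul_zero(1))

lemma below_le: "below p a n z \<Longrightarrow> p \<le> n \<Longrightarrow> g p a \<le> g n z"
  unfolding below_def by (meson order_refl order_trans)

text \<open>A nonzero contribution comes from some \<open>e\<close> whose boundary involves
  \<open>a\<close>, or from some \<open>f\<close> in the boundary of \<open>z\<close>. Induction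
  then gains a new lowest or a new highest level. For \<open>p = 0\<close> the term
  \<open>1 \<otimes> z\<close> contributes as well, hence the exception.\<close>

lemma homotopy_d_below: "z < r (p + q) \<Longrightarrow> a < r p \<Longrightarrow> homotopy_d q p z a \<noteq> 0 \<Longrightarrow> p = 0 \<or> below p a (p + q) z"
proof (induction q arbitrary: p z a)
  case 0
  then show ?case by (auto simp: homotopy_d_0 below_def split: if_splits dest!: le_antisym)
next
  case (Suc q)
  show ?case
  proof (cases "p = 0")
    case False
    have z: "z < r (Suc (p + q))" using Suc.prems by simp
    from Suc.prems(3) False
    consider "lcomb (r (Suc p)) (homotopy q (Suc p) z) (\<lambda>e. D p e a) \<noteq> 0"
      | "lcomb (r (p + q)) (\<lambda>f. homotopy q p f a) (D (p + q) z) \<noteq> 0"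
      by (fastforce simp: homotopy_d_Suc)
    then have "below p a (p + Suc q) z"
    proof cases
      case 1
      then obtain e where e: "e < r (Suc p)" "homotopy q (Suc p) z e \<noteq> 0" "D p e a \<noteq> 0"
        using lcomb_cong[of "r (Suc p)" "\<lambda>e. D p e a" "homotopy q (Suc p) z" "\<lambda>_. 0"] by auto
      then have "below (Suc p) e (Suc p + q) z"
        using Suc.IH[OF _ e(1) homotopy_nonzero_imp_homotopy_d[OF e(2)]] z by simp
      moreover have ae: "g p a \<le> g (Suc p) e"
        using boundary_chains[OF e(1)] e(3) by (simp add: chains_iff)
      ultimately have *: "\<exists>b<r l. g p a \<le> g l b \<and> g l b \<le> g (Suc (p + q)) z"
        if "Suc p \<le> l" "l \<le> Suc (p + q)" for l
        using that unfolding below_def by (metis add_Suc order_trans)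
      have "g p a \<le> g (Suc (p + q)) z" using *[of "Suc p"] by (meson le_add1 Suc_le_mono le_refl order_trans)
      then show ?thesis
        unfolding below_def using * Suc.prems(2) by (metis add_Suc_right le_antisym not_less_eq_eq order_refl)
    next
      case 2
      then obtain f where f: "f < r (p + q)" "homotopy q p f a \<noteq> 0" "D (p + q) z f \<noteq> 0"
        using lcomb_cong[of "r (p + q)" "D (p + q) z" "\<lambda>f. homotopy q p f a" "\<lambda>_. 0"] by auto
      then have b: "below p a (p + q) f"
        using Suc.IH[OF f(1) Suc.prems(2) homotopy_nonzero_imp_homotopy_d[OF f(2)]] False by simp
      have fz: "g (p + q) f \<le> g (Suc (p + q)) z"
        using boundary_chains[OF z] f(3) by (simp add: chains_iff)
      have az: "g p a \<le> g (Suc (p + q)) z" using below_le[OF b] fz by simp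
      show ?thesis
        unfolding below_def
      proof (intro allI impI)
        fix l assume l: "p \<le> l \<and> l \<le> p + Suc q"
        show "\<exists>b<r l. g p a \<le> g l b \<and> g l b \<le> g (p + Suc q) z"
        proof (cases "l \<le> p + q")
          case True
          with b l fz show ?thesis unfolding below_def by (metis add_Suc_right order_trans)
        next
          case False
          with l have "l = Suc (p + q)" by simp
          with z az show ?thesis by auto
        qed
      qed
    qed
    then show ?thesis by simp
  qed simp
qed

lemma homotopy_le: "z < r (p + q) \<Longrightarrow> a < r p \<Longrightarrow> homotopy q p z a \<noteq> 0 \<Longrightarrow> g p a \<le> g (p + q) z"
  using homotopy_d_below[OF _ _ homotopy_nonzero_imp_homotopy_d, of z p q a] below_le[of p a "p + q" z]
  by (cases "p = 0") (simp_all add: r0 g0_least)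

end

section \<open>The multiplication and the product of the cut homotopy\<close>

context minimal_strand_resolution
begin

text \<open>A multiplication \<open>P \<otimes> P \<rightarrow> P\<close> lifting that of \<open>S/I\<close>.\<close>

fun pmult :: "nat \<Rightarrow> nat \<Rightarrow> nat \<Rightarrow> nat \<Rightarrow> nat \<Rightarrow> 'k" where
  "pmult 0 q a b = unit_vec b"
| "pmult (Suc p) 0 a b = preimage p (sup (g (Suc p) a) (g 0 b)) (lcomb (r p) (\<lambda>e. pmult p 0 e b) (D p a))"
| "pmult (Suc p) (Suc q) a b = preimage (p + Suc q) (sup (g (Suc p) a) (g (Suc q) b))
     (lcomb (r p) (\<lambda>e. pmult p (Suc q) e b) (D p a)
      + smul ((- 1) ^ Suc p) (lcomb (r q) (pmult (Suc p) q a) (D q b)))"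

text \<open>The Leibniz term \<open>a (d b)\<close> for \<open>a\<close> of homological degree
  \<open>Suc p\<close>; the shift makes \<open>pmult_boundary p q a b\<close> the prescribed
  boundary of \<open>pmult (Suc p) q a b\<close>.\<close>

definition second_part :: "nat \<Rightarrow> nat \<Rightarrow> nat \<Rightarrow> nat \<Rightarrow> nat \<Rightarrow> 'k" where
  "second_part p q a b = (case q of 0 \<Rightarrow> 0 | Suc q' \<Rightarrow> lcomb (r q') (pmult (Suc p) q' a) (D q' b))"

definition pmult_boundary :: "nat \<Rightarrow> nat \<Rightarrow> nat \<Rightarrow> nat \<Rightarrow> nat \<Rightarrow> 'k" where
  "pmult_boundary p q a b =
     lcomb (r p) (\<lambda>e. pmult p q e b) (D p a) + smul ((- 1) ^ Suc p) (second_part p q a b)"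

lemma pmult_Suc: "pmult (Suc p) q a b = preimage (p + q) (sup (g (Suc p) a) (g q b)) (pmult_boundary p q a b)"
  by (cases q) (simp_all add: pmult_boundary_def second_part_def)

text \<open>Leibniz rule for \<open>a (d b)\<close>: the summand with the double boundary of
  \<open>b\<close> drops out.\<close>

lemma pmult_boundary_lcomb:
  assumes b: "b < r (Suc q')"
  shows "lcomb (r q') (pmult_boundary p q' a) (D q' b)
    = lcomb (r q') (\<lambda>k. lcomb (r p) (\<lambda>e. pmult p q' e k) (D p a)) (D q' b)"
proof -
  have "lcomb (r q') (second_part p q' a) (D q' b) = 0"
  proof (cases q')
    case 0
    have "lcomb (r 0) (second_part p 0 a) (D 0 b) = lcomb (r 0) (\<lambda>_. 0) (D 0 b)"
      by (rule lcomb_cong) (simp add: second_part_def)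
    then show ?thesis by (simp add: 0)
  next
    case (Suc k)
    have "lcomb (r (Suc k)) (second_part p (Suc k) a) (D (Suc k) b)
        = lcomb (r (Suc k)) (\<lambda>f. lcomb (r k) (pmult (Suc p) k a) (D k f)) (D (Suc k) b)"
      by (rule lcomb_cong) (simp add: second_part_def)
    also have "\<dots> = lcomb (r k) (pmult (Suc p) k a) (d k (D (Suc k) b))"
      by (rule lcomb_lcomb[symmetric])
    also have "\<dots> = 0" using b Suc by simp
    finally show ?thesis by (simp add: Suc)
  qed
  moreover have "lcomb (r q') (pmult_boundary p q' a) (D q' b) =
     lcomb (r q') (\<lambda>k. lcomb (r p) (\<lambda>e. pmult p q' e k) (D p a) + smul ((- 1) ^ Suc p) (second_part p q' a k)) (D q' b)"
    by (rule lcomb_cong) (simp add: pmult_boundary_def)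
  ultimately show ?thesis by (simp only: lcomb_add_left lcomb_smul_left smul_zero add_0_right)
qed

text \<open>A chosen preimage has the right degree and boundary only if the prescribed boundary is a
  cycle, and that uses the Leibniz rule for smaller indices. So both are proved together, by an
  outer induction on \<open>p\<close> and an inner one on \<open>q\<close>.\<close>

lemma pmult_chains_boundary:
  "(\<forall>q a b. a < r p \<longrightarrow> b < r q \<longrightarrow> pmult p q a b \<in> chain_space r g (p + q) (sup (g p a) (g q b))) \<and>
   (\<forall>p'. p = Suc p' \<longrightarrow> (\<forall>q a b. a < r p \<longrightarrow> b < r q \<longrightarrow> d (p' + q) (pmult p q a b) = pmult_boundary p' q a b))"
proof (induction p)
  case 0
  then show ?case by (auto intro: unit_chains)
next
  case (Suc p)
  have IH_chains: "pmult p q a b \<in> chain_space r g (p + q) (sup (g p a) (g q b))"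
    if "a < r p" "b < r q" for q a b using Suc.IH that by blast
  have IH_d: "d (p' + q) (pmult p q a b) = pmult_boundary p' q a b"
    if "p = Suc p'" "a < r p" "b < r q" for p' q a b using Suc.IH that by blast
  text \<open>Uniform in \<open>p\<close>, including \<open>p = 0\<close> where \<open>pmult\<close> is the unit.\<close>
  have first: "d n (lcomb (r p) (\<lambda>e. pmult p q e b) (D p a))
      = smul ((- 1) ^ p) (lcomb (r p) (\<lambda>e. case q of 0 \<Rightarrow> 0 | Suc q' \<Rightarrow> lcomb (r q') (pmult p q' e) (D q' b)) (D p a))"
    if a: "a < r (Suc p)" and b: "b < r q" and n: "p + q = Suc n" for q a b n
  proof (cases p)
    case 0
    then have q: "q = Suc n" using n by simp
    have "d n (lcomb (r 0) (\<lambda>e. pmult 0 q e b) (D 0 a)) = lcomb (r 0) (\<lambda>e. D n b) (D 0 a)"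
      unfolding lcomb_lcomb using b q by simp
    also have "\<dots> = lcomb (r 0) (\<lambda>e. lcomb (r n) (pmult 0 n e) (D n b)) (D 0 a)"
    proof (rule lcomb_cong)
      fix e
      have "D n b = lcomb (r n) unit_vec (D n b)"
        using lcomb_unit_left[OF chains_free_mod[OF boundary_chains[of b n]]] b q by simp
      also have "\<dots> = lcomb (r n) (pmult 0 n e) (D n b)"
        by (rule lcomb_cong) simp
      finally show "D n b = lcomb (r n) (pmult 0 n e) (D n b)" .
    qed
    finally show ?thesis by (simp add: 0 q)
  next
    case (Suc p')
    then have n': "n = p' + q" using n by simp
    have "d n (lcomb (r p) (\<lambda>e. pmult p q e b) (D p a)) = lcomb (r p) (\<lambda>e. pmult_boundary p' q e b) (D p a)"
      unfolding lcomb_lcomb by (rule lcomb_cong) (use IH_d[OF Suc _ b] n' in simp)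
    also have "\<dots> = lcomb (r p) (\<lambda>e. lcomb (r p') (\<lambda>k. pmult p' q k b) (D p' e)) (D p a)
        + smul ((- 1) ^ p) (lcomb (r p) (\<lambda>e. second_part p' q e b) (D p a))"
      unfolding pmult_boundary_def lcomb_add_left lcomb_smul_left by (simp add: Suc)
    also have "lcomb (r p) (\<lambda>e. lcomb (r p') (\<lambda>k. pmult p' q k b) (D p' e)) (D p a)
        = lcomb (r p') (\<lambda>k. pmult p' q k b) (d p' (D p a))"
      unfolding Suc by (rule lcomb_lcomb[symmetric])
    also have "\<dots> = 0" using a by (simp add: Suc)
    finally have "d n (lcomb (r p) (\<lambda>e. pmult p q e b) (D p a))
        = 0 + smul ((- 1) ^ p) (lcomb (r p) (\<lambda>e. second_part p' q e b) (D p a))" .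
    moreover have "second_part p' q e b
        = (case q of 0 \<Rightarrow> 0 | Suc q' \<Rightarrow> lcomb (r q') (pmult p q' e) (D q' b))" for e
      unfolding second_part_def Suc ..
    ultimately show ?thesis by (simp only: add_0)
  qed
  have main: "pmult (Suc p) q a b \<in> chain_space r g (Suc p + q) (sup (g (Suc p) a) (g q b)) \<and>
      d (p + q) (pmult (Suc p) q a b) = pmult_boundary p q a b" if a: "a < r (Suc p)" and "b < r q" for q a b
    using that(2)
  proof (induction q arbitrary: b)
    case 0
    let ?x = "sup (g (Suc p) a) (g 0 b)"
    have "pmult_boundary p 0 a b = lcomb (r p) (\<lambda>e. pmult p 0 e b) (D p a)"
      by (simp add: pmult_boundary_def second_part_def)
    moreover have "lcomb (r p) (\<lambda>e. pmult p 0 e b) (D p a) \<in> chain_space r g (p + 0) ?x"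
    proof (rule lcomb_chains_gen)
      fix e assume "e < r p" "D p a e \<noteq> 0"
      then show "pmult p 0 e b \<in> chain_space r g (p + 0) ?x"
        using chains_mono[OF IH_chains[OF _ 0] sup_mono[OF chains_support_le[OF boundary_chains[OF a]] order_refl]]
        by blast
    qed
    moreover have "cyc J r D c (p + 0) ?x (lcomb (r p) (\<lambda>e. pmult p 0 e b) (D p a))"
    proof (cases p)
      case 0
      \<comment> \<open>The degree of \<open>a\<close>, hence also the lcm, lies in
        \<open>J\<close>, so every chain is a cycle here.\<close>
      then show ?thesis using degree_in[of a 0] a upset[of "g (Suc 0) a" ?x] by (simp add: cyc_def)
    next
      case (Suc p')
      then show ?thesis using first[OF a 0, of p'] by (simp add: cyc_def)
    qed
    ultimately show ?case unfolding pmult_Suc using preimage by simp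
  next
    case (Suc q)
    let ?x = "sup (g (Suc p) a) (g (Suc q) b)"
    note b = Suc.prems
    have "lcomb (r p) (\<lambda>e. pmult p (Suc q) e b) (D p a) \<in> chain_space r g (p + Suc q) ?x"
    proof (rule lcomb_chains_gen)
      fix e assume "e < r p" "D p a e \<noteq> 0"
      then show "pmult p (Suc q) e b \<in> chain_space r g (p + Suc q) ?x"
        using chains_mono[OF IH_chains[OF _ b] sup_mono[OF chains_support_le[OF boundary_chains[OF a]] order_refl]]
        by blast
    qed
    moreover have "lcomb (r q) (pmult (Suc p) q a) (D q b) \<in> chain_space r g (p + Suc q) ?x"
    proof (rule lcomb_chains_gen)
      fix e assume "e < r q" "D q b e \<noteq> 0"
      then show "pmult (Suc p) q a e \<in> chain_space r g (p + Suc q) ?x"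
        using chains_mono[OF conjunct1[OF Suc.IH] sup_mono[OF order_refl chains_support_le[OF boundary_chains[OF b]]]]
        by (simp only: add_Suc_shift)
    qed
    ultimately have chain: "pmult_boundary p (Suc q) a b \<in> chain_space r g (p + Suc q) ?x"
      unfolding pmult_boundary_def second_part_def by (simp add: chains_add chains_smul)
    \<comment> \<open>Both Leibniz terms have boundary \<open>(d a)(d b)\<close> up to sign, and the
      signs are opposite.\<close>
    have "d (p + q) (lcomb (r q) (pmult (Suc p) q a) (D q b)) = lcomb (r q) (pmult_boundary p q a) (D q b)"
      unfolding lcomb_lcomb by (rule lcomb_cong) (use Suc.IH in simp)
    also have "\<dots> = lcomb (r q) (\<lambda>k. lcomb (r p) (\<lambda>e. pmult p q e k) (D p a)) (D q b)"
      using pmult_boundary_lcomb[OF b] .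
    also have "\<dots> = lcomb (r p) (\<lambda>e. lcomb (r q) (pmult p q e) (D q b)) (D p a)"
      using lcomb_swap[of "r q" "r p" "pmult p q" "D p a" "D q b"] .
    finally have "d (p + q) (pmult_boundary p (Suc q) a b) = 0"
      using first[OF a b, of "p + q"]
      by (simp add: pmult_boundary_def second_part_def lcomb_add lcomb_smul fun_eq_iff)
    then have "cyc J r D c (p + Suc q) ?x (pmult_boundary p (Suc q) a b)"
      by (simp add: cyc_def)
    with chain show ?case unfolding pmult_Suc using preimage by simp
  qed
  then show ?case by auto
qed

lemma pmult_chains: "a < r p \<Longrightarrow> b < r q \<Longrightarrow> pmult p q a b \<in> chain_space r g (p + q) (sup (g p a) (g q b))"
  using pmult_chains_boundary by blast

lemma d_pmult: "a < r (Suc p) \<Longrightarrow> b < r q \<Longrightarrow> d (p + q) (pmult (Suc p) q a b) = pmult_boundary p q a b"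
  using pmult_chains_boundary[of "Suc p"] by blast

text \<open>
  The product of \<open>\<Sum>\<^sub>a a \<otimes> homotopy_d q p z a\<close>.  Up to lower degrees it is \<open>z\<close> for every \<open>p \<ge> 1\<close>: passing from \<open>p\<close> to \<open>p + 1\<close>
  changes it by a boundary, and boundaries have lower degree by minimality.
\<close>

definition pmult_diag :: "nat \<Rightarrow> nat \<Rightarrow> nat \<Rightarrow> nat \<Rightarrow> 'k" where
  "pmult_diag p q z = (\<Sum>a<r p. lcomb (r q) (pmult p q a) (homotopy_d q p z a))"

text \<open>In column \<open>0\<close> multiplication is by the unit, so the product is just
  \<open>d\<close> of a homotopy component, and boundaries are lower.\<close>

lemma pmult_diag_0_lower:
  assumes "z < r q"
  shows "pmult_diag 0 q z \<in> lower_space r g q (g q z)"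
proof -
  have homotopy_d: "homotopy_d q 0 z 0 \<in> chain_space r g q (g q z)"
    using homotopy_d_cycle[of z 0 q 0] assms by (simp add: r0)
  have "pmult_diag 0 q z = lcomb (r q) unit_vec (homotopy_d q 0 z 0)"
    by (simp add: pmult_diag_def r0 lcomb_def)
  also have "\<dots> = homotopy_d q 0 z 0" by (rule lcomb_unit_left[OF chains_free_mod[OF homotopy_d]])
  also have "\<dots> = d q (homotopy q 0 z 0)" using d_homotopy[of z 0 q 0] assms by (simp add: r0)
  finally show ?thesis using homotopy_chains[of z 0 q 0] assms d_minimal by (simp add: r0)
qed

text \<open>Take the boundary of the multiplied homotopy component in bidegree
  \<open>(p + 1, q + 1)\<close>. Its Leibniz terms are the product at \<open>(p + 1, q)\<close> and
  a term that the recursion for \<open>homotopy_d\<close> relates to the product at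
  \<open>(p, q + 1)\<close>.\<close>

lemma pmult_diag_step:
  assumes z: "z < r (Suc (p + q))"
  shows "pmult_diag (Suc p) q z - pmult_diag p (Suc q) z - (if p = 0 then unit_vec z else 0)
    \<in> lower_space r g (Suc (p + q)) (g (Suc (p + q)) z)"
proof -
  let ?low = "lower_space r g (Suc (p + q)) (g (Suc (p + q)) z)"
  \<comment> \<open>The products of that component (\<open>Y\<close>), of its boundary in the first
    factor (\<open>A\<close>), and of the homotopy applied to the boundary of \<open>z\<close>
    (\<open>L\<close>).\<close>
  define Y where "Y = (\<Sum>a<r (Suc p). lcomb (r (Suc q)) (pmult (Suc p) (Suc q) a) (homotopy q (Suc p) z a))"
  define A where "A = (\<Sum>e<r p. lcomb (r (Suc q)) (pmult p (Suc q) e) (lcomb (r (Suc p)) (homotopy q (Suc p) z) (\<lambda>a. D p a e)))"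
  define L where "L = (\<Sum>e<r p. lcomb (r (Suc q)) (pmult p (Suc q) e) (lcomb (r (p + q)) (\<lambda>f. homotopy q p f e) (D (p + q) z)))"
  have "Y \<in> chain_space r g (Suc (Suc (p + q))) (g (Suc (p + q)) z)"
    unfolding Y_def
  proof (intro chains_sum lcomb_chains_gen)
    fix a b assume a: "a \<in> {..<r (Suc p)}" and b: "b < r (Suc q)" and homotopy: "homotopy q (Suc p) z a b \<noteq> 0"
    have "homotopy q (Suc p) z a \<noteq> 0" using homotopy by (metis zero_fun_apply)
    then have "g (Suc p) a \<le> g (Suc (p + q)) z" using homotopy_le[of z "Suc p" q a] z a by simp
    moreover have "g (Suc q) b \<le> g (Suc (p + q)) z"
      using homotopy_chains[of z "Suc p" q a] z a homotopy by (simp add: chains_iff)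
    ultimately show "pmult (Suc p) (Suc q) a b \<in> chain_space r g (Suc (Suc (p + q))) (g (Suc (p + q)) z)"
      using pmult_chains[of a "Suc p" b "Suc q"] a b by (simp, elim chains_mono) simp
  qed
  then have dY: "d (Suc (p + q)) Y \<in> ?low" by (rule d_minimal)
  have "d (Suc (p + q)) (lcomb (r (Suc q)) (pmult (Suc p) (Suc q) a) (homotopy q (Suc p) z a))
      = lcomb (r p) (\<lambda>e. lcomb (r (Suc q)) (pmult p (Suc q) e) (homotopy q (Suc p) z a)) (D p a)
        + lcomb (r q) (pmult (Suc p) q a) (homotopy_d q (Suc p) z a)" if a: "a < r (Suc p)" for a
  proof -
    have "d (Suc (p + q)) (lcomb (r (Suc q)) (pmult (Suc p) (Suc q) a) (homotopy q (Suc p) z a))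
        = lcomb (r (Suc q)) (\<lambda>b. lcomb (r p) (\<lambda>e. pmult p (Suc q) e b) (D p a)
            + smul ((- 1) ^ Suc p) (lcomb (r q) (pmult (Suc p) q a) (D q b))) (homotopy q (Suc p) z a)"
      unfolding lcomb_lcomb
      by (rule lcomb_cong) (use d_pmult[OF a, of _ "Suc q"] in \<open>simp add: pmult_boundary_def second_part_def\<close>)
    also have "\<dots> = lcomb (r (Suc q)) (\<lambda>b. lcomb (r p) (\<lambda>e. pmult p (Suc q) e b) (D p a)) (homotopy q (Suc p) z a)
        + smul ((- 1) ^ Suc p) (lcomb (r q) (pmult (Suc p) q a) (d q (homotopy q (Suc p) z a)))"
      by (simp only: lcomb_add_left lcomb_smul_left lcomb_lcomb)
    also have "lcomb (r (Suc q)) (\<lambda>b. lcomb (r p) (\<lambda>e. pmult p (Suc q) e b) (D p a)) (homotopy q (Suc p) z a)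
        = lcomb (r p) (\<lambda>e. lcomb (r (Suc q)) (pmult p (Suc q) e) (homotopy q (Suc p) z a)) (D p a)"
      by (rule lcomb_swap)
    \<comment> \<open>The sign of the Leibniz rule cancels the sign in
      \<open>d_homotopy\<close>.\<close>
    also have "smul ((- 1) ^ Suc p) (lcomb (r q) (pmult (Suc p) q a) (d q (homotopy q (Suc p) z a)))
        = lcomb (r q) (pmult (Suc p) q a) (homotopy_d q (Suc p) z a)"
      using d_homotopy[of z "Suc p" q a] z a by (simp add: lcomb_smul flip: power_mult_distrib)
    finally show ?thesis .
  qed
  then have "d (Suc (p + q)) Y = (\<Sum>a<r (Suc p). lcomb (r p) (\<lambda>e. lcomb (r (Suc q)) (pmult p (Suc q) e) (homotopy q (Suc p) z a)) (D p a))
      + pmult_diag (Suc p) q z"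
    unfolding Y_def pmult_diag_def lcomb_sum by (simp add: sum.distrib)
  also have "(\<Sum>a<r (Suc p). lcomb (r p) (\<lambda>e. lcomb (r (Suc q)) (pmult p (Suc q) e) (homotopy q (Suc p) z a)) (D p a)) = A"
    unfolding A_def lcomb_lcomb unfolding lcomb_eq_sum by (rule sum.swap)
  finally have 1: "d (Suc (p + q)) Y = A + pmult_diag (Suc p) q z" .
  have "pmult_diag p (Suc q) z = - A - (\<Sum>e<r p. lcomb (r (Suc q)) (pmult p (Suc q) e) (if p = 0 then unit_vec z else 0)) - L"
    unfolding pmult_diag_def A_def L_def homotopy_d_Suc lcomb_diff lcomb_uminus by (simp add: sum_subtractf sum_negf del: if_split)
  moreover have "(\<Sum>e<r p. lcomb (r (Suc q)) (pmult p (Suc q) e) (if p = 0 then unit_vec z else 0)) = (if p = 0 then unit_vec z else 0)"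
    using z by (auto simp: r0)
  ultimately have 2: "pmult_diag p (Suc q) z = - A - (if p = 0 then unit_vec z else 0) - L" by simp
  have L: "L \<in> ?low"
  proof -
    have "L = (\<Sum>e<r p. lcomb (r (p + q)) (\<lambda>f. lcomb (r (Suc q)) (pmult p (Suc q) e) (homotopy q p f e)) (D (p + q) z))"
      by (simp add: L_def lcomb_lcomb)
    also have "\<dots> \<in> ?low"
    proof (intro lower_space_sum lcomb_lower_gen)
      fix e f b assume e: "e \<in> {..<r p}" and f: "f < r (p + q)" "D (p + q) z f \<noteq> 0"
        and b: "b < r (Suc q)" "homotopy q p f e b \<noteq> 0"
      have "homotopy q p f e \<noteq> 0" using b(2) by (metis zero_fun_apply)
      then have "g p e \<le> g (p + q) f" using homotopy_le[OF f(1)] e by simp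
      moreover have "g (Suc q) b \<le> g (p + q) f" using homotopy_chains[OF f(1)] e b by (simp add: chains_iff)
      ultimately have "sup (g p e) (g (Suc q) b) \<le> g (p + q) f" by simp
      also have "g (p + q) f < g (Suc (p + q)) z"
        using minimal[OF z] f(2) by (simp add: lower_space_iff)
      finally show "pmult p (Suc q) e b \<in> ?low"
        using pmult_chains[of e p b "Suc q"] e b by (auto intro: chains_lower)
    qed
    finally show ?thesis .
  qed
  have "pmult_diag (Suc p) q z - pmult_diag p (Suc q) z - (if p = 0 then unit_vec z else 0) = d (Suc (p + q)) Y + L"
    unfolding 1 2 by (simp add: algebra_simps del: if_split)
  then show ?thesis using lower_space_add[OF dY L] by simp
qed

text \<open>Telescoping in \<open>p\<close> with \<open>p + q\<close> fixed: \<open>z\<close> enters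
  exactly once, in the step from column \<open>0\<close>, through
  \<open>1 \<otimes> z\<close>.\<close>

lemma pmult_diag_eq_unit:
  "z < r (Suc p + q) \<Longrightarrow> pmult_diag (Suc p) q z - unit_vec z \<in> lower_space r g (Suc p + q) (g (Suc p + q) z)"
proof (induction p arbitrary: q)
  case 0
  have "pmult_diag (Suc 0) q z - unit_vec z = (pmult_diag (Suc 0) q z - pmult_diag 0 (Suc q) z - unit_vec z) + pmult_diag 0 (Suc q) z"
    by simp
  also have "\<dots> \<in> lower_space r g (Suc q) (g (Suc q) z)"
    by (rule lower_space_add) (use pmult_diag_step[of z 0 q] pmult_diag_0_lower[of z "Suc q"] 0 in auto)
  finally show ?case by (simp only: add_Suc add_0)
next
  case (Suc p)
  have "pmult_diag (Suc (Suc p)) q z - unit_vec z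
      = (pmult_diag (Suc (Suc p)) q z - pmult_diag (Suc p) (Suc q) z) + (pmult_diag (Suc p) (Suc q) z - unit_vec z)"
    by simp
  also have "\<dots> \<in> lower_space r g (Suc (Suc p) + q) (g (Suc (Suc p) + q) z)"
  proof (rule lower_space_add)
    show "pmult_diag (Suc (Suc p)) q z - pmult_diag (Suc p) (Suc q) z \<in> lower_space r g (Suc (Suc p) + q) (g (Suc (Suc p) + q) z)"
      using pmult_diag_step[of z "Suc p" q] Suc.prems by simp
    show "pmult_diag (Suc p) (Suc q) z - unit_vec z \<in> lower_space r g (Suc (Suc p) + q) (g (Suc (Suc p) + q) z)"
      using Suc.IH[of "Suc q"] Suc.prems by (simp only: add_Suc add_Suc_right)
  qed
  finally show ?case .
qed

text \<open>Writing \<open>Suc p\<close> keeps the cut away from column \<open>0\<close>, where the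
  product is congruent to \<open>0\<close> instead of \<open>z\<close>. The clause
  \<open>below\<close> is recorded for raising the first factor afterwards.\<close>

lemma split_basis_element:
  assumes z: "z < r (Suc p + q)"
  shows "\<exists>a<r (Suc p). \<exists>b<r q. sup (g (Suc p) a) (g q b) = g (Suc p + q) z \<and> below (Suc p) a (Suc p + q) z"
proof (rule ccontr)
  assume contra: "\<not> ?thesis"
  have "pmult_diag (Suc p) q z \<in> lower_space r g (Suc p + q) (g (Suc p + q) z)"
    unfolding pmult_diag_def
  proof (intro lower_space_sum lcomb_lower_gen)
    fix a b assume a: "a \<in> {..<r (Suc p)}" and b: "b < r q" "homotopy_d q (Suc p) z a b \<noteq> 0"
    have "homotopy_d q (Suc p) z a \<noteq> 0" using b(2) by (metis zero_fun_apply)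
    then have below: "below (Suc p) a (Suc p + q) z" using homotopy_d_below[OF z] a by blast
    then have "g (Suc p) a \<le> g (Suc p + q) z" by (rule below_le) simp
    moreover have "g q b \<le> g (Suc p + q) z"
      using homotopy_d_cycle[OF z, of a] a b by (simp add: chains_iff)
    ultimately have "sup (g (Suc p) a) (g q b) < g (Suc p + q) z"
      using contra below a b by (metis le_supI lessThan_iff order_less_le)
    then show "pmult (Suc p) q a b \<in> lower_space r g (Suc p + q) (g (Suc p + q) z)"
      using pmult_chains[of a "Suc p" b q] a b by (auto intro: chains_lower)
  qed
  from lower_space_diff[OF this pmult_diag_eq_unit[OF z]]
  have "(unit_vec z :: nat \<Rightarrow> 'k) \<in> lower_space r g (Suc p + q) (g (Suc p + q) z)" by simp
  then show False by (auto simp: lower_space_iff unit_vec_apply dest: spec[of _ z])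
qed

theorem degree_splitting:
  assumes "1 \<le> i" "1 \<le> j" "k \<le> min i j" and z: "z < r (i + j - k)"
  shows "\<exists>a<r i. \<exists>b<r j. sup (g i a) (g j b) = g (i + j - k) z"
proof -
  define n where "n = i + j - k"
  have *: "\<exists>a<r i. \<exists>b<r j. sup (g i a) (g j b) = g n z"
    if ij: "1 \<le> i" "1 \<le> j" "i \<le> n" "j < n" "n \<le> i + j" and z: "z < r n" for i j
  proof -
    \<comment> \<open>Cut at second degree \<open>j\<close>. The first factor then has homological
      degree \<open>n - j\<close>, which is at least \<open>1\<close> and at most \<open>i\<close>,
      and \<open>below\<close> raises it to \<open>i\<close>.\<close>
    obtain p where p: "n - j = Suc p" using ij by (metis Suc_diff_Suc)
    have n: "n = Suc p + j" using p ij by linarith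
    obtain a b where ab: "a < r (Suc p)" "b < r j" "sup (g (Suc p) a) (g j b) = g n z"
      "below (Suc p) a n z"
      using split_basis_element[of z p j] z n by auto
    have "Suc p \<le> i" using n ij by linarith
    with ab(4) ij obtain a' where a': "a' < r i" "g (Suc p) a \<le> g i a'" "g i a' \<le> g n z"
      unfolding below_def by blast
    have "g n z \<le> sup (g i a') (g j b)" unfolding ab(3)[symmetric] using a'(2) by (rule sup_mono) simp
    moreover have "sup (g i a') (g j b) \<le> g n z"
      using a'(3) ab(3) by (metis le_sup_iff order_refl)
    ultimately have "sup (g i a') (g j b) = g n z" by simp
    with a' ab show ?thesis by blast
  qed
  have n: "i \<le> n" "j \<le> n" "n \<le> i + j" using assms(3) by (auto simp: n_def)
  \<comment> \<open>A cut needs \<open>j < n\<close>, or \<open>i < n\<close> after exchanging the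
    factors; in the remaining case \<open>z\<close> is paired with itself.\<close>
  consider "j < n" | "i < n" | "i = n" "j = n" using n by linarith
  then show ?thesis
  proof cases
    case 1
    then show ?thesis using *[of i j] assms n by (simp add: n_def)
  next
    case 2
    then show ?thesis using *[of j i] assms n by (metis add.commute n_def sup_commute)
  next
    case 3
    then show ?thesis using z by (metis n_def sup.idem)
  qed
qed

end

section \<open>Existence of minimal resolutions\<close>

lemma vector_space_smul: "vector_space smul"
  by unfold_locales (auto simp: fun_eq_iff algebra_simps)

lemma finite_spanning_subset:
  fixes V :: "(nat \<Rightarrow> 'k::field) set"
  assumes "V \<subseteq> free_mod s"
  shows "\<exists>B. finite B \<and> B \<subseteq> V \<and> \<not> module.dependent smul B \<and> V \<subseteq> module.span smul B"
proof -
  interpret vector_space "smul :: 'k \<Rightarrow> _" by (rule vector_space_smul)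
  obtain B where B: "B \<subseteq> V" "independent B" "V \<subseteq> span B" by (rule basis_exists)
  have "free_mod s \<subseteq> span (unit_vec ` {..<s})"
  proof
    fix v :: "nat \<Rightarrow> 'k" assume "v \<in> free_mod s"
    then have "v = (\<Sum>b<s. smul (v b) (unit_vec b))"
      using lcomb_unit_left[of v s] by (simp add: lcomb_eq_sum)
    then show "v \<in> span (unit_vec ` {..<s})"
      by (metis (no_types, lifting) imageI span_base span_scale span_sum)
  qed
  then have "B \<subseteq> span (unit_vec ` {..<s})" using B(1) assms by blast
  then have "finite B" using independent_span_bound[OF _ B(2)] by blast
  with B show ?thesis by blast
qed

text \<open>A homogeneous generating set of least cardinality has no relation with a unit coefficient.\<close>

lemma minimal_generators_exist:
  fixes Z :: "'a::order \<Rightarrow> (nat \<Rightarrow> 'k::field) set"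
  assumes fin: "finite \<Lambda>" and sub: "\<And>x. Z x \<subseteq> free_mod s"
    and subspace: "\<And>x. module.subspace smul (Z x)"
    and mono: "\<And>x y. x \<le> y \<Longrightarrow> Z x \<subseteq> Z y"
    and retract: "\<And>x. \<exists>y\<in>\<Lambda>. y \<le> x \<and> Z x \<subseteq> Z y"
  shows "\<exists>s' g e. (\<forall>b<s'. g b \<in> \<Lambda> \<and> e b \<in> Z (g b)) \<and>
    (\<forall>x. \<forall>v\<in>Z x. \<exists>u\<in>free_mod s'. (\<forall>b. u b \<noteq> 0 \<longrightarrow> g b \<le> x) \<and> lcomb s' e u = v) \<and>
    (\<forall>u\<in>free_mod s'. \<forall>b<s'. lcomb s' e u = 0 \<longrightarrow> (\<forall>c. u c \<noteq> 0 \<longrightarrow> g c \<le> g b) \<longrightarrow> u b = 0)"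
proof -
  interpret vector_space "smul :: 'k \<Rightarrow> _" by (rule vector_space_smul)
  \<comment> \<open>Generators are pairs of a degree and a vector, so one vector may serve in
    several degrees.\<close>
  define gen where "gen G \<longleftrightarrow> finite G \<and> (\<forall>p\<in>G. fst p \<in> \<Lambda> \<and> snd p \<in> Z (fst p)) \<and>
    (\<forall>x. Z x \<subseteq> span (snd ` {p \<in> G. fst p \<le> x}))" for G :: "('a \<times> (nat \<Rightarrow> 'k)) set"
  obtain \<B> where \<B>: "\<And>x. finite (\<B> x)" "\<And>x. \<B> x \<subseteq> Z x" "\<And>x. Z x \<subseteq> span (\<B> x)"
    using finite_spanning_subset[OF sub] by metis
  have "gen (SIGMA x:\<Lambda>. \<B> x)"
    unfolding gen_def
  proof (intro conjI allI ballI)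
    show "finite (SIGMA x:\<Lambda>. \<B> x)" using fin \<B>(1) by auto
    show "fst p \<in> \<Lambda>" "snd p \<in> Z (fst p)" if "p \<in> (SIGMA x:\<Lambda>. \<B> x)" for p
      using that \<B>(2)[of "fst p"] by auto
    fix x
    obtain y where y: "y \<in> \<Lambda>" "y \<le> x" "Z x \<subseteq> Z y" using retract by blast
    have "\<B> y \<subseteq> snd ` {p \<in> SIGMA x:\<Lambda>. \<B> x. fst p \<le> x}" using y by force
    then show "Z x \<subseteq> span (snd ` {p \<in> SIGMA x:\<Lambda>. \<B> x. fst p \<le> x})"
      using y(3) \<B>(3)[of y] span_mono by blast
  qed
  then obtain G where G: "gen G" and least: "\<And>H. gen H \<Longrightarrow> card G \<le> card H"
    using ex_has_least_nat[of gen _ card] by blast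
  have finG: "finite G" using G by (simp add: gen_def)
  \<comment> \<open>Otherwise \<open>p\<close> could be dropped: any bound admitting
    \<open>p\<close> also admits the generators that express it.\<close>
  have indep: "snd p \<notin> span (snd ` {q \<in> G - {p}. fst q \<le> fst p})" if p: "p \<in> G" for p
  proof
    assume *: "snd p \<in> span (snd ` {q \<in> G - {p}. fst q \<le> fst p})"
    have "gen (G - {p})"
      unfolding gen_def
    proof (intro conjI allI ballI)
      fix x
      have "snd ` {q \<in> G. fst q \<le> x} \<subseteq> span (snd ` {q \<in> G - {p}. fst q \<le> x})"
      proof
        fix e assume "e \<in> snd ` {q \<in> G. fst q \<le> x}"
        then obtain q where q: "q \<in> G" "fst q \<le> x" "e = snd q" by blast
        show "e \<in> span (snd ` {q \<in> G - {p}. fst q \<le> x})"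
        proof (cases "q = p")
          case True
          have "snd ` {q \<in> G - {p}. fst q \<le> fst p} \<subseteq> snd ` {q \<in> G - {p}. fst q \<le> x}"
            using q(2) True by (intro image_mono) auto
          then show ?thesis using * q(3) True span_mono by blast
        next
          case False
          then show ?thesis using q by (intro span_base) blast
        qed
      qed
      then have "span (snd ` {q \<in> G. fst q \<le> x}) \<subseteq> span (snd ` {q \<in> G - {p}. fst q \<le> x})"
        by (rule span_minimal) (rule subspace_span)
      then show "Z x \<subseteq> span (snd ` {q \<in> G - {p}. fst q \<le> x})"
        using G unfolding gen_def by blast
    qed (use G in \<open>auto simp: gen_def\<close>)
    then have "card G \<le> card (G - {p})" by (rule least)
    then show False using p finG by (metis card_Diff1_less not_less)
  qed
  obtain h where h: "bij_betw h {..<card G} G"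
    using ex_bij_betw_nat_finite[OF finG] by (auto simp: atLeast0LessThan)
  define g where "g = fst \<circ> h"
  define e where "e = snd \<circ> h"
  have hG: "h b \<in> G" if "b < card G" for b using h that by (auto simp: bij_betw_def)
  have hinj: "h b \<noteq> h c" if "b < card G" "c < card G" "b \<noteq> c" for b c
    using h that by (auto simp: bij_betw_def inj_on_def)
  show ?thesis
  proof (intro exI conjI allI ballI impI)
    fix b assume "b < card G"
    then show "g b \<in> \<Lambda>" "e b \<in> Z (g b)" using hG G by (auto simp: gen_def g_def e_def)
  next
    fix x v assume v: "v \<in> Z x"
    define T where "T = {lcomb (card G) e u | u. u \<in> free_mod (card G) \<and> (\<forall>b. u b \<noteq> 0 \<longrightarrow> g b \<le> x)}"
    have "subspace T"
    proof (rule subspaceI)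
      show "0 \<in> T" unfolding T_def by (intro CollectI exI[of _ 0]) (auto simp: free_mod_def)
    next
      fix v w assume "v \<in> T" "w \<in> T"
      then obtain a b where ab: "v = lcomb (card G) e a" "w = lcomb (card G) e b"
        "a \<in> free_mod (card G)" "b \<in> free_mod (card G)"
        "\<forall>i. a i \<noteq> 0 \<longrightarrow> g i \<le> x" "\<forall>i. b i \<noteq> 0 \<longrightarrow> g i \<le> x" by (auto simp: T_def)
      have "\<forall>i. (a + b) i \<noteq> 0 \<longrightarrow> g i \<le> x" using ab(5,6) by (metis plus_fun_apply add_0)
      then show "v + w \<in> T" unfolding T_def using ab
        by (intro CollectI exI[of _ "a + b"]) (auto simp: lcomb_add free_mod_def)
    next
      fix k v assume "v \<in> T"
      then obtain a where a: "v = lcomb (card G) e a"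
        "a \<in> free_mod (card G)" "\<forall>i. a i \<noteq> 0 \<longrightarrow> g i \<le> x" by (auto simp: T_def)
      then show "smul k v \<in> T" unfolding T_def
        by (intro CollectI exI[of _ "smul k a"]) (auto simp: lcomb_smul free_mod_def)
    qed
    moreover have "snd ` {p \<in> G. fst p \<le> x} \<subseteq> T"
    proof
      fix w assume "w \<in> snd ` {p \<in> G. fst p \<le> x}"
      then obtain p where p: "p \<in> G" "fst p \<le> x" "w = snd p" by blast
      then obtain b where b: "b < card G" "h b = p"
        using bij_betw_imp_surj_on[OF h] by (metis imageE lessThan_iff)
      have "lcomb (card G) e (unit_vec b) = w" using b p by (simp add: e_def)
      then show "w \<in> T" unfolding T_def using b p(2)
        by (intro CollectI exI[of _ "unit_vec b"]) (auto simp: free_mod_def unit_vec_apply g_def)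
    qed
    ultimately have "span (snd ` {p \<in> G. fst p \<le> x}) \<subseteq> T" by (intro span_minimal)
    then have "v \<in> T" using G v unfolding gen_def by blast
    then show "\<exists>u\<in>free_mod (card G). (\<forall>b. u b \<noteq> 0 \<longrightarrow> g b \<le> x) \<and> lcomb (card G) e u = v"
      unfolding T_def by blast
  next
    fix u b assume u: "u \<in> free_mod (card G)" and b: "b < card G" and rel: "lcomb (card G) e u = 0"
      and le: "\<forall>c. u c \<noteq> 0 \<longrightarrow> g c \<le> g b"
    show "u b = 0"
    proof (rule ccontr)
      assume ub: "u b \<noteq> 0"
      \<comment> \<open>Solving the relation for \<open>e b\<close> expresses it by other generators
        of degree at most \<open>g b\<close>, against \<open>indep\<close>.\<close>
      have "0 = smul (u b) (e b) + (\<Sum>c\<in>{..<card G} - {b}. smul (u c) (e c))"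
        using rel b by (simp add: lcomb_eq_sum sum.remove[of _ b])
      then have "smul (u b) (e b) = - (\<Sum>c\<in>{..<card G} - {b}. smul (u c) (e c))"
        by (metis eq_neg_iff_add_eq_0)
      moreover have "(\<Sum>c\<in>{..<card G} - {b}. smul (u c) (e c))
          \<in> span (snd ` {q \<in> G - {h b}. fst q \<le> fst (h b)})"
      proof (rule span_sum)
        fix c assume c: "c \<in> {..<card G} - {b}"
        show "smul (u c) (e c) \<in> span (snd ` {q \<in> G - {h b}. fst q \<le> fst (h b)})"
        proof (cases "u c = 0")
          case True
          then show ?thesis by (simp add: span_zero)
        next
          case False
          then have "h c \<in> {q \<in> G - {h b}. fst q \<le> fst (h b)}"
            using le c b hG[of c] hinj[of c b] by (auto simp: g_def)
          then show ?thesis unfolding e_def comp_def by (intro span_scale span_base imageI)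
        qed
      qed
      ultimately have "smul (u b) (e b) \<in> span (snd ` {q \<in> G - {h b}. fst q \<le> fst (h b)})"
        by (simp only: span_neg)
      then have "smul (inverse (u b)) (smul (u b) (e b)) \<in> span (snd ` {q \<in> G - {h b}. fst q \<le> fst (h b)})"
        by (rule span_scale)
      then have "snd (h b) \<in> span (snd ` {q \<in> G - {h b}. fst q \<le> fst (h b)})"
        using ub by (simp add: e_def)
      with indep[OF hG[OF b]] show False by blast
    qed
  qed
qed

lemma minimal_resolution_exists:
  fixes J :: "'a::semilattice_sup set"
  assumes fin: "finite \<Lambda>" and upset: "\<And>x y. x \<in> J \<Longrightarrow> x \<le> y \<Longrightarrow> y \<in> J"
    and bottom: "o' \<in> \<Lambda>" "\<And>x. o' \<le> x" "o' \<notin> J"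
    and retract: "\<And>x. \<exists>y\<in>\<Lambda>. y \<le> x \<and> (\<forall>l\<in>\<Lambda>. l \<le> x \<longrightarrow> l \<le> y) \<and> (x \<in> J \<longrightarrow> y \<in> J)"
  shows "\<exists>r g D. minimal_strand_resolution J r g D (\<lambda>_. 1 :: 'k::field) \<and> (\<forall>i. \<forall>b<r i. g i b \<in> \<Lambda>)"
proof -
  interpret vector_space "smul :: 'k \<Rightarrow> _" by (rule vector_space_smul)
  text \<open>A state describes one module of the resolution: its rank, the degrees of its basis, and the
    boundaries of its basis.\<close>
  define Z where "Z n st x = {v. v \<in> free_mod (fst st) \<and> (\<forall>b. v b \<noteq> 0 \<longrightarrow> fst (snd st) b \<le> x) \<and>
      (if n = 0 then x \<in> J \<or> v 0 = 0 else lcomb (fst st) (snd (snd st)) v = 0)}"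
    for n :: nat and st :: "nat \<times> (nat \<Rightarrow> 'a) \<times> (nat \<Rightarrow> nat \<Rightarrow> 'k)" and x
  define P where "P n st \<longleftrightarrow> (\<forall>b<fst st. fst (snd st) b \<in> \<Lambda>) \<and> (n = 0 \<longrightarrow> fst st = 1 \<and> fst (snd st) 0 = o')"
    for n :: nat and st :: "nat \<times> (nat \<Rightarrow> 'a) \<times> (nat \<Rightarrow> nat \<Rightarrow> 'k)"
  define Q where "Q n st st' \<longleftrightarrow> (\<forall>b<fst st'. snd (snd st') b \<in> Z n st (fst (snd st') b)) \<and>
    (\<forall>x. \<forall>v\<in>Z n st x. \<exists>u\<in>free_mod (fst st'). (\<forall>b. u b \<noteq> 0 \<longrightarrow> fst (snd st') b \<le> x) \<and>
       lcomb (fst st') (snd (snd st')) u = v) \<and>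
    (\<forall>u\<in>free_mod (fst st'). \<forall>b<fst st'. lcomb (fst st') (snd (snd st')) u = 0 \<longrightarrow>
       (\<forall>c. u c \<noteq> 0 \<longrightarrow> fst (snd st') c \<le> fst (snd st') b) \<longrightarrow> u b = 0)"
    for n :: nat and st st' :: "nat \<times> (nat \<Rightarrow> 'a) \<times> (nat \<Rightarrow> nat \<Rightarrow> 'k)"
  have "\<exists>f. \<forall>n. P n (f n) \<and> Q n (f n) (f (Suc n))"
  proof (rule dependent_nat_choice)
    show "\<exists>st. P 0 st" by (rule exI[of _ "(1, \<lambda>_. o', \<lambda>_. 0)"]) (simp add: P_def bottom)
  next
    fix st n assume st: "P n st"
    have "\<exists>s' g e. (\<forall>b<s'. g b \<in> \<Lambda> \<and> e b \<in> Z n st (g b)) \<and>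
      (\<forall>x. \<forall>v\<in>Z n st x. \<exists>u\<in>free_mod s'. (\<forall>b. u b \<noteq> 0 \<longrightarrow> g b \<le> x) \<and> lcomb s' e u = v) \<and>
      (\<forall>u\<in>free_mod s'. \<forall>b<s'. lcomb s' e u = 0 \<longrightarrow> (\<forall>c. u c \<noteq> 0 \<longrightarrow> g c \<le> g b) \<longrightarrow> u b = 0)"
    proof (rule minimal_generators_exist[OF fin])
      show "Z n st x \<subseteq> free_mod (fst st)" for x by (auto simp: Z_def)
      show "subspace (Z n st x)" for x
      proof (rule subspaceI)
        show "0 \<in> Z n st x" by (auto simp: Z_def free_mod_def)
      next
        fix v w assume v: "v \<in> Z n st x" and w: "w \<in> Z n st x"
        have "\<forall>b. (v + w) b \<noteq> 0 \<longrightarrow> fst (snd st) b \<le> x"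
          using v w unfolding Z_def by (metis (mono_tags, lifting) mem_Collect_eq plus_fun_apply add_0)
        then show "v + w \<in> Z n st x"
          using v w by (auto simp: Z_def free_mod_def lcomb_add split: if_splits)
      next
        fix k v assume "v \<in> Z n st x"
        then show "smul k v \<in> Z n st x"
          by (auto simp: Z_def free_mod_def lcomb_smul split: if_splits)
      qed
      show "Z n st x \<subseteq> Z n st y" if "x \<le> y" for x y
        using that upset[OF _ that] by (auto simp: Z_def intro: order_trans split: if_splits)
      fix x
      obtain y where y: "y \<in> \<Lambda>" "y \<le> x" "\<And>l. l \<in> \<Lambda> \<Longrightarrow> l \<le> x \<Longrightarrow> l \<le> y" "x \<in> J \<Longrightarrow> y \<in> J"
        using retract by blast
      have "Z n st x \<subseteq> Z n st y"
      proof
        fix v assume v: "v \<in> Z n st x"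
        have "fst (snd st) b \<le> y" if "v b \<noteq> 0" for b
        proof (rule y(3))
          have "b < fst st" using v that by (auto simp: Z_def free_mod_def not_less[symmetric])
          then show "fst (snd st) b \<in> \<Lambda>" using st by (simp add: P_def)
          show "fst (snd st) b \<le> x" using v that by (auto simp: Z_def)
        qed
        then show "v \<in> Z n st y" using v y(4) by (auto simp: Z_def split: if_splits)
      qed
      with y show "\<exists>y\<in>\<Lambda>. y \<le> x \<and> Z n st x \<subseteq> Z n st y" by blast
    qed
    then obtain s' g e where "(\<forall>b<s'. g b \<in> \<Lambda> \<and> e b \<in> Z n st (g b)) \<and>
      (\<forall>x. \<forall>v\<in>Z n st x. \<exists>u\<in>free_mod s'. (\<forall>b. u b \<noteq> 0 \<longrightarrow> g b \<le> x) \<and> lcomb s' e u = v) \<and>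
      (\<forall>u\<in>free_mod s'. \<forall>b<s'. lcomb s' e u = 0 \<longrightarrow> (\<forall>c. u c \<noteq> 0 \<longrightarrow> g c \<le> g b) \<longrightarrow> u b = 0)"
      by blast
    then show "\<exists>st'. P (Suc n) st' \<and> Q n st st'"
      by (intro exI[of _ "(s', g, e)"]) (simp add: P_def Q_def)
  qed
  then obtain f where fP: "\<And>n. P n (f n)" and fQ: "\<And>n. Q n (f n) (f (Suc n))" by blast
  define r where "r n = fst (f n)" for n
  define g where "g n = fst (snd (f n))" for n
  define D where "D n = snd (snd (f (Suc n)))" for n
  have r0: "r 0 = 1" and g0: "g 0 0 = o'" using fP[of 0] by (simp_all add: P_def r_def g_def)
  have g_in: "g n b \<in> \<Lambda>" if "b < r n" for n b using fP[of n] that by (simp add: P_def r_def g_def)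
  have Z_iff: "v \<in> Z n (f n) x \<longleftrightarrow> v \<in> chain_space r g n x \<and> cyc J r D (\<lambda>_. 1) n x v" for n x v
    by (cases n) (auto simp: Z_def chain_space_def cyc_def r_def[symmetric] g_def[symmetric] D_def[symmetric] r0)
  have D_in: "D n b \<in> chain_space r g n (g (Suc n) b)" "cyc J r D (\<lambda>_. 1) n (g (Suc n) b) (D n b)"
    if "b < r (Suc n)" for n b
    using fQ[of n] that Z_iff[of "D n b" n "g (Suc n) b"] by (auto simp: Q_def r_def g_def D_def)
  have ex: "\<exists>u\<in>chain_space r g (Suc n) x. lcomb (r (Suc n)) (D n) u = v"
    if "v \<in> chain_space r g n x" "cyc J r D (\<lambda>_. 1) n x v" for n x v
    using fQ[of n] that Z_iff[of v n x] unfolding Q_def chain_space_def r_def g_def D_def by blast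
  have no_unit: "u b = 0" if "u \<in> free_mod (r (Suc n))" "b < r (Suc n)" "lcomb (r (Suc n)) (D n) u = 0"
    "\<And>c. u c \<noteq> 0 \<Longrightarrow> g (Suc n) c \<le> g (Suc n) b" for u b n
    using fQ[of n] that unfolding Q_def r_def g_def D_def by blast
  \<comment> \<open>A vanishing boundary would be a relation with coefficient
    \<open>1\<close>.\<close>
  have D_nonzero: "D n b \<noteq> 0" if "b < r (Suc n)" for n b
  proof
    assume "D n b = 0"
    then have "unit_vec b b = (0 :: 'k)"
      using that by (intro no_unit[of "unit_vec b" n b]) (auto simp: free_mod_def unit_vec_apply split: if_splits)
    then show False by (simp add: unit_vec_apply)
  qed
  have cyc_d: "cyc J r D (\<lambda>_. 1) n x (lcomb (r (Suc n)) (D n) v)"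
    if v: "v \<in> chain_space r g (Suc n) x" for n x v
  proof (cases n)
    case 0
    have "(\<Sum>b<r 0. lcomb (r (Suc 0)) (D 0) v b * 1) = 0" if x: "x \<notin> J"
    proof -
      have "v b * D 0 b 0 = 0" if b: "b < r (Suc 0)" for b
      proof (cases "v b = 0")
        case False
        then have "g (Suc 0) b \<notin> J" using v x upset 0 by (auto simp: chains_iff)
        then show ?thesis using D_in(2)[OF b] by (simp add: cyc_def r0)
      qed simp
      then show ?thesis by (auto simp: r0 lcomb_apply intro: sum.neutral)
    qed
    then show ?thesis by (auto simp: cyc_def 0)
  next
    case (Suc k)
    have "lcomb (r (Suc k)) (D k) (lcomb (r (Suc (Suc k))) (D (Suc k)) v) = lcomb (r (Suc (Suc k))) (\<lambda>_. 0) v"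
      unfolding lcomb_lcomb by (rule lcomb_cong) (use D_in(2)[of _ "Suc k"] in \<open>simp add: cyc_def\<close>)
    then show ?thesis by (simp add: cyc_def Suc)
  qed
  \<comment> \<open>At the first step a degree outside \<open>J\<close> would force augmentation
    \<open>0\<close> and hence a zero boundary. Later, membership is inherited from any component of
    the nonzero boundary.\<close>
  have deg_J: "g (Suc n) b \<in> J" if "b < r (Suc n)" for n b
    using that
  proof (induction n arbitrary: b)
    case 0
    show ?case
    proof (rule ccontr)
      assume "g (Suc 0) b \<notin> J"
      then have "D 0 b 0 = 0" using D_in(2)[OF 0] by (simp add: cyc_def r0)
      moreover have "D 0 b a = 0" if "a \<noteq> 0" for a
        using D_in(1)[OF 0] that by (auto simp: chains_iff r0)
      ultimately have "D 0 b = 0" by (metis ext zero_fun_apply)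
      with D_nonzero[OF 0] show False by simp
    qed
  next
    case (Suc n)
    obtain a where a: "D (Suc n) b a \<noteq> 0" using D_nonzero[OF Suc.prems] by (metis ext zero_fun_apply)
    then have "a < r (Suc n)" "g (Suc n) a \<le> g (Suc (Suc n)) b"
      using D_in(1)[OF Suc.prems] by (auto simp: chains_iff)
    with Suc.IH upset show ?case by blast
  qed
  have "minimal_strand_resolution J r g D (\<lambda>_. 1)"
  proof unfold_locales
    show "\<exists>v\<in>chain_space r g 0 x. (\<Sum>b<r 0. v b * 1) = (1 :: 'k)" if "x \<notin> J" for x
      by (rule bexI[of _ "unit_vec 0"]) (auto simp: r0 unit_vec_apply g0 bottom intro!: unit_chains)
    show "D i b \<in> lower_space r g i (g (Suc i) b)" if b: "b < r (Suc i)" for i b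
      unfolding lower_space_iff
    proof (intro allI impI)
      fix a assume a: "D i b a \<noteq> 0"
      then have a': "a < r i" "g i a \<le> g (Suc i) b" using D_in(1)[OF b] by (auto simp: chains_iff)
      have "g i a \<noteq> g (Suc i) b"
      proof (cases i)
        case 0
        then have "g i a = o'" using a'(1) g0 by (simp add: r0)
        then show ?thesis using deg_J[OF b] bottom(3) by auto
      next
        case (Suc k)
        show ?thesis
        proof
          \<comment> \<open>The boundary of \<open>b\<close> is itself a relation among the
            preceding generators. With equal degrees, \<open>no_unit\<close> kills its coefficient
            at \<open>a\<close>.\<close>
          assume eq: "g i a = g (Suc i) b"
          have "D i b a = 0"
            using D_in[OF b] a' eq unfolding Suc
            by (intro no_unit[of "D (Suc k) b" k a]) (auto simp: chains_iff chain_space_def cyc_def)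
          with a show False by simp
        qed
      qed
      with a' show "a < r i \<and> g i a < g (Suc i) b" by auto
    qed
  qed (use upset D_in cyc_d ex r0 g0 bottom deg_J in auto)
  with g_in show ?thesis by blast
qed

section \<open>Monomial ideals and the lcm-lattice\<close>

lemma nat_seq_incseq_subseq: "\<exists>\<sigma> :: nat \<Rightarrow> nat. strict_mono \<sigma> \<and> (\<forall>i j. i \<le> j \<longrightarrow> s (\<sigma> i) \<le> s (\<sigma> j))"
  for s :: "nat \<Rightarrow> nat"
proof -
  \<comment> \<open>Choose indices whose value is minimal among all values from there on.\<close>
  have "\<exists>\<sigma>. \<forall>n. (\<forall>i\<ge>\<sigma> n. s (\<sigma> n) \<le> s i) \<and> \<sigma> n < \<sigma> (Suc n)"
  proof (rule dependent_nat_choice)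
    show "\<exists>k. \<forall>i\<ge>k. s k \<le> s i"
      using ex_has_least_nat[of "\<lambda>_. True" 0 s] by blast
    fix k assume "\<forall>i\<ge>k. s k \<le> s i"
    obtain k' where "k < k'" "\<And>i. k < i \<Longrightarrow> s k' \<le> s i"
      using ex_has_least_nat[of "\<lambda>i. k < i" "Suc k" s] by blast
    then show "\<exists>k'. (\<forall>i\<ge>k'. s k' \<le> s i) \<and> k < k'"
      by (meson order_less_le_trans)
  qed
  then obtain \<sigma> where \<sigma>: "\<And>n i. i \<ge> \<sigma> n \<Longrightarrow> s (\<sigma> n) \<le> s i" "\<And>n. \<sigma> n < \<sigma> (Suc n)" by blast
  have mono: "strict_mono \<sigma>" using \<sigma>(2) by (simp add: strict_mono_Suc_iff)
  then have "s (\<sigma> i) \<le> s (\<sigma> j)" if "i \<le> j" for i j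
    using \<sigma>(1) that by (simp add: strict_mono_less_eq)
  with mono show ?thesis by blast
qed

text \<open>Thinning an infinite sequence once per variable makes it weakly increasing in every
  coordinate, so two distinct members are comparable.\<close>

lemma dickson_antichain_finite:
  fixes G :: "('n::finite \<Rightarrow> nat) set"
  assumes anti: "\<And>a b. a \<in> G \<Longrightarrow> b \<in> G \<Longrightarrow> a \<le> b \<Longrightarrow> a = b"
  shows "finite G"
proof (rule ccontr)
  assume "infinite G"
  then obtain f :: "nat \<Rightarrow> 'n \<Rightarrow> nat" where f: "inj f" "range f \<subseteq> G"
    using infinite_countable_subset by blast
  have "\<exists>\<sigma> :: nat \<Rightarrow> nat. strict_mono \<sigma> \<and> (\<forall>x\<in>X. \<forall>i j. i \<le> j \<longrightarrow> f (\<sigma> i) x \<le> f (\<sigma> j) x)" for X :: "'n set"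
  proof (induction X rule: finite_induct[OF finite])
    case 1
    then show ?case by (rule exI[of _ id]) (simp add: strict_mono_def)
  next
    case (2 x X)
    then obtain \<sigma> :: "nat \<Rightarrow> nat" where
      \<sigma>: "strict_mono \<sigma>" "\<And>x i j. x \<in> X \<Longrightarrow> i \<le> j \<Longrightarrow> f (\<sigma> i) x \<le> f (\<sigma> j) x" by blast
    obtain \<tau> :: "nat \<Rightarrow> nat" where
      \<tau>: "strict_mono \<tau>" "\<And>i j. i \<le> j \<Longrightarrow> f (\<sigma> (\<tau> i)) x \<le> f (\<sigma> (\<tau> j)) x"
      using nat_seq_incseq_subseq[of "\<lambda>i. f (\<sigma> i) x"] by blast
    have "f (\<sigma> (\<tau> i)) y \<le> f (\<sigma> (\<tau> j)) y" if "y \<in> insert x X" "i \<le> j" for y i j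
      using that \<tau> \<sigma>(2)[of y "\<tau> i" "\<tau> j"] by (auto simp: strict_mono_less_eq)
    moreover have "strict_mono (\<sigma> \<circ> \<tau>)" using \<sigma>(1) \<tau>(1) by (rule strict_mono_o)
    ultimately show ?case unfolding comp_def by blast
  qed
  from this[of UNIV] obtain \<sigma> :: "nat \<Rightarrow> nat" where
    \<sigma>: "strict_mono \<sigma>" "\<And>x i j. i \<le> j \<Longrightarrow> f (\<sigma> i) x \<le> f (\<sigma> j) x" by blast
  have "f (\<sigma> 0) \<le> f (\<sigma> 1)" using \<sigma>(2) by (simp add: le_fun_def)
  then have "f (\<sigma> 0) = f (\<sigma> 1)" using anti f(2) by blast
  then have "\<sigma> 0 = \<sigma> 1" using f(1) by (simp add: inj_def)
  with \<sigma>(1) show False by (simp add: strict_mono_eq)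
qed

section \<open>Monomial ideals and their minimal generators\<close>

lemma monomial_diff_add: "m \<le> e \<Longrightarrow> (e - m) + m = e" for m e :: "'n monomial"
  by (auto simp: le_fun_def fun_eq_iff)

lemma poly_as_sum: "p = (\<Sum>e\<in>Poly_Mapping.keys p. Poly_Mapping.single e (Poly_Mapping.lookup p e))"
  by (rule poly_mapping_eqI)
    (simp add: lookup_sum lookup_single when_def in_keys_iff)

lemma lookup_single_times:
  "Poly_Mapping.lookup (Poly_Mapping.single t c * p) e =
    (if t \<le> e then c * Poly_Mapping.lookup p (e - t) else 0)"
  for p :: "('n, 'k::field) mpoly"
proof -
  have "Poly_Mapping.single t c * p =
      (\<Sum>s\<in>Poly_Mapping.keys p. Poly_Mapping.single (t + s) (c * Poly_Mapping.lookup p s))"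
    by (subst poly_as_sum[of p]) (simp add: sum_distrib_left mult_single)
  then have *: "Poly_Mapping.lookup (Poly_Mapping.single t c * p) e =
      (\<Sum>s\<in>Poly_Mapping.keys p. if t + s = e then c * Poly_Mapping.lookup p s else 0)"
    by (simp add: lookup_sum lookup_single when_def)
  show ?thesis
  proof (cases "t \<le> e")
    case True
    then have "t + s = e \<longleftrightarrow> s = e - t" for s
      using monomial_diff_add[OF True] by (metis add.commute add_left_cancel)
    then show ?thesis using True by (simp add: * in_keys_iff)
  next
    case False
    then have "t + s \<noteq> e" for s by (auto simp: le_fun_def)
    then show ?thesis using False by (simp add: *)
  qed
qed

lemma module_times: "module ((*) :: ('n, 'k::field) mpoly \<Rightarrow> _)"
  by unfold_locales (auto simp: algebra_simps)

lemma ideal_monomial_iff: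
  fixes p :: "('n, 'k::field) mpoly"
  shows "p \<in> ideal_generated (monom_poly ` M) \<longleftrightarrow> (\<forall>e\<in>Poly_Mapping.keys p. \<exists>m\<in>M. m \<le> e)"
proof -
  interpret module "(*) :: ('n, 'k) mpoly \<Rightarrow> _" by (rule module_times)
  define T :: "('n, 'k) mpoly set" where "T = {p. \<forall>e\<in>Poly_Mapping.keys p. \<exists>m\<in>M. m \<le> e}"
  have "subspace T"
  proof (rule subspaceI)
    show "0 \<in> T" by (simp add: T_def)
    show "p + q \<in> T" if "p \<in> T" "q \<in> T" for p q
      using that Poly_Mapping.keys_add[of p q] by (auto simp: T_def)
    show "c * p \<in> T" if "p \<in> T" for c p
    proof -
      have "\<exists>m\<in>M. m \<le> a + b" if "b \<in> Poly_Mapping.keys p" for a b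
      proof -
        have "\<exists>m\<in>M. m \<le> b" using \<open>p \<in> T\<close> that by (simp add: T_def)
        then obtain m where "m \<in> M" "m \<le> b" ..
        then show ?thesis by (intro bexI[of _ m]) (auto simp: le_fun_def intro: trans_le_add2)
      qed
      then show ?thesis using keys_mult[of c p] by (fastforce simp: T_def)
    qed
  qed
  moreover have "monom_poly ` M \<subseteq> T" by (auto simp: T_def monom_poly_def)
  ultimately have "span (monom_poly ` M) \<subseteq> T" by (intro span_minimal)
  moreover have "p \<in> span (monom_poly ` M)" if "p \<in> T" for p
  proof -
    have "Poly_Mapping.single e (Poly_Mapping.lookup p e) \<in> span (monom_poly ` M)"
      if e: "e \<in> Poly_Mapping.keys p" for e
    proof -
      have "\<exists>m\<in>M. m \<le> e" using \<open>p \<in> T\<close> e by (simp add: T_def)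
      then obtain m where m: "m \<in> M" "m \<le> e" ..
      have "Poly_Mapping.single e (Poly_Mapping.lookup p e)
          = Poly_Mapping.single (e - m) (Poly_Mapping.lookup p e) * monom_poly m"
        by (simp add: monom_poly_def mult_single monomial_diff_add[OF m(2)])
      then show ?thesis using m(1) by (simp add: span_base span_scale)
    qed
    then show ?thesis by (subst poly_as_sum) (rule span_sum)
  qed
  ultimately show ?thesis unfolding ideal_generated_def T_def by blast
qed

definition monomials_in :: "('n, 'k::field) mpoly set \<Rightarrow> 'n monomial set" where
  "monomials_in I = {e. monom_poly e \<in> I}"

lemma monomials_in_generated:
  "monomials_in (ideal_generated (monom_poly ` M) :: ('n, 'k::field) mpoly set) = {e. \<exists>m\<in>M. m \<le> e}"
  by (simp add: monomials_in_def ideal_monomial_iff) (simp add: monom_poly_def)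

lemma monomial_ideal_iff:
  assumes "monomial_ideal I"
  shows "p \<in> I \<longleftrightarrow> (\<forall>e\<in>Poly_Mapping.keys p. e \<in> monomials_in I)"
proof -
  obtain M where M: "I = ideal_generated (monom_poly ` M)"
    using assms by (auto simp: monomial_ideal_def)
  show ?thesis unfolding M monomials_in_generated by (simp add: ideal_monomial_iff)
qed

lemma monomials_in_upset: "monomial_ideal I \<Longrightarrow> x \<in> monomials_in I \<Longrightarrow> x \<le> y \<Longrightarrow> y \<in> monomials_in I"
  unfolding monomial_ideal_def by (auto simp: monomials_in_generated) (meson order_trans)

lemma generates_iff:
  fixes I :: "('n, 'k::field) mpoly set"
  assumes "monomial_ideal I"
  shows "ideal_generated (monom_poly ` G) = I \<longleftrightarrow> {e. \<exists>m\<in>G. m \<le> e} = monomials_in I"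
proof
  assume "ideal_generated (monom_poly ` G) = I"
  from monomials_in_generated[of G, where 'k = 'k, unfolded this]
  show "{e. \<exists>m\<in>G. m \<le> e} = monomials_in I" ..
next
  assume *: "{e. \<exists>m\<in>G. m \<le> e} = monomials_in I"
  show "ideal_generated (monom_poly ` G) = I"
  proof (rule set_eqI)
    show "p \<in> ideal_generated (monom_poly ` G) \<longleftrightarrow> p \<in> I" for p
      unfolding ideal_monomial_iff monomial_ideal_iff[OF assms] *[symmetric] by simp
  qed
qed

lemma finite_divisors: "finite {m. m \<le> e}" for e :: "'n::finite monomial"
proof -
  have "{m. m \<le> e} = PiE UNIV (\<lambda>x. {..e x})" by (auto simp: le_fun_def)
  then show ?thesis by (simp add: finite_PiE)
qed

text \<open>The divisibility-minimal monomials generate the ideal and lie in every monomial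
  generating set, so exactly one set satisfies the definite description.\<close>

lemma min_generators_eq:
  fixes I :: "('n::finite, 'k::field) mpoly set"
  assumes I: "monomial_ideal I"
  shows "min_generators I = {m \<in> monomials_in I. \<forall>m'\<in>monomials_in I. m' \<le> m \<longrightarrow> m' = m}"
    (is "_ = ?Min")
proof -
  have below: "\<exists>m\<in>?Min. m \<le> e" if "e \<in> monomials_in I" for e
  proof -
    have "finite {m \<in> monomials_in I. m \<le> e}"
      by (rule finite_subset[OF _ finite_divisors[of e]]) auto
    from finite_has_minimal2[OF this, of e] that
    obtain m where m: "m \<in> monomials_in I" "m \<le> e"
      "\<forall>b\<in>{m \<in> monomials_in I. m \<le> e}. b \<le> m \<longrightarrow> m = b" by auto
    then show ?thesis by (intro bexI[of _ m]) (auto dest: order_trans)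
  qed
  have up_Min: "{e. \<exists>m\<in>?Min. m \<le> e} = monomials_in I"
    using below monomials_in_upset[OF I] by blast
  have Min_sub: "?Min \<subseteq> G" if G: "{e. \<exists>m\<in>G. m \<le> e} = monomials_in I" for G
  proof
    fix m assume m: "m \<in> ?Min"
    then obtain h where h: "h \<in> G" "h \<le> m" using G by blast
    then have "h \<in> monomials_in I" using G by blast
    then show "m \<in> G" using m h by blast
  qed
  show ?thesis
    unfolding min_generators_def generates_iff[OF I]
  proof (rule the_equality)
    show "{e. \<exists>m\<in>?Min. m \<le> e} = monomials_in I \<and> (\<forall>H. H \<subset> ?Min \<longrightarrow> {e. \<exists>m\<in>H. m \<le> e} \<noteq> monomials_in I)"
      using up_Min Min_sub by (intro conjI allI impI notI) (assumption, blast)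
    show "G = ?Min"
      if "{e. \<exists>m\<in>G. m \<le> e} = monomials_in I \<and> (\<forall>H. H \<subset> G \<longrightarrow> {e. \<exists>m\<in>H. m \<le> e} \<noteq> monomials_in I)" for G
    proof (rule ccontr)
      assume "G \<noteq> ?Min"
      with Min_sub[OF conjunct1[OF that]] have "?Min \<subset> G" by blast
      from that[THEN conjunct2, rule_format, OF this] up_Min show False by (rule notE)
    qed
  qed
qed

text \<open>Finiteness makes the supremum a maximum; on \<open>nat\<close> it need not bound an
  infinite set.\<close>

lemma lcm_monomials_upper:
  assumes "finite A" "m \<in> A"
  shows "m \<le> lcm_monomials A"
  using assms by (auto simp: lcm_monomials_def le_fun_def intro!: le_cSup_finite)

lemma lcm_monomials_least:
  assumes "\<And>m. m \<in> A \<Longrightarrow> m \<le> x"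
  shows "lcm_monomials A \<le> x"
proof (cases "A = {}")
  case True
  then show ?thesis by (simp add: lcm_monomials_def le_fun_def Sup_nat_def)
next
  case False
  then show ?thesis using assms by (auto simp: lcm_monomials_def le_fun_def intro!: cSup_least)
qed

lemma lcm_lattice_finite_retract:
  fixes I :: "('n::finite, 'k::field) mpoly set"
  assumes I: "monomial_ideal I"
  shows "finite (lcm_lattice I)" and "0 \<in> lcm_lattice I"
    and "\<exists>y\<in>lcm_lattice I. y \<le> x \<and> (\<forall>l\<in>lcm_lattice I. l \<le> x \<longrightarrow> l \<le> y)
      \<and> (x \<in> monomials_in I \<longrightarrow> y \<in> monomials_in I)"
proof -
  note Min = min_generators_eq[OF I]
  have fin: "finite (min_generators I)" by (rule dickson_antichain_finite) (auto simp: Min)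
  then show "finite (lcm_lattice I)" by (simp add: lcm_lattice_def setcompr_eq_image flip: Pow_def)
  have "lcm_monomials {} = (0 :: 'n monomial)"
    by (simp add: lcm_monomials_def Sup_nat_def fun_eq_iff)
  then show "0 \<in> lcm_lattice I"
    unfolding lcm_lattice_def by (intro CollectI exI[of _ "{}"]) simp
  \<comment> \<open>The lcm of all minimal generators dividing \<open>x\<close> is the largest
    lattice element dividing \<open>x\<close>.\<close>
  define y where "y = lcm_monomials {m \<in> min_generators I. m \<le> x}"
  have "y \<in> lcm_lattice I" unfolding lcm_lattice_def y_def by blast
  moreover have "y \<le> x" unfolding y_def by (rule lcm_monomials_least) simp
  moreover have "l \<le> y" if l: "l \<in> lcm_lattice I" "l \<le> x" for l
  proof -
    obtain A where A: "A \<subseteq> min_generators I" "l = lcm_monomials A"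
      using l(1) unfolding lcm_lattice_def by blast
    have "m \<le> y" if "m \<in> A" for m
    proof -
      have "m \<le> l"
        unfolding A(2) using finite_subset[OF A(1) fin] that by (rule lcm_monomials_upper)
      then have "m \<le> x" using \<open>l \<le> x\<close> by (rule order_trans)
      then show ?thesis unfolding y_def using that A fin by (intro lcm_monomials_upper) auto
    qed
    then show ?thesis unfolding A(2) by (rule lcm_monomials_least)
  qed
  moreover have "y \<in> monomials_in I" if x: "x \<in> monomials_in I"
  proof -
    have "finite {m \<in> monomials_in I. m \<le> x}"
      by (rule finite_subset[OF _ finite_divisors[of x]]) auto
    from finite_has_minimal2[OF this, of x] x
    obtain m where m: "m \<in> monomials_in I" "m \<le> x"
      "\<forall>b\<in>{m \<in> monomials_in I. m \<le> x}. b \<le> m \<longrightarrow> m = b" by auto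
    then have "m \<in> min_generators I" by (auto simp: Min dest: order_trans)
    then have "m \<le> y" unfolding y_def using m fin by (intro lcm_monomials_upper) auto
    with m(1) show ?thesis by (rule monomials_in_upset[OF I])
  qed
  ultimately show "\<exists>y\<in>lcm_lattice I. y \<le> x \<and> (\<forall>l\<in>lcm_lattice I. l \<le> x \<longrightarrow> l \<le> y)
      \<and> (x \<in> monomials_in I \<longrightarrow> y \<in> monomials_in I)" by blast
qed

section \<open>Free resolutions and their strands\<close>

text \<open>Homogeneity allows one monomial per matrix entry; its coefficient is kept, and
  \<open>dmat_eq\<close> recovers the entry.\<close>

definition strand_boundary :: "('n, 'k::field) free_complex \<Rightarrow> nat \<Rightarrow> nat \<Rightarrow> nat \<Rightarrow> 'k" where
  "strand_boundary F i b = (\<lambda>a. if a < rk F i \<and> mdeg F i a \<le> mdeg F (Suc i) b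
     then Poly_Mapping.lookup (dmat F i a b) (mdeg F (Suc i) b - mdeg F i a) else 0)"

definition strand_aug :: "('n, 'k::field) free_complex \<Rightarrow> nat \<Rightarrow> 'k" where
  "strand_aug F b = Poly_Mapping.lookup (aug F b) (mdeg F 0 b)"

text \<open>\<open>strand F i x v\<close> is the component of multidegree \<open>x\<close> of the element \<open>v\<close> of the \<open>i\<close>-th module,
  and \<open>homogenize F i x\<close> is the inverse operation.\<close>

definition strand :: "('n, 'k::field) free_complex \<Rightarrow> nat \<Rightarrow> 'n monomial \<Rightarrow> (nat \<Rightarrow> ('n, 'k) mpoly) \<Rightarrow> nat \<Rightarrow> 'k" where
  "strand F i x v = (\<lambda>b. if mdeg F i b \<le> x then Poly_Mapping.lookup (v b) (x - mdeg F i b) else 0)"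

definition homogenize :: "('n, 'k::field) free_complex \<Rightarrow> nat \<Rightarrow> 'n monomial \<Rightarrow> (nat \<Rightarrow> 'k) \<Rightarrow> nat \<Rightarrow> ('n, 'k) mpoly" where
  "homogenize F i x u = (\<lambda>b. if mdeg F i b \<le> x then Poly_Mapping.single (x - mdeg F i b) (u b) else 0)"

lemma single_eqI:
  assumes "\<And>e. e \<in> Poly_Mapping.keys p \<Longrightarrow> e = t" and "Poly_Mapping.lookup p t = c"
  shows "p = Poly_Mapping.single t c"
  using assms by (intro poly_mapping_eqI) (auto simp: lookup_single when_def in_keys_iff)

lemma dmat_eq:
  assumes "multihomogeneous F" "a < rk F i" "b < rk F (Suc i)"
  shows "dmat F i a b = Poly_Mapping.single (mdeg F (Suc i) b - mdeg F i a) (strand_boundary F i b a)"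
proof (rule single_eqI)
  have key: "e + mdeg F i a = mdeg F (Suc i) b" if "e \<in> Poly_Mapping.keys (dmat F i a b)" for e
    using assms that unfolding multihomogeneous_def by blast
  show "e = mdeg F (Suc i) b - mdeg F i a" if "e \<in> Poly_Mapping.keys (dmat F i a b)" for e
    using key[OF that] by (metis add_diff_cancel_right')
  show "Poly_Mapping.lookup (dmat F i a b) (mdeg F (Suc i) b - mdeg F i a) = strand_boundary F i b a"
  proof (cases "mdeg F i a \<le> mdeg F (Suc i) b")
    case False
    have "e \<notin> Poly_Mapping.keys (dmat F i a b)" for e
      using key[of e] False by (auto simp: le_fun_def fun_eq_iff) (metis le_add2)
    then show ?thesis using False by (simp add: strand_boundary_def in_keys_iff)
  qed (simp add: strand_boundary_def assms(2))
qed

lemma aug_eq: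
  assumes "multihomogeneous F" "b < rk F 0"
  shows "aug F b = Poly_Mapping.single (mdeg F 0 b) (strand_aug F b)"
  using assms by (intro single_eqI) (auto simp: multihomogeneous_def strand_aug_def)

lemma monomial_diff_le_iff:
  "a \<le> b \<Longrightarrow> a \<le> x \<Longrightarrow> b - a \<le> x - a \<longleftrightarrow> b \<le> x" for a b x :: "'n monomial"
  by (auto simp: le_fun_def) (metis diff_le_mono eq_diff_iff le_diff_iff)+

lemma monomial_diff_diff: "a \<le> b \<Longrightarrow> (x - a) - (b - a) = x - b" for a b x :: "'n monomial"
  by (auto simp: le_fun_def fun_eq_iff)

lemma strand_diff_map:
  assumes F: "multihomogeneous F"
  shows "strand F i x (diff_map F i v) = lcomb (rk F (Suc i)) (strand_boundary F i) (strand F (Suc i) x v)"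
proof
  fix a
  show "strand F i x (diff_map F i v) a = lcomb (rk F (Suc i)) (strand_boundary F i) (strand F (Suc i) x v) a"
  proof (cases "a < rk F i \<and> mdeg F i a \<le> x")
    case True
    have "strand F i x (diff_map F i v) a
        = (\<Sum>b<rk F (Suc i). Poly_Mapping.lookup (dmat F i a b * v b) (x - mdeg F i a))"
      using True by (simp add: strand_def diff_map_def mat_app_def lookup_sum)
    also have "\<dots> = (\<Sum>b<rk F (Suc i). strand F (Suc i) x v b * strand_boundary F i b a)"
    proof (rule sum.cong)
      fix b assume "b \<in> {..<rk F (Suc i)}"
      then have *: "Poly_Mapping.lookup (dmat F i a b * v b) (x - mdeg F i a) =
          (if mdeg F (Suc i) b - mdeg F i a \<le> x - mdeg F i a then strand_boundary F i b a *
            Poly_Mapping.lookup (v b) (x - mdeg F i a - (mdeg F (Suc i) b - mdeg F i a)) else 0)"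
        using True dmat_eq[OF F, of a i b] by (simp add: lookup_single_times)
      show "Poly_Mapping.lookup (dmat F i a b * v b) (x - mdeg F i a)
          = strand F (Suc i) x v b * strand_boundary F i b a"
      proof (cases "strand_boundary F i b a = 0")
        case False
        \<comment> \<open>This divisibility makes the truncated differences of exponents genuine
          ones.\<close>
        then have "mdeg F i a \<le> mdeg F (Suc i) b" by (auto simp: strand_boundary_def split: if_splits)
        then show ?thesis using True
          by (simp add: * monomial_diff_le_iff monomial_diff_diff strand_def mult.commute[of "strand_boundary F i b a"])
      qed (simp add: *)
    qed simp
    finally show ?thesis by (simp add: lcomb_apply)
  next
    case False
    have "strand F (Suc i) x v b * strand_boundary F i b a = 0" for b
      using False by (auto simp: strand_def strand_boundary_def dest: order_trans)
    then have "lcomb (rk F (Suc i)) (strand_boundary F i) (strand F (Suc i) x v) a = 0"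
      unfolding lcomb_apply by (intro sum.neutral) blast
    then show ?thesis using False by (auto simp: strand_def diff_map_def mat_app_def)
  qed
qed

lemma lookup_aug_map:
  assumes F: "multihomogeneous F"
  shows "Poly_Mapping.lookup (aug_map F v) x = (\<Sum>b<rk F 0. strand F 0 x v b * strand_aug F b)"
  unfolding aug_map_def lookup_sum
proof (rule sum.cong)
  fix b assume "b \<in> {..<rk F 0}"
  then show "Poly_Mapping.lookup (aug F b * v b) x = strand F 0 x v b * strand_aug F b"
    using aug_eq[OF F, of b] by (simp add: lookup_single_times strand_def)
qed simp

lemma strand_chains: "v \<in> free_mod (rk F i) \<Longrightarrow> strand F i x v \<in> chain_space (rk F) (mdeg F) i x"
  by (auto simp: chains_iff strand_def free_mod_def split: if_splits) (metis lookup_zero not_less)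

lemma strand_homogenize:
  "u \<in> chain_space (rk F) (mdeg F) i x \<Longrightarrow> strand F i y (homogenize F i x u) = (if y = x then u else 0)"
proof
  fix b
  assume u: "u \<in> chain_space (rk F) (mdeg F) i x"
  show "strand F i y (homogenize F i x u) b = (if y = x then u else 0) b"
  proof (cases "mdeg F i b \<le> x \<and> mdeg F i b \<le> y")
    case True
    then have "x - mdeg F i b = y - mdeg F i b \<longleftrightarrow> y = x"
      by (metis monomial_diff_add)
    then show ?thesis using True by (simp add: strand_def homogenize_def lookup_single when_def)
  next
    case False
    then have "u b = 0 \<or> y \<noteq> x" using chains_support_le[OF u, of b] by auto
    then show ?thesis using False by (auto simp: strand_def homogenize_def)
  qed
qed

lemma homogenize_free_mod: "u \<in> chain_space (rk F) (mdeg F) i x \<Longrightarrow> homogenize F i x u \<in> free_mod (rk F i)"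
  by (auto simp: homogenize_def free_mod_def dest!: chains_free_mod)

lemma strand_diff: "strand F i x (u - v) = strand F i x u - strand F i x v"
  by (auto simp: strand_def fun_eq_iff lookup_minus)

lemma strand_zero [simp]: "strand F i x 0 = 0"
  by (auto simp: strand_def fun_eq_iff)

lemma strand_sum: "strand F i x (\<Sum>y\<in>X. f y) = (\<Sum>y\<in>X. strand F i x (f y))"
  by (auto simp: strand_def fun_eq_iff sum_fun_apply lookup_sum)

lemma eq_zero_if_strands: "(\<And>x. strand F i x v = 0) \<Longrightarrow> v = 0"
proof (intro ext poly_mapping_eqI)
  fix b e
  assume "\<And>x. strand F i x v = 0"
  from fun_cong[OF this[of "e + mdeg F i b"], of b]
  show "Poly_Mapping.lookup (v b) e = Poly_Mapping.lookup (0 b) e"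
    by (simp add: strand_def le_fun_def)
qed

lemma finite_strands:
  assumes "v \<in> free_mod (rk F i)"
  shows "finite {x. strand F i x v \<noteq> 0}"
proof (rule finite_subset)
  show "{x. strand F i x v \<noteq> 0} \<subseteq> (\<Union>b<rk F i. (\<lambda>e. e + mdeg F i b) ` Poly_Mapping.keys (v b))"
  proof
    fix x assume "x \<in> {x. strand F i x v \<noteq> 0}"
    then have "strand F i x v \<noteq> 0" by simp
    then obtain b where b: "strand F i x v b \<noteq> 0" by (auto simp: fun_eq_iff)
    then have le: "mdeg F i b \<le> x" "x - mdeg F i b \<in> Poly_Mapping.keys (v b)"
      by (auto simp: strand_def in_keys_iff split: if_splits)
    have "b < rk F i" using strand_chains[OF assms] b by (auto simp: chains_iff)
    moreover have "x = (x - mdeg F i b) + mdeg F i b" using monomial_diff_add[OF le(1)] by simp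
    ultimately show "x \<in> (\<Union>b<rk F i. (\<lambda>e. e + mdeg F i b) ` Poly_Mapping.keys (v b))"
      using le(2) by blast
  qed
qed simp

text \<open>The way back from single degrees to polynomial vectors: solutions found in finitely many
  degrees are realised by one vector.\<close>

lemma assemble_strands:
  assumes "finite X" and u: "\<And>x. x \<in> X \<Longrightarrow> u x \<in> chain_space (rk F) (mdeg F) i x"
  shows "\<exists>v\<in>free_mod (rk F i). \<forall>y. strand F i y v = (if y \<in> X then u y else 0)"
proof (intro bexI allI)
  let ?v = "\<Sum>x\<in>X. homogenize F i x (u x)"
  show "?v \<in> free_mod (rk F i)"
    using homogenize_free_mod[OF u] by (simp add: free_mod_def sum_fun_apply)
  fix y
  have "strand F i y ?v = (\<Sum>x\<in>X. if y = x then u x else 0)"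
    unfolding strand_sum by (rule sum.cong) (simp_all add: strand_homogenize[OF u])
  then show "strand F i y ?v = (if y \<in> X then u y else 0)" using assms(1) by simp
qed

text \<open>Treats augmentation and differentials alike, so that exactness at all modules is one
  statement.\<close>

definition kernel_cond :: "('n, 'k::field) mpoly set \<Rightarrow> ('n, 'k) free_complex \<Rightarrow> nat \<Rightarrow> (nat \<Rightarrow> ('n, 'k) mpoly) \<Rightarrow> bool" where
  "kernel_cond I F i v = (case i of 0 \<Rightarrow> aug_map F v \<in> I | Suc j \<Rightarrow> diff_map F j v = 0)"

lemma free_resolution_iff:
  "free_resolution I F \<longleftrightarrow> multihomogeneous F \<and>
     (\<forall>p. \<exists>v\<in>free_mod (rk F 0). p - aug_map F v \<in> I) \<and>
     (\<forall>i. {v \<in> free_mod (rk F i). kernel_cond I F i v} = diff_map F i ` free_mod (rk F (Suc i)))"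
proof -
  have "(\<forall>i. A i) \<longleftrightarrow> A 0 \<and> (\<forall>i. A (Suc i))" for A :: "nat \<Rightarrow> bool" by (metis not0_implies_Suc)
  from this[of "\<lambda>i. {v \<in> free_mod (rk F i). kernel_cond I F i v} = diff_map F i ` free_mod (rk F (Suc i))"]
  show ?thesis unfolding free_resolution_def kernel_cond_def by simp
qed

lemma kernel_cond_iff:
  assumes I: "monomial_ideal I" and F: "multihomogeneous F"
  shows "kernel_cond I F i v \<longleftrightarrow>
    (\<forall>x. cyc (monomials_in I) (rk F) (strand_boundary F) (strand_aug F) i x (strand F i x v))"
proof (cases i)
  case 0
  then show ?thesis
    by (auto simp: kernel_cond_def cyc_def monomial_ideal_iff[OF I] in_keys_iff lookup_aug_map[OF F])
next
  case (Suc j)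
  have "diff_map F j v = 0 \<longleftrightarrow> (\<forall>x. strand F j x (diff_map F j v) = 0)"
    using eq_zero_if_strands[of F j] by auto
  then show ?thesis by (simp add: kernel_cond_def cyc_def Suc strand_diff_map[OF F])
qed

text \<open>Cycle and exactness conditions are tested on \<open>homogenize F i x v\<close>, all of
  whose strands other than the one in degree \<open>x\<close> vanish.\<close>

lemma strand_resolution_of_free_resolution:
  assumes I: "monomial_ideal I" and res: "free_resolution I F"
  shows "strand_resolution (monomials_in I) (rk F) (mdeg F) (strand_boundary F) (strand_aug F)"
proof unfold_locales
  have F: "multihomogeneous F" using res by (simp add: free_resolution_def)
  have ker: "{v \<in> free_mod (rk F i). kernel_cond I F i v} = diff_map F i ` free_mod (rk F (Suc i))" for i
    using res by (simp add: free_resolution_iff)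
  note K = kernel_cond_iff[OF I F]
  show "y \<in> monomials_in I" if "x \<in> monomials_in I" "x \<le> y" for x y
    using monomials_in_upset[OF I that] .
  show "strand_boundary F i b \<in> chain_space (rk F) (mdeg F) i (mdeg F (Suc i) b)" for i b
    by (auto simp: chains_iff strand_boundary_def)
  show "\<exists>v\<in>chain_space (rk F) (mdeg F) 0 x. (\<Sum>b<rk F 0. v b * strand_aug F b) = 1" if x: "x \<notin> monomials_in I" for x
  proof -
    obtain v where v: "v \<in> free_mod (rk F 0)" "monom_poly x - aug_map F v \<in> I"
      using res unfolding free_resolution_def by blast
    then have "x \<notin> Poly_Mapping.keys (monom_poly x - aug_map F v)"
      using x monomial_ideal_iff[OF I] by blast
    then have "(\<Sum>b<rk F 0. strand F 0 x v b * strand_aug F b) = 1"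
      by (simp add: in_keys_iff lookup_minus monom_poly_def lookup_aug_map[OF F])
    with strand_chains[OF v(1)] show ?thesis by blast
  qed
  show "cyc (monomials_in I) (rk F) (strand_boundary F) (strand_aug F) i x (lcomb (rk F (Suc i)) (strand_boundary F i) v)"
    if v: "v \<in> chain_space (rk F) (mdeg F) (Suc i) x" for i x v
  proof -
    have "kernel_cond I F i (diff_map F i (homogenize F (Suc i) x v))"
      using ker[of i] homogenize_free_mod[OF v] by blast
    then show ?thesis unfolding K strand_diff_map[OF F] using strand_homogenize[OF v, of x] by metis
  qed
  show "\<exists>u\<in>chain_space (rk F) (mdeg F) (Suc i) x. lcomb (rk F (Suc i)) (strand_boundary F i) u = v"
    if v: "v \<in> chain_space (rk F) (mdeg F) i x"
      and cyc: "cyc (monomials_in I) (rk F) (strand_boundary F) (strand_aug F) i x v" for i x v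
  proof -
    have "cyc (monomials_in I) (rk F) (strand_boundary F) (strand_aug F) i y (strand F i y (homogenize F i x v))" for y
      using cyc unfolding strand_homogenize[OF v] by (auto simp: cyc_def split: nat.split)
    then have "homogenize F i x v \<in> diff_map F i ` free_mod (rk F (Suc i))"
      unfolding ker[symmetric] using K homogenize_free_mod[OF v] by blast
    then obtain U where U: "U \<in> free_mod (rk F (Suc i))" "homogenize F i x v = diff_map F i U" by blast
    have "lcomb (rk F (Suc i)) (strand_boundary F i) (strand F (Suc i) x U) = v"
      using strand_homogenize[OF v, of x] unfolding U(2) strand_diff_map[OF F] by simp
    with strand_chains[OF U(1)] show ?thesis by blast
  qed
qed

text \<open>Reinserts the monomials dictated by the degrees. Existence ensures that the choice in
  \<open>tor_dim\<close> picks an actual resolution.\<close>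

lemma free_resolution_of_strand_resolution:
  fixes I :: "('n, 'k::field) mpoly set" and c :: "nat \<Rightarrow> 'k"
  assumes I: "monomial_ideal I" and res: "strand_resolution (monomials_in I) r g D c"
  shows "\<exists>F. free_resolution I F"
proof -
  interpret strand_resolution "monomials_in I" r g D c by fact
  define F :: "('n, 'k) free_complex" where "F = \<lparr>rk = r, mdeg = g,
    dmat = (\<lambda>i a b. Poly_Mapping.single (g (Suc i) b - g i a) (D i b a)),
    aug = (\<lambda>b. Poly_Mapping.single (g 0 b) (c b))\<rparr>"
  have [simp]: "rk F = r" "mdeg F = g" by (simp_all add: F_def)
  have F: "multihomogeneous F"
    unfolding multihomogeneous_def
  proof (intro conjI allI impI ballI)
    fix b e assume "e \<in> Poly_Mapping.keys (aug F b)"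
    then show "e = mdeg F 0 b" by (auto simp: F_def split: if_splits)
  next
    fix i a b e assume "b < rk F (Suc i)" "e \<in> Poly_Mapping.keys (dmat F i a b)"
    then have "e = g (Suc i) b - g i a" "g i a \<le> g (Suc i) b"
      using boundary_chains[of b i] by (auto simp: F_def chains_iff split: if_splits)
    then show "e + mdeg F i a = mdeg F (Suc i) b" by (simp add: monomial_diff_add)
  qed
  have bd: "strand_boundary F i b = D i b" if "b < r (Suc i)" for i b
  proof
    fix a
    have "D i b a = 0" if "\<not> (a < r i \<and> g i a \<le> g (Suc i) b)"
      using boundary_chains[OF \<open>b < r (Suc i)\<close>] that by (auto simp: chains_iff)
    then show "strand_boundary F i b a = D i b a" by (auto simp: strand_boundary_def F_def)
  qed
  then have bd: "lcomb (r (Suc i)) (strand_boundary F i) v = d i v" for i v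
    by (intro lcomb_cong)
  have ag: "strand_aug F = c" by (simp add: strand_aug_def fun_eq_iff F_def)
  have cyc: "cyc (monomials_in I) (rk F) (strand_boundary F) (strand_aug F) i x v \<longleftrightarrow> cyc (monomials_in I) r D c i x v"
    for i x v by (simp add: cyc_def bd ag split: nat.split)
  have K: "kernel_cond I F i v \<longleftrightarrow> (\<forall>x. cyc (monomials_in I) r D c i x (strand F i x v))" for i v
    unfolding kernel_cond_iff[OF I F] cyc ..
  have sd: "strand F i x (diff_map F i v) = d i (strand F (Suc i) x v)" for i x v
    using strand_diff_map[OF F] bd by simp
  have "free_resolution I F"
    unfolding free_resolution_iff
  proof (intro conjI allI)
    show "multihomogeneous F" by fact
  next
    fix p :: "('n, 'k) mpoly"
    obtain w where w: "\<And>x. x \<notin> monomials_in I \<Longrightarrow> w x \<in> chain_space r g 0 x"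
      "\<And>x. x \<notin> monomials_in I \<Longrightarrow> (\<Sum>b<r 0. w x b * c b) = 1"
      using aug_surj by metis
    have "smul (Poly_Mapping.lookup p x) (w x) \<in> chain_space (rk F) (mdeg F) 0 x"
      if "x \<in> Poly_Mapping.keys p - monomials_in I" for x
      using w(1) that by (simp add: chains_smul)
    from assemble_strands[of "Poly_Mapping.keys p - monomials_in I", OF _ this]
    obtain v where v: "v \<in> free_mod (rk F 0)" "\<And>y. strand F 0 y v =
        (if y \<in> Poly_Mapping.keys p - monomials_in I then smul (Poly_Mapping.lookup p y) (w y) else 0)"
      by auto
    have "Poly_Mapping.lookup (p - aug_map F v) y = 0" if y: "y \<notin> monomials_in I" for y
    proof (cases "y \<in> Poly_Mapping.keys p")
      case True
      then have "Poly_Mapping.lookup (aug_map F v) y = Poly_Mapping.lookup p y * (\<Sum>b<r 0. w y b * c b)"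
        using y by (simp add: lookup_aug_map[OF F] v(2) ag sum_distrib_left mult.assoc)
      then show ?thesis using w(2)[OF y] by (simp add: lookup_minus)
    next
      case False
      then show ?thesis by (simp add: lookup_minus lookup_aug_map[OF F] v(2) in_keys_iff)
    qed
    then have "p - aug_map F v \<in> I" unfolding monomial_ideal_iff[OF I] in_keys_iff by blast
    with v(1) show "\<exists>v\<in>free_mod (rk F 0). p - aug_map F v \<in> I" by blast
  next
    fix i
    show "{v \<in> free_mod (rk F i). kernel_cond I F i v} = diff_map F i ` free_mod (rk F (Suc i))"
    proof (intro set_eqI iffI)
      fix v assume "v \<in> {v \<in> free_mod (rk F i). kernel_cond I F i v}"
      then have v: "v \<in> free_mod (rk F i)" and "\<And>x. cyc (monomials_in I) r D c i x (strand F i x v)"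
        by (auto simp: K)
      then have "\<exists>u\<in>chain_space r g (Suc i) x. d i u = strand F i x v" for x
        using exact strand_chains[OF v] by simp
      then obtain u where u: "\<And>x. u x \<in> chain_space r g (Suc i) x" "\<And>x. d i (u x) = strand F i x v"
        by metis
      have "\<exists>V\<in>free_mod (rk F (Suc i)). \<forall>y. strand F (Suc i) y V = (if y \<in> {x. strand F i x v \<noteq> 0} then u y else 0)"
        by (rule assemble_strands) (use finite_strands[OF v] u(1) in auto)
      then obtain V where V: "V \<in> free_mod (rk F (Suc i))"
        "\<And>y. strand F (Suc i) y V = (if strand F i y v \<noteq> 0 then u y else 0)" by auto
      have "strand F i y (diff_map F i V - v) = 0" for y
        by (simp add: strand_diff sd V(2) u(2))
      then have "diff_map F i V - v = 0" by (rule eq_zero_if_strands)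
      then have "v = diff_map F i V" by simp
      with V(1) show "v \<in> diff_map F i ` free_mod (rk F (Suc i))" by blast
    next
      fix v assume "v \<in> diff_map F i ` free_mod (rk F (Suc i))"
      then obtain V where V: "V \<in> free_mod (rk F (Suc i))" "v = diff_map F i V" by blast
      have "kernel_cond I F i v"
        unfolding K V(2) sd using boundary_cyc strand_chains[OF V(1)] by simp
      then show "v \<in> {v \<in> free_mod (rk F i). kernel_cond I F i v}"
        by (simp add: V(2) diff_map_def mat_app_def free_mod_def)
    qed
  qed
  then show ?thesis ..
qed

section \<open>Betti numbers in terms of strands\<close>

text \<open>A vector of \<open>W\<close> outside \<open>V\<close> enlarges a basis of
  \<open>V\<close>, so the dimension grows strictly and subtraction on \<open>nat\<close> detects
  it.\<close>

lemma kdim_diff_nonzero_iff: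
  fixes V W :: "(nat \<Rightarrow> 'k::field) set"
  assumes W: "W \<subseteq> free_mod s" and V: "module.subspace smul V" and sub: "V \<subseteq> W"
  shows "kdim W - kdim V \<noteq> 0 \<longleftrightarrow> \<not> W \<subseteq> V"
proof -
  interpret vector_space "smul :: 'k \<Rightarrow> _" by (rule vector_space_smul)
  have kdim: "kdim X = dim X" for X :: "(nat \<Rightarrow> 'k) set"
    by (simp add: kdim_def smul_def[abs_def])
  show ?thesis
  proof
    assume "kdim W - kdim V \<noteq> 0"
    then show "\<not> W \<subseteq> V" using sub by auto
  next
    assume "\<not> W \<subseteq> V"
    then obtain w where w: "w \<in> W" "w \<notin> V" by blast
    obtain B where B: "finite B" "B \<subseteq> V" "independent B" "V \<subseteq> span B"
      using finite_spanning_subset[of V s] W sub by blast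
    obtain C where C: "finite C" "C \<subseteq> W" "independent C" "W \<subseteq> span C"
      using finite_spanning_subset[OF W] by blast
    have "span B \<subseteq> V" using B(2) V by (rule span_minimal)
    then have "w \<notin> span B" using w(2) by blast
    then have ind: "independent (insert w B)" and "w \<notin> B"
      using B(3) independent_insert span_base by auto
    have "insert w B \<subseteq> span C" using w(1) B(2) sub C(4) by blast
    from independent_span_bound[OF C(1) ind this] have "card B < card C"
      using B(1) \<open>w \<notin> B\<close> by simp
    moreover have "dim V = card B" using B by (intro dim_unique) auto
    moreover have "dim W = card C" using C by (intro dim_unique) auto
    ultimately show "kdim W - kdim V \<noteq> 0" by (simp add: kdim)
  qed
qed

section \<open>The complex tensored with the field, degree by degree\<close>

definition degree_part :: "('n, 'k::field) free_complex \<Rightarrow> nat \<Rightarrow> 'n monomial \<Rightarrow> (nat \<Rightarrow> 'k) \<Rightarrow> nat \<Rightarrow> 'k" where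
  "degree_part F i m v = (\<lambda>b. if mdeg F i b = m then v b else 0)"

lemma tensor_part_iff:
  "v \<in> tensor_part F i X \<longleftrightarrow> (\<forall>b. v b \<noteq> 0 \<longrightarrow> b < rk F i \<and> mdeg F i b \<in> X)"
  by (auto simp: tensor_part_def free_mod_def not_less[symmetric])

lemma degree_part_tensor_part:
  "v \<in> free_mod (rk F i) \<Longrightarrow> m \<in> X \<Longrightarrow> degree_part F i m v \<in> tensor_part F i X"
  by (auto simp: tensor_part_iff degree_part_def free_mod_def not_less[symmetric] split: if_splits)

lemma degree_part_chains:
  "v \<in> free_mod (rk F i) \<Longrightarrow> degree_part F i m v \<in> chain_space (rk F) (mdeg F) i m"
  by (auto simp: chains_iff degree_part_def free_mod_def not_less[symmetric] split: if_splits)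

lemma degree_part_degree_part:
  "degree_part F i m (degree_part F i m' v) = (if m = m' then degree_part F i m v else 0)"
  by (auto simp: degree_part_def fun_eq_iff)

text \<open>A homogeneous entry can have a constant term only between basis elements of equal
  degree.\<close>

lemma tensor_diff_eq:
  assumes F: "multihomogeneous F"
  shows "tensor_diff F i v a = lcomb (rk F (Suc i)) (strand_boundary F i) (degree_part F (Suc i) (mdeg F i a) v) a"
proof (cases "a < rk F i")
  case True
  have "Poly_Mapping.lookup (dmat F i a b) 0 * v b
      = degree_part F (Suc i) (mdeg F i a) v b * strand_boundary F i b a" if "b < rk F (Suc i)" for b
  proof (cases "mdeg F (Suc i) b = mdeg F i a")
    case eq: True
    then show ?thesis using dmat_eq[OF F True that]
      by (simp add: degree_part_def lookup_single when_def)
  next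
    case False
    have "Poly_Mapping.lookup (dmat F i a b) 0 = 0"
    proof (rule ccontr)
      assume "Poly_Mapping.lookup (dmat F i a b) 0 \<noteq> 0"
      then have "0 \<in> Poly_Mapping.keys (dmat F i a b)" by (simp add: in_keys_iff)
      then have "0 + mdeg F i a = mdeg F (Suc i) b"
        using F True that unfolding multihomogeneous_def by blast
      with False show False by simp
    qed
    then show ?thesis using False by (simp add: degree_part_def)
  qed
  then show ?thesis using True by (simp add: tensor_diff_def mat_app_def lcomb_apply)
next
  case False
  then show ?thesis by (simp add: tensor_diff_def mat_app_def lcomb_apply strand_boundary_def)
qed

text \<open>A nonzero coefficient at \<open>a\<close> requires a degree at least that of
  \<open>a\<close>, and \<open>v\<close> allows at most that, so only equal degrees
  contribute.\<close>

lemma tensor_diff_chain: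
  assumes F: "multihomogeneous F" and v: "v \<in> chain_space (rk F) (mdeg F) (Suc i) (mdeg F i a)"
  shows "tensor_diff F i v a = lcomb (rk F (Suc i)) (strand_boundary F i) v a"
  unfolding tensor_diff_eq[OF F] lcomb_apply
proof (rule sum.cong)
  fix b
  show "degree_part F (Suc i) (mdeg F i a) v b * strand_boundary F i b a = v b * strand_boundary F i b a"
    using chains_support_le[OF v, of b] by (auto simp: degree_part_def strand_boundary_def)
qed simp

lemma tensor_diff_lcomb:
  "tensor_diff F i = lcomb (rk F (Suc i)) (\<lambda>b a. if a < rk F i then Poly_Mapping.lookup (dmat F i a b) 0 else 0)"
  by (auto simp: tensor_diff_def mat_app_def lcomb_def fun_eq_iff mult.commute)

lemma tensor_diff_zero [simp]: "tensor_diff F i 0 = 0"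
  by (simp add: tensor_diff_lcomb)

lemma tensor_diff_part:
  assumes F: "multihomogeneous F" and v: "v \<in> tensor_part F (Suc i) X"
  shows "tensor_diff F i v \<in> tensor_part F i X"
  unfolding tensor_part_iff
proof (intro allI impI)
  fix a assume a: "tensor_diff F i v a \<noteq> 0"
  then have "a < rk F i" by (auto simp: tensor_diff_def mat_app_def split: if_splits)
  moreover from a obtain b where "degree_part F (Suc i) (mdeg F i a) v b \<noteq> 0"
    unfolding tensor_diff_eq[OF F] lcomb_apply by (metis (no_types, lifting) mult_zero_left sum.neutral)
  then have "mdeg F i a \<in> X" using v by (auto simp: degree_part_def tensor_part_iff split: if_splits)
  ultimately show "a < rk F i \<and> mdeg F i a \<in> X" by simp
qed

lemma subspace_tensor_part:
  fixes F :: "('n, 'k::field) free_complex"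
  shows "module.subspace smul (tensor_part F i X)"
proof -
  interpret vector_space "smul :: 'k \<Rightarrow> _" by (rule vector_space_smul)
  show ?thesis
  proof (rule subspaceI)
    show "u + v \<in> tensor_part F i X" if "u \<in> tensor_part F i X" "v \<in> tensor_part F i X" for u v
      using that unfolding tensor_part_iff by (metis plus_fun_apply add_0)
  qed (auto simp: tensor_part_iff)
qed

lemma subspace_tensor_boundaries:
  fixes F :: "('n, 'k::field) free_complex"
  shows "module.subspace smul (tensor_boundaries F i X)"
proof -
  interpret vector_space "smul :: 'k \<Rightarrow> _" by (rule vector_space_smul)
  note sub = subspace_tensor_part[of F "Suc i" X]
  show ?thesis
    unfolding tensor_boundaries_def
  proof (rule subspaceI)
    show "0 \<in> tensor_diff F i ` tensor_part F (Suc i) X"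
      using subspace_0[OF sub] tensor_diff_zero by (metis imageI)
    show "u + v \<in> tensor_diff F i ` tensor_part F (Suc i) X"
      if "u \<in> tensor_diff F i ` tensor_part F (Suc i) X" "v \<in> tensor_diff F i ` tensor_part F (Suc i) X" for u v
      using that subspace_add[OF sub] lcomb_add unfolding tensor_diff_lcomb by (smt (verit) imageE imageI)
    show "smul k v \<in> tensor_diff F i ` tensor_part F (Suc i) X"
      if "v \<in> tensor_diff F i ` tensor_part F (Suc i) X" for k v
      using that subspace_scale[OF sub] lcomb_smul unfolding tensor_diff_lcomb by (smt (verit) imageE imageI)
  qed
qed

context
  fixes I :: "('n, 'k::field) mpoly set" and F
  assumes I: "monomial_ideal I" and res: "free_resolution I F"
begin

interpretation strand_resolution "monomials_in I" "rk F" "mdeg F" "strand_boundary F" "strand_aug F"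
  using I res by (rule strand_resolution_of_free_resolution)

lemma multihom: "multihomogeneous F" using res by (simp add: free_resolution_def)

lemma tensor_diff_tensor_diff: "tensor_diff F i (tensor_diff F (Suc i) v) = 0"
proof
  fix a
  let ?m = "mdeg F i a"
  let ?v = "degree_part F (Suc (Suc i)) ?m (\<lambda>b. if b < rk F (Suc (Suc i)) then v b else 0)"
  have v: "?v \<in> chain_space (rk F) (mdeg F) (Suc (Suc i)) ?m"
    by (rule degree_part_chains) (simp add: free_mod_def)
  have dv: "d (Suc i) ?v \<in> chain_space (rk F) (mdeg F) (Suc i) ?m"
    using v by (rule d_chains)
  have "degree_part F (Suc i) ?m (tensor_diff F (Suc i) v) = degree_part F (Suc i) ?m (d (Suc i) ?v)"
  proof
    fix b
    have "tensor_diff F (Suc i) v b = d (Suc i) ?v b" if "mdeg F (Suc i) b = ?m"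
      unfolding tensor_diff_eq[OF multihom] that lcomb_apply
      by (rule sum.cong) (auto simp: degree_part_def)
    then show "degree_part F (Suc i) ?m (tensor_diff F (Suc i) v) b = degree_part F (Suc i) ?m (d (Suc i) ?v) b"
      by (simp add: degree_part_def)
  qed
  then have "tensor_diff F i (tensor_diff F (Suc i) v) a = tensor_diff F i (d (Suc i) ?v) a"
    unfolding tensor_diff_eq[OF multihom] by simp
  also have "\<dots> = d i (d (Suc i) ?v) a" using tensor_diff_chain[OF multihom dv] .
  finally show "tensor_diff F i (tensor_diff F (Suc i) v) a = 0 a" by simp
qed

lemma boundaries_subset_cycles: "tensor_boundaries F i X \<subseteq> tensor_cycles F i X"
  using tensor_diff_part[OF multihom] tensor_diff_tensor_diff
  by (auto simp: tensor_boundaries_def tensor_cycles_def split: nat.splits)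

lemma lower_iff:
  assumes "v \<in> chain_space (rk F) (mdeg F) i m"
  shows "v \<in> lower_space (rk F) (mdeg F) i m \<longleftrightarrow> (\<forall>a. mdeg F i a = m \<longrightarrow> v a = 0)"
  using assms by (fastforce simp: chains_iff lower_space_iff order_less_le)

text \<open>\<open>degree_part\<close> identifies chains of degree \<open>\<le> m\<close> modulo
  lower ones with the degree-\<open>m\<close> part of the tensored complex, where
  \<open>hom_zero\<close> is exactness.\<close>

lemma cycles_subset_boundaries_iff:
  "tensor_cycles F i X \<subseteq> tensor_boundaries F i X \<longleftrightarrow> (\<forall>m\<in>X. hom_zero i m)"
proof
  assume sub: "tensor_cycles F i X \<subseteq> tensor_boundaries F i X"
  show "\<forall>m\<in>X. hom_zero i m"
    unfolding hom_zero_def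
  proof (intro ballI impI)
    fix m v assume m: "m \<in> X" and v: "v \<in> chain_space (rk F) (mdeg F) i m"
      and dv: "case i of 0 \<Rightarrow> True | Suc j \<Rightarrow> d j v \<in> lower_space (rk F) (mdeg F) j m"
    let ?v = "degree_part F i m v"
    have part: "?v \<in> tensor_part F i X"
      using chains_free_mod[OF v] m by (rule degree_part_tensor_part)
    have "?v \<in> tensor_cycles F i X"
    proof (cases i)
      case 0
      then show ?thesis using part by (simp add: tensor_cycles_def)
    next
      case (Suc j)
      have "tensor_diff F j ?v a = 0" for a
      proof (cases "mdeg F j a = m")
        case True
        have "tensor_diff F j ?v a = tensor_diff F j v a"
          unfolding tensor_diff_eq[OF multihom] True Suc degree_part_degree_part by simp
        also have "\<dots> = d j v a" by (rule tensor_diff_chain[OF multihom]) (use v True Suc in simp)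
        also have "\<dots> = 0" using dv True by (auto simp: Suc lower_space_iff)
        finally show ?thesis .
      next
        case False
        then show ?thesis
          unfolding tensor_diff_eq[OF multihom] Suc degree_part_degree_part by simp
      qed
      then have "tensor_diff F j ?v = 0" by (simp add: fun_eq_iff)
      then show ?thesis using part by (simp add: tensor_cycles_def Suc)
    qed
    with sub obtain u where u: "u \<in> tensor_part F (Suc i) X" "?v = tensor_diff F i u"
      unfolding tensor_boundaries_def by blast
    let ?u = "degree_part F (Suc i) m u"
    have uc: "?u \<in> chain_space (rk F) (mdeg F) (Suc i) m"
      using u(1) by (intro degree_part_chains) (simp add: tensor_part_def)
    moreover have "v - d i ?u \<in> lower_space (rk F) (mdeg F) i m"
      unfolding lower_iff[OF chains_diff[OF v d_chains[OF uc]]]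
    proof (intro allI impI)
      fix a assume a: "mdeg F i a = m"
      have "v a = tensor_diff F i u a" using fun_cong[OF u(2), of a] a by (simp add: degree_part_def)
      then show "(v - d i ?u) a = 0" by (simp add: tensor_diff_eq[OF multihom] a)
    qed
    ultimately show "\<exists>u\<in>chain_space (rk F) (mdeg F) (Suc i) m. v - d i u \<in> lower_space (rk F) (mdeg F) i m"
      by blast
  qed
next
  assume zero: "\<forall>m\<in>X. hom_zero i m"
  show "tensor_cycles F i X \<subseteq> tensor_boundaries F i X"
  proof
    fix v assume v: "v \<in> tensor_cycles F i X"
    then have part: "v \<in> tensor_part F i X" by (auto simp: tensor_cycles_def split: nat.splits)
    have vf: "v \<in> free_mod (rk F i)" using part by (simp add: tensor_part_def)
    have "\<exists>u\<in>chain_space (rk F) (mdeg F) (Suc i) m. degree_part F i m v - d i u \<in> lower_space (rk F) (mdeg F) i m"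
      if m: "m \<in> X" for m
    proof -
      have c: "degree_part F i m v \<in> chain_space (rk F) (mdeg F) i m" using vf by (rule degree_part_chains)
      have "case i of 0 \<Rightarrow> True | Suc j \<Rightarrow> d j (degree_part F i m v) \<in> lower_space (rk F) (mdeg F) j m"
      proof (cases i)
        case (Suc j)
        have dc: "d j (degree_part F i m v) \<in> chain_space (rk F) (mdeg F) j m"
          using c unfolding Suc by (rule d_chains)
        have "d j (degree_part F i m v) a = 0" if a: "mdeg F j a = m" for a
        proof -
          have "d j (degree_part F i m v) a = tensor_diff F j v a"
            by (simp add: tensor_diff_eq[OF multihom] a Suc)
          then show ?thesis using v by (simp add: tensor_cycles_def Suc)
        qed
        then show ?thesis using lower_iff[OF dc] by (simp add: Suc)
      qed simp
      with zero m c show ?thesis unfolding hom_zero_def by blast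
    qed
    then obtain u where u: "\<And>m. m \<in> X \<Longrightarrow> u m \<in> chain_space (rk F) (mdeg F) (Suc i) m"
      "\<And>m. m \<in> X \<Longrightarrow> degree_part F i m v - d i (u m) \<in> lower_space (rk F) (mdeg F) i m"
      by metis
    \<comment> \<open>Glue the solutions: each basis element takes its coefficient from the solution
      for its own degree.\<close>
    define U where "U b = (if mdeg F (Suc i) b \<in> X then u (mdeg F (Suc i) b) b else 0)" for b
    have "U \<in> tensor_part F (Suc i) X"
      unfolding tensor_part_iff
    proof (intro allI impI)
      fix b assume "U b \<noteq> 0"
      then have b: "mdeg F (Suc i) b \<in> X" "u (mdeg F (Suc i) b) b \<noteq> 0" by (auto simp: U_def split: if_splits)
      then show "b < rk F (Suc i) \<and> mdeg F (Suc i) b \<in> X" using u(1)[OF b(1)] by (auto simp: chains_iff)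
    qed
    moreover have "tensor_diff F i U = v"
    proof
      fix a
      show "tensor_diff F i U a = v a"
      proof (cases "mdeg F i a \<in> X")
        case True
        have "degree_part F (Suc i) (mdeg F i a) U = degree_part F (Suc i) (mdeg F i a) (u (mdeg F i a))"
          by (rule ext) (use True in \<open>simp add: degree_part_def U_def\<close>)
        then have "tensor_diff F i U a = tensor_diff F i (u (mdeg F i a)) a"
          by (simp add: tensor_diff_eq[OF multihom])
        also have "\<dots> = d i (u (mdeg F i a)) a"
          by (rule tensor_diff_chain[OF multihom u(1)[OF True]])
        also have "\<dots> = degree_part F i (mdeg F i a) v a"
        proof (rule ccontr)
          assume "d i (u (mdeg F i a)) a \<noteq> degree_part F i (mdeg F i a) v a"
          then have "(degree_part F i (mdeg F i a) v - d i (u (mdeg F i a))) a \<noteq> 0" by simp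
          then show False using u(2)[OF True] unfolding lower_space_iff by blast
        qed
        finally show ?thesis by (simp add: degree_part_def)
      next
        case False
        then have "degree_part F (Suc i) (mdeg F i a) U = 0"
          by (intro ext) (simp add: degree_part_def U_def)
        then have "tensor_diff F i U a = 0" by (simp add: tensor_diff_eq[OF multihom])
        moreover have "v a = 0" using part False by (auto simp: tensor_part_iff)
        ultimately show ?thesis by simp
      qed
    qed
    ultimately show "v \<in> tensor_boundaries F i X" unfolding tensor_boundaries_def by blast
  qed
qed

lemma kdim_homology_nonzero_iff:
  "kdim (tensor_cycles F i X) - kdim (tensor_boundaries F i X) \<noteq> 0 \<longleftrightarrow> (\<exists>m\<in>X. \<not> hom_zero i m)"
proof -
  have "tensor_cycles F i X \<subseteq> free_mod (rk F i)"
    by (auto simp: tensor_cycles_def tensor_part_def split: nat.splits)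
  from kdim_diff_nonzero_iff[OF this subspace_tensor_boundaries boundaries_subset_cycles]
  show ?thesis using cycles_subset_boundaries_iff by blast
qed

end

text \<open>All boundaries are lower, so modulo lower degrees every chain is a cycle and no basis
  element of degree \<open>m\<close> is a boundary.\<close>

lemma (in minimal_strand_resolution) hom_zero_iff: "hom_zero i m \<longleftrightarrow> (\<forall>b<r i. g i b \<noteq> m)"
proof
  assume zero: "hom_zero i m"
  show "\<forall>b<r i. g i b \<noteq> m"
  proof (intro allI impI notI)
    fix b assume b: "b < r i" "g i b = m"
    have u: "unit_vec b \<in> chain_space r g i m" using b by (intro unit_chains) auto
    have "case i of 0 \<Rightarrow> True | Suc j \<Rightarrow> d j (unit_vec b) \<in> lower_space r g j m"
      using d_minimal u by (auto split: nat.split)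
    with zero u obtain w where w: "w \<in> chain_space r g (Suc i) m" "unit_vec b - d i w \<in> lower_space r g i m"
      unfolding hom_zero_def by blast
    from lower_space_add[OF w(2) d_minimal[OF w(1)]]
    have "(unit_vec b :: nat \<Rightarrow> 'k) \<in> lower_space r g i m" by simp
    then show False using b by (auto simp: lower_space_iff unit_vec_apply dest: spec[of _ b])
  qed
next
  assume none: "\<forall>b<r i. g i b \<noteq> m"
  then have "v \<in> lower_space r g i m" if "v \<in> chain_space r g i m" for v :: "nat \<Rightarrow> 'k"
    using that by (auto simp: chains_iff lower_space_iff order_less_le)
  then show "hom_zero i m" unfolding hom_zero_def by (intro ballI impI bexI[of _ 0]) auto
qed

text \<open>All that the final counting uses, freed from the choice of a resolution. The clause on
  \<open>r 0\<close> distinguishes the unit ideal, for which every Betti number vanishes.\<close>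

lemma monomial_ideal_resolution:
  fixes I :: "('n::finite, 'k::field) mpoly set"
  assumes I: "monomial_ideal I"
  shows "\<exists>(r :: nat \<Rightarrow> nat) (g :: nat \<Rightarrow> nat \<Rightarrow> 'n monomial). (\<forall>i X. tor_dim I i X \<noteq> 0 \<longleftrightarrow> (\<exists>b<r i. g i b \<in> X)) \<and>
    (\<forall>i. \<forall>b<r i. g i b \<in> lcm_lattice I) \<and> (r 0 = 0 \<longrightarrow> (\<forall>i. r i = 0)) \<and>
    (\<forall>i j k z. 1 \<le> i \<longrightarrow> 1 \<le> j \<longrightarrow> k \<le> min i j \<longrightarrow> z < r (i + j - k) \<longrightarrow>
       (\<exists>a<r i. \<exists>b<r j. sup (g i a) (g j b) = g (i + j - k) z))"
proof -
  let ?J = "monomials_in I"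
  have transfer: "tor_dim I i X \<noteq> 0 \<longleftrightarrow> (\<exists>m\<in>X. \<not> strand_resolution.hom_zero r g D i m)"
    if res: "strand_resolution ?J r g D c" for r g D and c :: "nat \<Rightarrow> 'k" and i X
  proof -
    define F where "F = (SOME F. free_resolution I F)"
    have F: "free_resolution I F"
      unfolding F_def using free_resolution_of_strand_resolution[OF I res] by (rule someI_ex)
    have "tor_dim I i X = kdim (tensor_cycles F i X) - kdim (tensor_boundaries F i X)"
      by (simp add: tor_dim_def F_def Let_def)
    moreover have "strand_resolution.hom_zero (rk F) (mdeg F) (strand_boundary F) i m
        \<longleftrightarrow> strand_resolution.hom_zero r g D i m" for m
      using hom_zero_transfer[OF res strand_resolution_of_free_resolution[OF I F]]
        hom_zero_transfer[OF strand_resolution_of_free_resolution[OF I F] res] by blast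
    ultimately show ?thesis using kdim_homology_nonzero_iff[OF I F] by simp
  qed
  show ?thesis
  proof (cases "0 \<in> ?J")
    \<comment> \<open>Here \<open>1\<close> lies in the ideal, so \<open>S/I\<close> is zero and the
      zero complex resolves it.\<close>
    case True
    have "x \<in> ?J" for x using monomials_in_upset[OF I True, of x] by (simp add: le_fun_def)
    then have res: "strand_resolution ?J (\<lambda>_. 0) (\<lambda>_ _. 0) (\<lambda>_ _ _. 0 :: 'k) (\<lambda>_. 0)"
      by unfold_locales (auto simp: cyc_def chains_iff lcomb_def fun_eq_iff split: nat.split)
    have "strand_resolution.hom_zero (\<lambda>_. 0) (\<lambda>_ _. 0 :: 'n monomial) (\<lambda>_ _ _. 0 :: 'k) i m" for i m
      unfolding strand_resolution.hom_zero_def[OF res]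
      by (auto simp: chains_iff lower_space_iff lcomb_def)
    with transfer[OF res] show ?thesis by (intro exI[of _ "\<lambda>_. 0"] exI[of _ "\<lambda>_ _. 0"]) simp
  next
    case False
    obtain r g and D :: "nat \<Rightarrow> nat \<Rightarrow> nat \<Rightarrow> 'k" where
      min: "minimal_strand_resolution ?J r g D (\<lambda>_. 1)" and lcm: "\<forall>i. \<forall>b<r i. g i b \<in> lcm_lattice I"
    proof -
      have "\<exists>r g D. minimal_strand_resolution ?J r g D (\<lambda>_. 1 :: 'k) \<and> (\<forall>i. \<forall>b<r i. g i b \<in> lcm_lattice I)"
        by (rule minimal_resolution_exists[OF lcm_lattice_finite_retract(1)[OF I] monomials_in_upset[OF I]
              lcm_lattice_finite_retract(2)[OF I] _ False lcm_lattice_finite_retract(3)[OF I]])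
          (auto simp: le_fun_def)
      then show ?thesis using that by (elim exE conjE)
    qed
    interpret minimal_strand_resolution ?J r g D "\<lambda>_. 1" by fact
    have "tor_dim I i X \<noteq> 0 \<longleftrightarrow> (\<exists>b<r i. g i b \<in> X)" for i X
      using transfer[OF strand_resolution_axioms] hom_zero_iff by auto
    then show ?thesis using lcm r0 degree_splitting by (intro exI[of _ r] exI[of _ g]) simp
  qed
qed

section \<open>Subadditivity of degrees and submultiplicativity of counts\<close>

lemma total_degree_sup_le: "total_degree (sup a b) \<le> total_degree a + total_degree b"
  unfolding total_degree_def sum.distrib[symmetric] by (rule sum_mono) (simp add: sup_nat_def)

theorem theorem6p1:
  fixes I :: "('n::finite, 'k::field) mpoly set"
  assumes "monomial_ideal I"
  shows "(\<forall>i1 i2 k m. 1 \<le> i1 \<and> 1 \<le> i2 \<and> k \<le> min i1 i2 \<and> m \<in> lcm_lattice I \<and>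
            multi_betti I (i1 + i2 - k) m \<noteq> 0 \<longrightarrow>
            (\<exists>n1\<in>lcm_lattice I. \<exists>n2\<in>lcm_lattice I. n1 \<le> m \<and> n2 \<le> m \<and> m = sup n1 n2 \<and>
               multi_betti I i1 n1 \<noteq> 0 \<and> multi_betti I i2 n2 \<noteq> 0)) \<and>
         (\<forall>i1 i2 k. k \<le> min i1 i2 \<longrightarrow> t_max I (i1 + i2 - k) \<le> t_max I i1 + t_max I i2) \<and>
         (\<forall>i1 i2. a_num I (i1 + i2) \<le> a_num I i1 * a_num I i2)"
proof -
  obtain r :: "nat \<Rightarrow> nat" and g :: "nat \<Rightarrow> nat \<Rightarrow> 'n monomial" where
    tor: "\<forall>i X. tor_dim I i X \<noteq> 0 \<longleftrightarrow> (\<exists>b<r i. g i b \<in> X)"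
    and lcm: "\<forall>i. \<forall>b<r i. g i b \<in> lcm_lattice I"
    and r0: "r 0 = 0 \<longrightarrow> (\<forall>i. r i = 0)"
    and splitting: "\<forall>i j k z. 1 \<le> i \<longrightarrow> 1 \<le> j \<longrightarrow> k \<le> min i j \<longrightarrow> z < r (i + j - k) \<longrightarrow>
       (\<exists>a<r i. \<exists>b<r j. sup (g i a) (g j b) = g (i + j - k) z)"
    using monomial_ideal_resolution[OF assms] by (elim exE conjE) (rule that)
  note tor = tor[rule_format]
  \<comment> \<open>The multidegrees with nonzero Betti number; all three claims become statements
    about these finite sets.\<close>
  define N where "N i = g i ` {..<r i}" for i
  have finN: "finite (N i)" for i by (simp add: N_def)
  have multi: "multi_betti I i m \<noteq> 0 \<longleftrightarrow> m \<in> N i" for i m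
    unfolding multi_betti_def tor N_def by auto
  have graded: "graded_betti I i j \<noteq> 0 \<longleftrightarrow> j \<in> total_degree ` N i" for i j
    unfolding graded_betti_def tor N_def by auto
  have t_eq: "t_max I i = (if N i = {} then 0 else Max (total_degree ` N i))" for i
    unfolding t_max_def graded by auto
  have t_ge: "total_degree n \<le> t_max I i" if "n \<in> N i" for i n
    using that finN by (auto simp: t_eq)
  have a_eq: "a_num I i = card (N i)" for i unfolding a_num_def multi by simp
  have N_split: "\<exists>n1\<in>N i. \<exists>n2\<in>N j. sup n1 n2 = m"
    if ijk: "1 \<le> i" "1 \<le> j" "k \<le> min i j" and m: "m \<in> N (i + j - k)" for i j k m
  proof -
    obtain z where z: "z < r (i + j - k)" "m = g (i + j - k) z" using m by (auto simp: N_def)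
    then obtain a b where "a < r i" "b < r j" "sup (g i a) (g j b) = m"
      using splitting[rule_format, OF ijk z(1)] by blast
    then show ?thesis by (auto simp: N_def)
  qed
  show ?thesis
  proof (intro conjI allI impI)
    fix i1 i2 k m
    assume *: "1 \<le> i1 \<and> 1 \<le> i2 \<and> k \<le> min i1 i2 \<and> m \<in> lcm_lattice I \<and> multi_betti I (i1 + i2 - k) m \<noteq> 0"
    then have "m \<in> N (i1 + i2 - k)" using multi by blast
    with * obtain n1 n2 where n: "n1 \<in> N i1" "n2 \<in> N i2" "sup n1 n2 = m"
      using N_split[of i1 i2 k m] by blast
    then have "n1 \<in> lcm_lattice I" "n2 \<in> lcm_lattice I" using lcm by (auto simp: N_def)
    moreover have "n1 \<le> m" "n2 \<le> m" "m = sup n1 n2" using n(3) by auto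
    moreover have "multi_betti I i1 n1 \<noteq> 0" "multi_betti I i2 n2 \<noteq> 0" using n multi by blast+
    ultimately show "\<exists>n1\<in>lcm_lattice I. \<exists>n2\<in>lcm_lattice I. n1 \<le> m \<and> n2 \<le> m \<and> m = sup n1 n2 \<and>
               multi_betti I i1 n1 \<noteq> 0 \<and> multi_betti I i2 n2 \<noteq> 0"
      by blast
  next
    fix i1 i2 k :: nat assume k: "k \<le> min i1 i2"
    show "t_max I (i1 + i2 - k) \<le> t_max I i1 + t_max I i2"
    \<comment> \<open>An index \<open>0\<close> forces \<open>k = 0\<close>, so the left side is
      already one of the summands; for empty \<open>N\<close> it is \<open>0\<close>.\<close>
    proof (cases "i1 = 0 \<or> i2 = 0 \<or> N (i1 + i2 - k) = {}")
      case True
      then show ?thesis using k by (auto simp: t_eq)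
    next
      case False
      then have "Max (total_degree ` N (i1 + i2 - k)) \<in> total_degree ` N (i1 + i2 - k)"
        using finN by (intro Max_in) auto
      then obtain m where m: "m \<in> N (i1 + i2 - k)" "t_max I (i1 + i2 - k) = total_degree m"
        using False by (auto simp: t_eq)
      obtain n1 n2 where n: "n1 \<in> N i1" "n2 \<in> N i2" "sup n1 n2 = m"
        using N_split[of i1 i2 k m] False k m(1) by auto
      have "total_degree m \<le> total_degree n1 + total_degree n2"
        using total_degree_sup_le n(3) by metis
      also have "\<dots> \<le> t_max I i1 + t_max I i2" using t_ge n by (intro add_mono)
      finally show ?thesis by (simp add: m(2))
    qed
  next
    fix i1 i2
    show "a_num I (i1 + i2) \<le> a_num I i1 * a_num I i2"
    proof (cases "i1 = 0 \<or> i2 = 0")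
      case True
      \<comment> \<open>With an index \<open>0\<close>, the factor for homological degree
        \<open>0\<close> is at least \<open>1\<close> unless the left side is
        \<open>0\<close>.\<close>
      have "N 0 \<noteq> {} \<or> N (i1 + i2) = {}" using r0 by (auto simp: N_def)
      then have "1 \<le> card (N 0) \<or> card (N (i1 + i2)) = 0" using finN[of 0] by (auto simp: card_gt_0_iff Suc_le_eq)
      then show ?thesis using True by (auto simp: a_eq)
    next
      case False
      have "N (i1 + i2) \<subseteq> (\<lambda>(n1, n2). sup n1 n2) ` (N i1 \<times> N i2)"
      proof
        fix m assume "m \<in> N (i1 + i2)"
        then obtain n1 n2 where "n1 \<in> N i1" "n2 \<in> N i2" "sup n1 n2 = m"
          using N_split[of i1 i2 0 m] False by auto
        then show "m \<in> (\<lambda>(n1, n2). sup n1 n2) ` (N i1 \<times> N i2)" by force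
      qed
      then have "card (N (i1 + i2)) \<le> card ((\<lambda>(n1, n2). sup n1 n2) ` (N i1 \<times> N i2))"
        using finN by (intro card_mono) auto
      also have "\<dots> \<le> card (N i1 \<times> N i2)" using finN by (intro card_image_le) auto
      finally show ?thesis by (simp add: a_eq card_cartesian_product)
    qed
  qed
qed

end
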